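(* Let $M$ be a regular indecomposable module. Then the shift orbit $\{\sigma^tM : t\in\mathbb Z\}$ of $M$ contains a unique sink module $M_0$ with smallest possible radius; let $r_0=r_0(M)=r(M_0)$ and $M_i=\sigma^iM_0$ for all $i\in\mathbb Z$. Then $r_0\ge 1$, and there are an integer $b$ with $0\le b\le r_0$ and a path $(a_0,\dots,a_b)$ in $T(n)$ such that: (1) for every $i\ge 0$, $M_{-i}$ is a sink module with radius $r_0+i$ and center $a_0$; (2) for $1\le i\le b$, $M_i$ is a flow module with radius $r_0-1$ and center the edge $\{a_{i-1},a_i\}$; (3) for every $i\ge 0$, $M_{b+1+i}$ is a source module with radius $r_0+i$ and center $a_b$. Moreover, $a_0$ is a sink of the orientation of the quiver of which $M_0$ is a representation if $r_0$ is even, and a source of that orientation if $r_0$ is odd.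
   Context: Let $k$ be a field and $n\ge 3$ an integer. $T(n)$ denotes the $n$-regular tree (the infinite tree in which every vertex has exactly $n$ neighbours). A path of length $t\ge 0$ in $T(n)$ is a sequence $(a_0,\dots,a_t)$ of vertices with $a_{i-1},a_i$ neighbours for $1\le i\le t$ and $a_{i-1}\neq a_{i+1}$ for $1\le i<t$; $d(a,a')$ is the length of the unique path from $a$ to $a'$. A path of length $2r$ has center $a_r$ and radius $r$; a path of length $2r+1$ has center the edge $\{a_r,a_{r+1}\}$ and radius $r$. Fix a bipartite orientation $\Omega$ of $T(n)$ (every vertex is a sink or a source) and let $\sigma\Omega$ be the opposite orientation, $\sigma^2\Omega=\Omega$. A module is a finite-dimensional $k$-representation of the quiver $(T(n),\Omega)$ or of $(T(n),\sigma\Omega)$. The shift functor $\sigma$ is the composition of the Bernstein–Gelfand–Ponomarev reflection functors at all sinks; it maps $\mathrm{mod}(T(n),\Omega)\to\mathrm{mod}(T(n),\sigma\Omega)$ and $\mathrm{mod}(T(n),\sigma\Omega)\to\mathrm{mod}(T(n),\Omega)$; $\sigma^-$ denotes its left adjoint, and $\sigma^t$ for $t<0$ means $(\sigma^-)^{-t}$. An indecomposable module $M$ is regular if $\sigma^tM\neq 0$ for all $t\in\mathbb Z$. For an indecomposable module $M$, its support $T(M)$ is the full subgraph of $T(n)$ on the vertices $a$ with $M_a\neq 0$ (a finite tree). A diameter path of $M$ is a path in $T(M)$ of maximal length; this length is the diameter $d(M)$. All diameter paths of $M$ have the same center, called the center of $M$ (a vertex or an edge), and the radius of $M$ is $r(M)=\lfloor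 d(M)/2\rfloor$. $M$ is a sink module (resp. source module) if its diameter paths start and end in sinks (resp. sources) of the orientation of the quiver of which $M$ is a representation; $M$ is a flow module if $d(M)$ is odd. *)

theory Defs
  imports "Jordan_Normal_Form.Matrix"
begin

text \<open>Model of T(n): vertices are reduced words over the alphabet {0..<n}
 (no two consecutive letters equal), i.e. elements of the free product of n
 copies of Z/2Z; two words are adjacent iff one is obtained from the other by
 prepending one letter. Every vertex has exactly n neighbours.\<close>

definition tvert :: "nat \<Rightarrow> nat list \<Rightarrow> bool" where
  "tvert n v \<longleftrightarrow> set v \<subseteq> {..<n} \<and> (\<forall>i. Suc i < length v \<longrightarrow> v ! i \<noteq> v ! Suc i)"

definition tadj :: "nat \<Rightarrow> nat list \<Rightarrow> nat list \<Rightarrow> bool" where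
  "tadj n u w \<longleftrightarrow> tvert n u \<and> tvert n w \<and>
     ((w \<noteq> [] \<and> u = tl w) \<or> (u \<noteq> [] \<and> w = tl u))"

definition nbrs :: "nat \<Rightarrow> nat list \<Rightarrow> nat list list" where
  "nbrs n v = (if v = [] then map (\<lambda>x. [x]) [0..<n]
               else tl v # map (\<lambda>x. x # v) (filter (\<lambda>x. x \<noteq> hd v) [0..<n]))"

definition is_path :: "nat \<Rightarrow> nat list list \<Rightarrow> bool" where
  "is_path n p \<longleftrightarrow> p \<noteq> [] \<and> (\<forall>a\<in>set p. tvert n a) \<and>
     (\<forall>i. Suc i < length p \<longrightarrow> tadj n (p ! i) (p ! Suc i)) \<and>
     (\<forall>i. Suc (Suc i) < length p \<longrightarrow> p ! i \<noteq> p ! Suc (Suc i))"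

definition plen :: "nat list list \<Rightarrow> nat" where
  "plen p = length p - 1"

definition path_center :: "nat list list \<Rightarrow> nat list set" where
  "path_center p = (let r = plen p div 2 in
     if even (plen p) then {p ! r} else {p ! r, p ! Suc r})"

text \<open>Orientation parameter w :: bool.  In orientation w the sinks are the
 vertices whose length has parity given by w, all others are sources; arrows go
 from sources to sinks.  The two values of w are Omega and sigma Omega.\<close>

definition is_sink :: "bool \<Rightarrow> nat list \<Rightarrow> bool" where
  "is_sink w v \<longleftrightarrow> (even (length v) \<longleftrightarrow> w)"

definition is_source :: "bool \<Rightarrow> nat list \<Rightarrow> bool" where
  "is_source w v \<longleftrightarrow> \<not> is_sink w v"

text \<open>A module: an orientation, a dimension vector, and for every arrow x \<rightarrow> y
 (x source, y sink, adjacent) a (dimv y) x (dimv x) matrix arr x y.  Entries of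
 arr at non-arrows are irrelevant.\<close>

record 'k qmod =
  orient :: bool
  dimv :: "nat list \<Rightarrow> nat"
  arr :: "nat list \<Rightarrow> nat list \<Rightarrow> 'k mat"

definition is_arrow :: "nat \<Rightarrow> bool \<Rightarrow> nat list \<Rightarrow> nat list \<Rightarrow> bool" where
  "is_arrow n w x y \<longleftrightarrow> tadj n x y \<and> is_source w x \<and> is_sink w y"

definition valid_mod :: "nat \<Rightarrow> 'k qmod \<Rightarrow> bool" where
  "valid_mod n M \<longleftrightarrow> finite {v. dimv M v \<noteq> 0} \<and> (\<forall>v. \<not> tvert n v \<longrightarrow> dimv M v = 0) \<and>
     (\<forall>x y. is_arrow n (orient M) x y \<longrightarrow> arr M x y \<in> carrier_mat (dimv M y) (dimv M x))"

definition zero_mod :: "'k qmod \<Rightarrow> bool" where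
  "zero_mod M \<longleftrightarrow> (\<forall>v. dimv M v = 0)"

definition is_hom :: "nat \<Rightarrow> 'k::semiring_1 qmod \<Rightarrow> 'k qmod \<Rightarrow> (nat list \<Rightarrow> 'k mat) \<Rightarrow> bool" where
  "is_hom n M N f \<longleftrightarrow> orient M = orient N \<and>
     (\<forall>v. f v \<in> carrier_mat (dimv N v) (dimv M v)) \<and>
     (\<forall>x y. is_arrow n (orient M) x y \<longrightarrow> arr N x y * f x = f y * arr M x y)"

definition iso_mod :: "nat \<Rightarrow> 'k::semiring_1 qmod \<Rightarrow> 'k qmod \<Rightarrow> bool" where
  "iso_mod n M N \<longleftrightarrow> (\<exists>f g. is_hom n M N f \<and> is_hom n N M g \<and>
     (\<forall>v. g v * f v = 1\<^sub>m (dimv M v) \<and> f v * g v = 1\<^sub>m (dimv N v)))"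

definition dsum_mod :: "'k::zero qmod \<Rightarrow> 'k qmod \<Rightarrow> 'k qmod" where
  "dsum_mod X Y = \<lparr> orient = orient X, dimv = (\<lambda>v. dimv X v + dimv Y v),
     arr = (\<lambda>x y. four_block_mat (arr X x y) (0\<^sub>m (dimv X y) (dimv Y x))
                                 (0\<^sub>m (dimv Y y) (dimv X x)) (arr Y x y)) \<rparr>"

definition indecomposable :: "nat \<Rightarrow> 'k::field qmod \<Rightarrow> bool" where
  "indecomposable n M \<longleftrightarrow> valid_mod n M \<and> \<not> zero_mod M \<and>
     \<not> (\<exists>X Y. valid_mod n X \<and> valid_mod n Y \<and> orient X = orient M \<and> orient Y = orient M \<and>
            \<not> zero_mod X \<and> \<not> zero_mod Y \<and> iso_mod n M (dsum_mod X Y))"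

fun blk_idx :: "nat list \<Rightarrow> nat \<Rightarrow> nat \<times> nat" where
  "blk_idx [] c = (0, c)"
| "blk_idx (d # ds) c = (if c < d then (0, c) else (let (j, c') = blk_idx ds (c - d) in (Suc j, c')))"

definition blk_off :: "(nat list \<Rightarrow> nat) \<Rightarrow> nat list list \<Rightarrow> nat list \<Rightarrow> nat" where
  "blk_off d ys y = sum_list (map d (takeWhile (\<lambda>z. z \<noteq> y) ys))"

text \<open>phi: the map (+)_{y nbr x} M_y \<rightarrow> M_x at a sink x;
 psi: the map M_x \<rightarrow> (+)_{y nbr x} M_y at a source x.\<close>
definition phi_mat :: "nat \<Rightarrow> 'k qmod \<Rightarrow> nat list \<Rightarrow> 'k mat" where
  "phi_mat n M x = (let ys = nbrs n x; ds = map (dimv M) ys in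
     mat (dimv M x) (sum_list ds)
       (\<lambda>(i, c). let (j, c') = blk_idx ds c in arr M (ys ! j) x $$ (i, c')))"

definition psi_mat :: "nat \<Rightarrow> 'k qmod \<Rightarrow> nat list \<Rightarrow> 'k mat" where
  "psi_mat n M x = (let ys = nbrs n x; ds = map (dimv M) ys in
     mat (sum_list ds) (dimv M x)
       (\<lambda>(r, i). let (j, r') = blk_idx ds r in arr M x (ys ! j) $$ (r', i)))"

definition ker_choice :: "'k::field mat \<Rightarrow> nat \<times> 'k mat" where
  "ker_choice A = (SOME (k, B). B \<in> carrier_mat (dim_col A) k \<and>
     (\<forall>v\<in>carrier_vec (dim_col A). A *\<^sub>v v = 0\<^sub>v (dim_row A) \<longleftrightarrow> (\<exists>w\<in>carrier_vec k. v = B *\<^sub>v w)) \<and>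
     (\<forall>w\<in>carrier_vec k. \<forall>w'\<in>carrier_vec k. B *\<^sub>v w = B *\<^sub>v w' \<longrightarrow> w = w'))"

definition coker_choice :: "'k::field mat \<Rightarrow> nat \<times> 'k mat" where
  "coker_choice A = (SOME (c, C). C \<in> carrier_mat c (dim_row A) \<and>
     (\<forall>u\<in>carrier_vec c. \<exists>v\<in>carrier_vec (dim_row A). C *\<^sub>v v = u) \<and>
     (\<forall>v\<in>carrier_vec (dim_row A). C *\<^sub>v v = 0\<^sub>v c \<longleftrightarrow> (\<exists>w\<in>carrier_vec (dim_col A). v = A *\<^sub>v w)))"

text \<open>sigma: reflection at all sinks (simultaneously; sinks are pairwise non-adjacent).
 At a sink x the new space is the kernel of phi, and the new arrow x \<rightarrow> y is the
 y-component of the kernel inclusion.  The orientation is reversed.\<close>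
definition shift :: "nat \<Rightarrow> 'k::field qmod \<Rightarrow> 'k qmod" where
  "shift n M = (let w = orient M in
     \<lparr> orient = \<not> w,
       dimv = (\<lambda>v. if \<not> tvert n v then 0
                   else if is_sink w v then fst (ker_choice (phi_mat n M v)) else dimv M v),
       arr = (\<lambda>x y. if is_sink w x then
                 (let B = snd (ker_choice (phi_mat n M x)); off = blk_off (dimv M) (nbrs n x) y in
                  mat (dimv M y) (fst (ker_choice (phi_mat n M x))) (\<lambda>(i, l). B $$ (off + i, l)))
               else 0\<^sub>m 0 0) \<rparr>)"

text \<open>sigma^-: reflection at all sources, the left adjoint of sigma.  At a source x
 the new space is the cokernel of psi and the new arrow y \<rightarrow> x is the
 y-component of the cokernel projection.\<close>
definition shift_minus :: "nat \<Rightarrow> 'k::field qmod \<Rightarrow> 'k qmod" where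
  "shift_minus n M = (let w = orient M in
     \<lparr> orient = \<not> w,
       dimv = (\<lambda>v. if \<not> tvert n v then 0
                   else if is_source w v then fst (coker_choice (psi_mat n M v)) else dimv M v),
       arr = (\<lambda>y x. if is_source w x then
                 (let C = snd (coker_choice (psi_mat n M x)); off = blk_off (dimv M) (nbrs n x) y in
                  mat (fst (coker_choice (psi_mat n M x))) (dimv M y) (\<lambda>(i, l). C $$ (i, off + l)))
               else 0\<^sub>m 0 0) \<rparr>)"

definition shift_pow :: "nat \<Rightarrow> int \<Rightarrow> 'k::field qmod \<Rightarrow> 'k qmod" where
  "shift_pow n t M = (if t \<ge> 0 then (shift n ^^ nat t) M else (shift_minus n ^^ nat (- t)) M)"

definition regular :: "nat \<Rightarrow> 'k::field qmod \<Rightarrow> bool" where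
  "regular n M \<longleftrightarrow> indecomposable n M \<and> (\<forall>t. \<not> zero_mod (shift_pow n t M))"

definition supp :: "'k qmod \<Rightarrow> nat list set" where
  "supp M = {v. dimv M v \<noteq> 0}"

definition diam :: "nat \<Rightarrow> 'k qmod \<Rightarrow> nat" where
  "diam n M = Max {plen p | p. is_path n p \<and> set p \<subseteq> supp M}"

definition diam_paths :: "nat \<Rightarrow> 'k qmod \<Rightarrow> nat list list set" where
  "diam_paths n M = {p. is_path n p \<and> set p \<subseteq> supp M \<and> plen p = diam n M}"

definition radius :: "nat \<Rightarrow> 'k qmod \<Rightarrow> nat" where
  "radius n M = diam n M div 2"

definition has_center :: "nat \<Rightarrow> 'k qmod \<Rightarrow> nat list set \<Rightarrow> bool" where
  "has_center n M c \<longleftrightarrow> (\<forall>p\<in>diam_paths n M. path_center p = c)"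

definition sink_mod :: "nat \<Rightarrow> 'k qmod \<Rightarrow> bool" where
  "sink_mod n M \<longleftrightarrow> (\<forall>p\<in>diam_paths n M. is_sink (orient M) (hd p) \<and> is_sink (orient M) (last p))"

definition source_mod :: "nat \<Rightarrow> 'k qmod \<Rightarrow> bool" where
  "source_mod n M \<longleftrightarrow> (\<forall>p\<in>diam_paths n M. is_source (orient M) (hd p) \<and> is_source (orient M) (last p))"

definition flow_mod :: "nat \<Rightarrow> 'k qmod \<Rightarrow> bool" where
  "flow_mod n M \<longleftrightarrow> odd (diam n M)"

end

theory Submission
  imports Defs
begin

text \<open>Write \<open>X\<^sub>t\<close> for the set of sources in the support of \<open>\<sigma>\<^sup>t M\<close>.  A reflection keeps the
  sources and makes them sinks, so \<open>\<sigma>\<^sup>t M\<close> has support \<open>X\<^sub>t\<^sub>-\<^sub>1 \<union> X\<^sub>t\<close>; since a vertex outside the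
  support with a neighbour in the support enters it, and since the support is connected, the
  neighbourhood of \<open>X\<^sub>t\<close> is \<open>X\<^sub>t\<^sub>-\<^sub>1 \<union> X\<^sub>t\<^sub>+\<^sub>1\<close>.  Each \<open>X\<^sub>t\<close> has even diameter, hence a centre vertex
  \<open>c\<^sub>t\<close> and a radius \<open>\<rho>\<^sub>t\<close>, and \<open>\<sigma>\<^sup>t M\<close> is a sink, flow or source module according to whether
  \<open>\<rho>\<^sub>t - \<rho>\<^sub>t\<^sub>-\<^sub>1\<close> is \<open>-1\<close>, \<open>0\<close> or \<open>1\<close>.  As the neighbourhood of \<open>X\<^sub>t\<close> has centre \<open>c\<^sub>t\<close> and radius
  \<open>\<rho>\<^sub>t + 1\<close>, these differences never decrease, and while they vanish the centres run along a path.
  The length of that path is bounded because all outward descendants of an extreme point enter the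
  support during the flow phase, and \<open>n \<ge> 3\<close>.\<close>

section \<open>Discs and shift orbits in trees\<close>

text \<open>The chosen kernels and cokernels make \<open>shift\<close> after
  \<open>shift_minus\<close> the identity at best up to isomorphism, while the statement speaks of
  shifts of M_0, which are not literally shifts of M. This obstacle shapes the end of the proof.
  Only supports are followed, and two orbits are used: that of M locates M_0 and gives its
  minimality and uniqueness; that of M_0, started afresh, gives the path. They are compared only at
  the three consecutive source sets around M_0, which is enough to recognise the same valley of
  radii. The number r_0 is the least radius at the valley plus one, because the sinks of M_0 form a
  disc one larger than its sources. It also bounds b, since a plateau of radii that is any longer
  cannot occur. The parity of r_0 decides the colour of a_0 because some sink in the support is at
  distance exactly r_0 from it. Trees enter only through a distance for which each vertex other than
  c has exactly one neighbour nearer to c.\<close>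

locale tree_metric =
  fixes V :: "'a set" and adj :: "'a \<Rightarrow> 'a \<Rightarrow> bool" and d :: "'a \<Rightarrow> 'a \<Rightarrow> nat"
  assumes adj_in: "adj x y \<Longrightarrow> x \<in> V" and adj_sym: "adj x y \<Longrightarrow> adj y x"
    and d_sym: "x \<in> V \<Longrightarrow> y \<in> V \<Longrightarrow> d x y = d y x"
    and d_eq_0_iff: "x \<in> V \<Longrightarrow> y \<in> V \<Longrightarrow> d x y = 0 \<longleftrightarrow> x = y"
    and d_adj: "c \<in> V \<Longrightarrow> adj x y \<Longrightarrow> d c y = d c x + 1 \<or> d c x = d c y + 1"
    and closer_ex: "c \<in> V \<Longrightarrow> x \<in> V \<Longrightarrow> c \<noteq> x \<Longrightarrow> \<exists>y. adj x y \<and> d c x = d c y + 1"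
    and closer_unique:
      "c \<in> V \<Longrightarrow> adj x y \<Longrightarrow> adj x z \<Longrightarrow> d c x = d c y + 1 \<Longrightarrow> d c x = d c z + 1 \<Longrightarrow> y = z"
    and three_nbrs: "x \<in> V \<Longrightarrow> \<exists>y1 y2 y3. adj x y1 \<and> adj x y2 \<and> adj x y3 \<and>
      y1 \<noteq> y2 \<and> y1 \<noteq> y3 \<and> y2 \<noteq> y3"
begin

lemma adj_in2: "adj x y \<Longrightarrow> y \<in> V"
  using adj_in adj_sym by blast

lemma d_self [simp]: "x \<in> V \<Longrightarrow> d x x = 0"
  using d_eq_0_iff by blast

text \<open>Every vertex is reached from \<open>c\<close> by steps that increase the distance, so
  facts about distances can be carried outwards along one unspecified geodesic.\<close>

lemma outward_induct [consumes 2, case_names base step]: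
  assumes "c \<in> V" "x \<in> V" "P c"
    and step: "\<And>x y. adj x y \<Longrightarrow> d c y = d c x + 1 \<Longrightarrow> P x \<Longrightarrow> P y"
  shows "P x"
  using assms(2)
proof (induction "d c x" arbitrary: x)
  case 0 then show ?case using assms d_eq_0_iff by metis
next
  case (Suc k)
  then have "c \<noteq> x" by auto
  then obtain y where "adj x y" "d c x = d c y + 1" using closer_ex assms(1) Suc.prems by blast
  then show ?case using Suc adj_sym adj_in2 step by (metis Suc_eq_plus1 nat.inject)
qed

lemma triangle: "x \<in> V \<Longrightarrow> y \<in> V \<Longrightarrow> z \<in> V \<Longrightarrow> d x z \<le> d x y + d y z"
proof (rule outward_induct[of y z])
  fix u v assume "x \<in> V" "adj u v" "d y v = d y u + 1" "d x u \<le> d x y + d y u"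
  then show "d x v \<le> d x y + d y v" using d_adj[of x u v] by auto
qed auto

lemma d_parity: "x \<in> V \<Longrightarrow> y \<in> V \<Longrightarrow> z \<in> V \<Longrightarrow> even (d x z) \<longleftrightarrow> (even (d x y) \<longleftrightarrow> even (d y z))"
proof (rule outward_induct[of y z])
  fix u v assume "x \<in> V" "adj u v" "d y v = d y u + 1"
    "even (d x u) \<longleftrightarrow> (even (d x y) \<longleftrightarrow> even (d y u))"
  then show "even (d x v) \<longleftrightarrow> (even (d x y) \<longleftrightarrow> even (d y v))" using d_adj[of x u v]
    by (metis even_plus_one_iff)
qed auto

lemma adj_d: "adj x y \<Longrightarrow> d x y = 1"
  using d_adj[of x x y] adj_in adj_in2 by fastforce

lemma d_1_adj: "x \<in> V \<Longrightarrow> y \<in> V \<Longrightarrow> d x y = 1 \<Longrightarrow> adj x y"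
  using closer_ex[of x y] d_eq_0_iff adj_sym adj_in2
  by (metis One_nat_def add_right_cancel d_self numeral_1_eq_Suc_0 numeral_One zero_neq_one add_0)

lemma away_ex:
  assumes "c \<in> V" "x \<in> V"
  shows "\<exists>y. adj x y \<and> d c y = d c x + 1"
proof -
  obtain y1 y2 where "adj x y1" "adj x y2" "y1 \<noteq> y2" using three_nbrs assms by blast
  then show ?thesis using d_adj[OF assms(1)] closer_unique[OF assms(1)] by metis
qed

text \<open>At most one of three neighbours is nearer to \<open>c\<close>. This is where degree at
  least three matters: two outward directions at one vertex are what bounds the flow phase.\<close>

lemma away_ex2:
  assumes "c \<in> V" "x \<in> V" 
  shows "\<exists>y z. adj x y \<and> adj x z \<and> y \<noteq> z \<and> d c y = d c x + 1 \<and> d c z = d c x + 1"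
proof -
  obtain y1 y2 y3 where y: "adj x y1" "adj x y2" "adj x y3" "y1 \<noteq> y2" "y1 \<noteq> y3" "y2 \<noteq> y3"
    using three_nbrs assms by metis
  have away: "d c y = d c x + 1" if "adj x y" "d c x \<noteq> d c y + 1" for y
    using d_adj[OF assms(1) that(1)] that(2) by auto
  show ?thesis
  proof (cases "d c x = d c y1 + 1 \<or> d c x = d c y2 + 1")
    case True
    then have "d c x \<noteq> d c y3 + 1" using closer_unique[OF assms(1)] y by blast
    moreover have "d c x \<noteq> d c y1 + 1 \<or> d c x \<noteq> d c y2 + 1"
      using closer_unique[OF assms(1)] y by blast
    ultimately show ?thesis using away y by blast
  qed (use away y in blast)
qed

text \<open>The vertex \<open>x\<close> lies in the branch behind the edge from \<open>c\<close> to
  \<open>y\<close>, and \<open>u\<close> lies on the other side. Going outwards in that branch, a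
  step from \<open>x'\<close> towards \<open>u\<close> could only lead back to the predecessor of
  \<open>x'\<close>, because the nearer neighbour is unique.\<close>

lemma d_through_edge:
  assumes "u \<in> V" "adj c y" "d u y = d u c + 1" "x \<in> V" "d c x = d y x + 1"
  shows "d u x = d u c + d c x"
  using assms(4,5)
proof (induction "d y x" arbitrary: x rule: less_induct)
  case less
  have V: "c \<in> V" "y \<in> V" using assms adj_in adj_in2 by auto
  \<comment> \<open>A step towards \<open>y\<close> stays in the branch: the other sign would lower
    the distance to \<open>c\<close> by three in one step.\<close>
  have par: "d c z = d y z + 1" if "adj x' z" "d c x' = d y x' + 1" "d y x' = d y z + 1" for x' z
  proof -
    have "z \<in> V" using that adj_in2 by auto
    then have "d c z = d y z + 1 \<or> d y z = d c z + 1"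
      using d_adj[of z c y] V d_sym assms(2) by metis
    moreover have "d c z = d c x' + 1 \<or> d c x' = d c z + 1" using d_adj that V by blast
    ultimately show ?thesis using that by arith
  qed
  show ?case
  proof (cases "x = y")
    case True then show ?thesis using assms V adj_d by auto
  next
    case False
    obtain x' where x': "adj x x'" "d y x = d y x' + 1" using closer_ex V False less by metis
    have x'V: "x' \<in> V" using x' adj_in2 by auto
    have 1: "d c x' = d y x' + 1" using par x' less by auto
    have IH: "d u x' = d u c + d c x'" using less(1)[of x'] x' 1 x'V by auto
    have "d u x' \<noteq> d u x + 1"
    proof
      assume bk: "d u x' = d u x + 1"
      show False
      proof (cases "x' = y")
        case True
        then have "x = c"
          using closer_unique[of u y x c] x'(1) bk assms(1-3) adj_sym by metis
        then show False using less(3) V by simp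
      next
        case False
        obtain p where p: "adj x' p" "d y x' = d y p + 1" using closer_ex V False x'V by metis
        have pV: "p \<in> V" using p adj_in2 by auto
        have 2: "d c p = d y p + 1" using par p 1 by auto
        have "d u p = d u c + d c p" using less(1)[of p] x' p 2 pV by auto
        then have "d u x' = d u p + 1" using IH 1 2 p by simp
        then have "x = p" using closer_unique[of u x' x p] x' p adj_sym assms(1) bk by blast
        then show False using x' p by auto
      qed
    qed
    then have "d u x = d u x' + 1" using d_adj[of u x' x] x' adj_sym assms(1) by blast
    then show ?thesis using IH 1 less x' by simp
  qed
qed

text \<open>The first step from \<open>c\<close> towards \<open>x\<close> cannot approach both
  \<open>u\<close> and \<open>v\<close>, as this would shorten their distance. The end that it does
  not approach is seen from \<open>x\<close> through \<open>c\<close>.\<close>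

lemma between_branch:
  assumes V: "u \<in> V" "v \<in> V" "c \<in> V" "x \<in> V" and "d u v = d u c + d c v"
  shows "d x u = d x c + d c u \<or> d x v = d x c + d c v"
proof (cases "x = c")
  case False
  then obtain y where y: "adj c y" "d x c = d x y + 1" using closer_ex V by blast
  then have yV: "y \<in> V" using adj_in2 by auto
  have cx: "d c x = d y x + 1" using y V yV d_sym by auto
  have "\<not> (d u c = d u y + 1 \<and> d v c = d v y + 1)"
    using triangle[of u y v] assms yV d_sym by auto
  then consider "d u y = d u c + 1" | "d v y = d v c + 1" using d_adj V y by blast
  then show ?thesis using d_through_edge[of _ c y x] cx y V d_sym by (metis add.commute)
qed (use V in auto)

text \<open>By \<open>between_branch\<close> one end is seen from \<open>x\<close> through
  \<open>c\<close>, yet \<open>x\<close> is as close to that end as \<open>c\<close> is.\<close>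

lemma between_unique:
  assumes V: "u \<in> V" "v \<in> V" "c \<in> V" "x \<in> V"
    and "d u c + d c v = d u v" "d u x + d x v = d u v" "d u x = d u c"
  shows "x = c"
  using between_branch[of u v c x] assms d_sym d_eq_0_iff
  by (metis add_diff_cancel_left' add_diff_cancel_right' diff_self_eq_0)

section \<open>Centres and radii of vertex sets\<close>

definition nbhd :: "'a set \<Rightarrow> 'a set" where "nbhd X = {y. \<exists>x\<in>X. adj x y}"

text \<open>The pair at distance \<open>2 * r\<close> has \<open>c\<close> as its midpoint, so
  \<open>c\<close> and \<open>r\<close> are determined by \<open>X\<close>; an enclosing ball alone
  would not determine them.\<close>

definition disc :: "'a \<Rightarrow> nat \<Rightarrow> 'a set \<Rightarrow> bool" where
  "disc c r X \<longleftrightarrow> c \<in> V \<and> X \<subseteq> V \<and> (\<forall>x\<in>X. d c x \<le> r) \<and> (\<exists>u\<in>X. \<exists>v\<in>X. d u v = 2 * r)"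

lemma discD: "disc c r X \<Longrightarrow> c \<in> V" "disc c r X \<Longrightarrow> X \<subseteq> V" "disc c r X \<Longrightarrow> x \<in> X \<Longrightarrow> d c x \<le> r"
  "disc c r X \<Longrightarrow> X \<noteq> {}" "disc c r X \<Longrightarrow> x \<in> X \<Longrightarrow> x \<in> V"
  unfolding disc_def by auto

lemma disc_ends:
  assumes "disc c r X"
  obtains u v where "u \<in> X" "v \<in> X" "d u v = 2 * r" "d c u = r" "d c v = r"
proof -
  obtain u v where uv: "u \<in> X" "v \<in> X" "d u v = 2 * r" using assms unfolding disc_def by blast
  moreover have V: "u \<in> V" "v \<in> V" "c \<in> V" "d c u \<le> r" "d c v \<le> r"
    using uv assms unfolding disc_def by auto
  ultimately have "d c u = r \<and> d c v = r" using triangle[of u c v] d_sym[of u c] by auto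
  then show ?thesis using uv that by blast
qed

lemma disc_far:
  assumes "disc c r X" "x \<in> V"
  obtains u where "u \<in> X" "d c u = r" "d x u = d x c + r"
proof -
  obtain u v where uv: "u \<in> X" "v \<in> X" "d u v = 2 * r" "d c u = r" "d c v = r"
    using disc_ends assms by blast
  moreover have "u \<in> V" "v \<in> V" "c \<in> V" using uv assms discD(1,5) by blast+
  ultimately show ?thesis using between_branch[of u v c x] assms that d_sym by (metis mult_2)
qed

text \<open>One end of a diametral pair is seen from \<open>x\<close> through the centre. An
  enclosing ball about another point must therefore be larger by the distance of the two centres;
  most comparisons of radii and centres rest on this.\<close>

lemma disc_in_ball:
  assumes "disc c r X" "x \<in> V" "\<And>y. y \<in> X \<Longrightarrow> d x y \<le> s"
  shows "d x c + r \<le> s"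
  using disc_far[OF assms(1,2)] assms(3) by metis

text \<open>The ends of a diametral pair can each be pushed one step further apart.\<close>

lemma disc_nbhd:
  assumes "disc c r X"
  shows "disc c (r + 1) (nbhd X)"
proof -
  obtain u v where uv: "u \<in> X" "v \<in> X" "d u v = 2 * r" using assms unfolding disc_def by blast
  have V: "u \<in> V" "v \<in> V" using uv assms discD(5) by blast+
  obtain u' where u': "adj u u'" "d v u' = d v u + 1" using away_ex V by blast
  have u'V: "u' \<in> V" using u' adj_in2 by auto
  \<comment> \<open>The second step leads away from \<open>u'\<close> rather than from
    \<open>u\<close>, so that both gains add up.\<close>
  obtain v' where v': "adj v v'" "d u' v' = d u' v + 1" using away_ex V u'V by blast
  have "d u' v' = 2 * (r + 1)" using u' v' uv d_sym V u'V by auto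
  moreover have "u' \<in> nbhd X" "v' \<in> nbhd X" using u' v' uv unfolding nbhd_def by auto
  moreover have "d c y \<le> r + 1" if "y \<in> nbhd X" for y
    using that assms d_adj unfolding nbhd_def disc_def by fastforce
  ultimately show ?thesis using assms adj_in2 unfolding disc_def nbhd_def by blast
qed

text \<open>The centre is the midpoint of a pair at maximal distance, a vertex because that distance
  is even. By \<open>between_branch\<close>, a point further than \<open>r\<close> from it would be
  further than \<open>2 * r\<close> from one of the two ends.\<close>

lemma disc_ex:
  assumes "finite X" "X \<noteq> {}" "X \<subseteq> V" and mono: "\<And>x y. x \<in> X \<Longrightarrow> y \<in> X \<Longrightarrow> even (d x y)"
  shows "\<exists>c r. disc c r X"
proof -
  define D where "D = (\<lambda>(x, y). d x y) ` (X \<times> X)"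
  have "finite D" "D \<noteq> {}" using assms unfolding D_def by auto
  then have "Max D \<in> D" by (rule Max_in)
  then obtain u v where uv: "u \<in> X" "v \<in> X" "d u v = Max D" unfolding D_def by auto
  then obtain r where r: "d u v = 2 * r" using mono by blast
  have le: "d x y \<le> 2 * r" if "x \<in> X" "y \<in> X" for x y
    using that uv r \<open>finite D\<close>
      unfolding D_def by (metis (mono_tags, lifting) Max_ge SigmaI image_eqI split_conv)
  have V: "u \<in> V" "v \<in> V" using uv assms by auto
  have "\<exists>c\<in>V. d u c = k \<and> d c v = d u v - k" if "k \<le> d u v" for k
    using that
  proof (induction k)
    case 0 then show ?case using V by (intro bexI[of _ u]) auto
  next
    case (Suc k)
    then obtain c where c: "c \<in> V" "d u c = k" "d c v = d u v - k" by auto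
    then have "v \<noteq> c" using Suc V by auto
    then obtain c' where c': "adj c c'" "d v c = d v c' + 1" using closer_ex V c by metis
    have c'V: "c' \<in> V" using c' adj_in2 by auto
    have "d u v \<le> d u c' + d c' v" using triangle V c'V by auto
    then have "d u c' = Suc k" using d_adj[of u c c'] c' c V d_sym[of v] c'V by auto
    then show ?case using c c' c'V V d_sym[of v] by (intro bexI[of _ c']) auto
  qed
  from this[of r] obtain c where c: "c \<in> V" "d u c = r" "d c v = r" using r by auto
  have "d c x \<le> r" if "x \<in> X" for x
  proof -
    have "x \<in> V" using that assms(3) by auto
    then show ?thesis
      using between_branch[of u v c x] V c le[OF that uv(1)] le[OF that uv(2)] r
        d_sym[of x c] d_sym[of c u] by auto
  qed
  then show ?thesis using uv r c assms unfolding disc_def by blast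
qed

text \<open>The situation of the sinks and the sources in the support of an indecomposable representation.\<close>

definition linked :: "'a set \<Rightarrow> 'a set \<Rightarrow> bool" where
  "linked A B \<longleftrightarrow> A \<subseteq> nbhd B \<and> B \<subseteq> nbhd A \<and> (\<forall>x\<in>A. \<forall>y\<in>B. odd (d x y))"

lemma linked_sym: "linked A B \<Longrightarrow> linked B A"
  unfolding linked_def nbhd_def using d_sym adj_in adj_in2
  by (smt (verit) mem_Collect_eq subset_iff)

lemma nbhd_ball: "disc c r X \<Longrightarrow> y \<in> nbhd X \<Longrightarrow> d c y \<le> r + 1"
  using disc_nbhd discD(3) by blast

text \<open>\<open>A\<close> lies in the ball of radius \<open>s + 1\<close> about \<open>b\<close>.
  Together with the same inequality for exchanged roles this leaves two cases: radii differing by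
  one with equal centres, or equal radii with centres at distance at most one.\<close>

lemma linked_le: 
  assumes "linked A B" "disc a r A" "disc b s B"
  shows "d a b + r \<le> s + 1" 
proof -
  have "d b a + r \<le> s + 1"
    using disc_in_ball[OF assms(2) discD(1)[OF assms(3)], of "s + 1"] assms(1)
      nbhd_ball[OF assms(3)]
    unfolding linked_def by blast
  then show ?thesis using d_sym[of a b] assms discD(1) by metis
qed

lemma linked_eq_center:
  assumes "linked A B" "disc a r A" "disc b s B" "r \<noteq> s"
  shows "a = b" "r = s + 1 \<or> s = r + 1"
proof -
  have V: "a \<in> V" "b \<in> V" using assms discD by auto
  have "d a b + r \<le> s + 1" "d b a + s \<le> r + 1"
    using linked_le[OF assms(1-3)] linked_le[OF linked_sym[OF assms(1)] assms(3,2)] by auto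
  then have "d a b = 0 \<and> (r = s + 1 \<or> s = r + 1)" using assms(4) d_sym[of a b] V by auto
  then show "a = b" "r = s + 1 \<or> s = r + 1" using d_eq_0_iff V by auto
qed

text \<open>Equal centres are excluded by parity: points of \<open>A\<close> and \<open>B\<close> at
  distance \<open>r\<close> from a common centre would be at even distance from each other.\<close>

lemma linked_adj_center:
  assumes "linked A B" "disc a r A" "disc b r B"
  shows "adj a b"
proof -
  have V: "a \<in> V" "b \<in> V" using assms discD by auto
  have "d a b + r \<le> r + 1" using linked_le[OF assms] by auto
  moreover have "d a b \<noteq> 0"
  proof
    assume "d a b = 0"
    then have "a = b" using d_eq_0_iff V by auto
    obtain u where u: "u \<in> A" "d a u = r" using disc_ends assms(2) by metis
    obtain v where v: "v \<in> B" "d a v = r" using disc_ends assms(3) \<open>a = b\<close> by metis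
    have "odd (d u v)" using u v assms(1) unfolding linked_def by auto
    moreover have "u \<in> V" "v \<in> V" using u v assms discD(5) by blast+
    ultimately show False using d_parity[of u a v] d_sym[of u a] u v V by auto
  qed
  ultimately show ?thesis using d_1_adj V by auto
qed

text \<open>The recursion for three consecutive source sets. The neighbourhood of \<open>B\<close>
  has radius \<open>s + 1\<close>, and the ends of a diametral pair in it cannot both lie in the
  smaller set \<open>A\<close>, so \<open>C\<close> has to supply one. If \<open>r < s\<close>, then
  \<open>A\<close> is concentric with \<open>B\<close> and \<open>C\<close> supplies both ends. If
  all radii agree, a common centre of \<open>A\<close> and \<open>C\<close> would put the whole
  neighbourhood into a ball of radius \<open>s\<close>.\<close>

lemma next_radius:
  assumes "nbhd B = A \<union> C" "disc a r A" "disc b s B" "disc c t C" "linked A B" "linked C B" "r \<le> s"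
  shows "s \<le> t" "r < s \<Longrightarrow> t = s + 1" "r = s \<Longrightarrow> t = s \<Longrightarrow> a \<noteq> c"
proof -
  have V: "a \<in> V" "b \<in> V" "c \<in> V" using assms discD by auto
  obtain u v where uv: "u \<in> nbhd B" "v \<in> nbhd B" "d u v = 2 * (s + 1)" "d b u = s + 1"
    "d b v = s + 1"
    using disc_ends[OF disc_nbhd[OF assms(3)]] by metis
  have uvV: "u \<in> V" "v \<in> V" using uv disc_nbhd[OF assms(3)] discD(5) by blast+
  have notA: "\<not> (u \<in> A \<and> v \<in> A)"
  proof
    assume "u \<in> A \<and> v \<in> A"
    then have "d a u \<le> r" "d a v \<le> r" using assms discD by auto
    then show False using triangle[of u a v] d_sym[of u a] V uvV uv assms by auto
  qed
  have le: "s + d b c \<le> t + 1" 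
    using linked_le[OF linked_sym[OF assms(6)] assms(3,4)] by auto
  show "s \<le> t"
  proof (rule ccontr)
    assume "\<not> s \<le> t"
    then have "t < s" by auto
    then have "c = b" using linked_eq_center[OF assms(6,4,3)] by auto
    moreover obtain x where "x \<in> C" "d b x = s + 1" using notA uv assms(1) by auto
    ultimately show False using assms(4) discD(3) \<open>t < s\<close> by fastforce
  qed
  show "t = s + 1" if "r < s"
  proof -
    have "a = b" using linked_eq_center[OF assms(5,2,3)] that by auto
    then have "u \<notin> A" "v \<notin> A" using uv assms(2) discD(3) that by fastforce+
    then have uvC: "u \<in> C" "v \<in> C" using assms(1) uv by auto
    then have "d c u \<le> t" "d c v \<le> t" using assms discD by auto
    then have "s + 1 \<le> t" using triangle[of u c v] d_sym[of u c] V uvV uv by auto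
    then show ?thesis using linked_le[OF assms(6,4,3)] by auto
  qed
  show "a \<noteq> c" if "r = s" "t = s"
  proof
    assume "a = c"
    then have "d a x \<le> s" if "x \<in> nbhd B" for x using that assms discD(3) \<open>r = s\<close> \<open>t = s\<close> by blast
    then show False using disc_in_ball[OF disc_nbhd[OF assms(3)], of a s] V by fastforce
  qed
qed

section \<open>Non-backtracking paths and longest paths in a connected set\<close>

definition gpath :: "'a list \<Rightarrow> bool" where
  "gpath p \<longleftrightarrow> p \<noteq> [] \<and> set p \<subseteq> V \<and> (\<forall>i. Suc i < length p \<longrightarrow> adj (p ! i) (p ! Suc i)) \<and>
     (\<forall>i. Suc (Suc i) < length p \<longrightarrow> p ! i \<noteq> p ! Suc (Suc i))"

text \<open>A path without backtracking is a geodesic: if a step came back towards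
  \<open>p ! i\<close>, the vertices before and after it would both be the unique nearer
  neighbour.\<close>

lemma gpath_d:
  assumes "gpath p" "i \<le> j" "j < length p"
  shows "d (p ! i) (p ! j) = j - i"
  using assms(2,3)
proof (induction j rule: less_induct)
  case (less j)
  have V: "p ! k \<in> V" if "k < length p" for k using assms(1) that unfolding gpath_def by auto
  show ?case
  proof (cases "j = i")
    case True then show ?thesis using V less by auto
  next
    case False
    then obtain k where k: "j = Suc k" "i \<le> k"
      using less by (metis Suc_le_D le_neq_implies_less less_Suc_eq_le Suc_leI le_SucE)
    have IH: "d (p ! i) (p ! k) = k - i" using less k by auto
    have a: "adj (p ! k) (p ! j)" using assms(1) less k unfolding gpath_def by auto
    have "d (p ! i) (p ! k) \<noteq> d (p ! i) (p ! j) + 1"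
    proof (cases "k = i")
      case True then show ?thesis using V less k by auto
    next
      case False
      then obtain l where l: "k = Suc l" "i \<le> l"
        using k by (metis Suc_le_D le_neq_implies_less Suc_leI le_SucE)
      have "d (p ! i) (p ! l) = l - i" using less k l by auto
      moreover have "adj (p ! k) (p ! l)"
        using assms(1) less k l adj_sym unfolding gpath_def by auto
      moreover have "p ! l \<noteq> p ! j" using assms(1) less k l unfolding gpath_def by auto
      moreover have "p ! i \<in> V" using V less by auto
      moreover have "k - i = l - i + 1" using l by auto
      ultimately show ?thesis using closer_unique[of "p ! i" "p ! k" "p ! l" "p ! j"] IH a by metis
    qed
    then show ?thesis using d_adj[OF V a, of i] IH k less by auto
  qed
qed

lemma gpath_ends: 
  assumes "gpath p"
  shows "d (hd p) (last p) = length p - 1" 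
    "k < length p \<Longrightarrow> d (hd p) (p ! k) = k" "k < length p \<Longrightarrow> d (p ! k) (last p) = length p - 1 - k"
proof -
  have "p \<noteq> []" using assms unfolding gpath_def by auto
  then have h: "hd p = p ! 0" "last p = p ! (length p - 1)" "length p - 1 < length p"
    by (auto simp: hd_conv_nth last_conv_nth)
  show "d (hd p) (last p) = length p - 1"
    "k < length p \<Longrightarrow> d (hd p) (p ! k) = k" "k < length p \<Longrightarrow> d (p ! k) (last p) = length p - 1 - k"
    unfolding h using gpath_d[OF assms] h(3) by auto
qed

text \<open>Stated through subsets closed under adjacency, because such a subset of a support yields
  an idempotent endomorphism at once.\<close>

definition connected :: "'a set \<Rightarrow> bool" where
  "connected S \<longleftrightarrow> (\<forall>A\<subseteq>S. A \<noteq> {} \<longrightarrow> (\<forall>x\<in>A. \<forall>y\<in>S. adj x y \<longrightarrow> y \<in> A) \<longrightarrow> A = S)"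

text \<open>The set of end points of paths from \<open>u\<close> is closed under adjacency: a
  neighbour of the last vertex either prolongs the path or is its last vertex but one, and then the
  path is cut back.\<close>

lemma connected_path:
  assumes "connected S" "S \<subseteq> V" "u \<in> S" "v \<in> S"
  shows "\<exists>p. gpath p \<and> set p \<subseteq> S \<and> hd p = u \<and> last p = v"
proof -
  define A where "A = {v \<in> S. \<exists>p. gpath p \<and> set p \<subseteq> S \<and> hd p = u \<and> last p = v}"
  have "gpath [u]" using assms unfolding gpath_def by auto
  then have "u \<in> A" using assms unfolding A_def by force
  moreover have "y \<in> A" if xA: "x \<in> A" and y: "y \<in> S" and a: "adj x y" for x y
  proof -
    obtain p where p: "gpath p" "set p \<subseteq> S" "hd p = u" "last p = x" using xA unfolding A_def by auto
    then have ne: "p \<noteq> []" unfolding gpath_def by auto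
    have lastn: "p ! (length p - 1) = x" using p ne by (simp add: last_conv_nth)
    show "y \<in> A"
    proof (cases "length p \<ge> 2 \<and> p ! (length p - 2) = y")
      case True
      define q where "q = butlast p"
      have q: "length q = length p - 1" "q \<noteq> []" "set q \<subseteq> set p"
        "\<And>i. i < length q \<Longrightarrow> q ! i = p ! i"
        using True unfolding q_def
          by (auto simp: nth_butlast in_set_butlastD simp flip: length_0_conv)
      then have "gpath q" using p(1) unfolding gpath_def by auto
      moreover have "q ! (length q - 1) = p ! (length q - 1)" using q(2,4) by simp
      then have "last q = y" using q True by (simp add: last_conv_nth numeral_2_eq_2)
      moreover have "hd q = u" using q ne p by (metis hd_conv_nth length_greater_0_conv)
      ultimately show ?thesis using y p q unfolding A_def by blast
    next
      case False
      have "gpath (p @ [y])"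
        unfolding gpath_def
      proof (intro conjI allI impI)
        show "set (p @ [y]) \<subseteq> V" using p y assms by auto
        fix i assume i: "Suc i < length (p @ [y])"
        show "adj ((p @ [y]) ! i) ((p @ [y]) ! Suc i)"
        proof (cases "Suc i < length p")
          case True then show ?thesis using p unfolding gpath_def by (simp add: nth_append)
        next
          case False
          then have "i = length p - 1" "Suc i = length p" using i by auto
          then show ?thesis using a lastn ne by (simp add: nth_append)
        qed
      next
        fix i assume i: "Suc (Suc i) < length (p @ [y])"
        show "(p @ [y]) ! i \<noteq> (p @ [y]) ! Suc (Suc i)"
        proof (cases "Suc (Suc i) < length p")
          case True then show ?thesis using p unfolding gpath_def by (simp add: nth_append)
        next
          case F: False
          then have "i = length p - 2" "Suc (Suc i) = length p" using i by auto
          then show ?thesis using False by (auto simp: nth_append)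
        qed
      qed simp
      moreover have "hd (p @ [y]) = u" using p ne by simp
      ultimately show ?thesis using y p unfolding A_def by force
    qed
  qed
  moreover have "A \<subseteq> S" unfolding A_def by auto
  ultimately have "A = S" using assms(1) unfolding connected_def by blast
  then show ?thesis using assms(4) unfolding A_def by blast
qed

text \<open>A vertex without neighbour in the union would be a component of its own, although both
  classes are inhabited. Parity puts its neighbour into the other class.\<close>

lemma connected_linked:
  assumes "connected (A \<union> B)" "A \<noteq> {}" "B \<noteq> {}" "\<And>x y. x \<in> A \<Longrightarrow> y \<in> B \<Longrightarrow> odd (d x y)"
    "\<And>x y. x \<in> A \<Longrightarrow> y \<in> A \<Longrightarrow> even (d x y)" "\<And>x y. x \<in> B \<Longrightarrow> y \<in> B \<Longrightarrow> even (d x y)"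
    "A \<union> B \<subseteq> V"
  shows "linked A B"
proof -
  have "\<exists>y\<in>A \<union> B. adj x y" if "x \<in> A \<union> B" for x
  proof (rule ccontr)
    assume "\<not> ?thesis"
    then have "{x} = A \<union> B"
      using assms(1) that unfolding connected_def by (metis empty_not_insert insert_subset
      empty_subsetI singletonD)
    then have "x \<in> A" "x \<in> B" using assms(2,3) by auto
    then show False using assms(4,5) by blast
  qed
  then have "\<exists>y\<in>B. adj y x" if "x \<in> A" for x
    using that assms(5) adj_d adj_sym by (metis UnE UnI1 odd_one)
  moreover have "\<exists>y\<in>A. adj y x" if "x \<in> B" for x
    using that assms(6) adj_d adj_sym \<open>\<And>x. x \<in> A \<union> B \<Longrightarrow> \<exists>y\<in>A \<union> B. adj x y\<close>
      by (metis UnE UnI2 odd_one)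
  ultimately show ?thesis using assms(4) unfolding linked_def nbhd_def by auto
qed

text \<open>Everything lies in the ball of radius \<open>r\<close> about \<open>c\<close>. A path of
  maximal length has both ends on its sphere, which \<open>B\<close> does not reach, and
  \<open>c\<close> is its midpoint. Lists count vertices, hence \<open>2 * r + 1\<close>.\<close>

lemma even_center_paths:
  assumes "connected (A \<union> B)" "disc c r A" "disc c s B" "s < r"
  shows "\<exists>p. gpath p \<and> set p \<subseteq> A \<union> B \<and> length p = 2 * r + 1"
    "gpath p \<Longrightarrow> set p \<subseteq> A \<union> B \<Longrightarrow> length p \<le> 2 * r + 1"
    "gpath p \<Longrightarrow> set p \<subseteq> A \<union> B \<Longrightarrow> length p = 2 * r + 1 \<Longrightarrow> p ! r = c \<and> hd p \<in> A \<and> last p \<in> A"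
proof -
  have V: "A \<union> B \<subseteq> V" "c \<in> V" using assms discD by auto
  have ball: "d c x \<le> r" if "x \<in> A \<union> B" for x using that assms discD(3) by fastforce
  obtain u v where uv: "u \<in> A" "v \<in> A" "d u v = 2 * r" using assms(2) unfolding disc_def by blast
  then obtain p where p: "gpath p" "set p \<subseteq> A \<union> B" "hd p = u" "last p = v"
    using connected_path[OF assms(1) V(1)] by blast
  then have "length p = 2 * r + 1"
    using gpath_ends(1)[of p] uv unfolding gpath_def by (cases p) auto
  then show "\<exists>p. gpath p \<and> set p \<subseteq> A \<union> B \<and> length p = 2 * r + 1" using p by blast
next
  have V: "A \<union> B \<subseteq> V" "c \<in> V" using assms discD by auto
  have ball: "d c x \<le> r" if "x \<in> A \<union> B" for x using that assms discD(3) by fastforce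
  assume p: "gpath p" "set p \<subseteq> A \<union> B"
  then have "p \<noteq> []" unfolding gpath_def by auto
  then have hl: "hd p \<in> A \<union> B" "last p \<in> A \<union> B" using p hd_in_set last_in_set by blast+
  then have hlV: "hd p \<in> V" "last p \<in> V" using V by auto
  have tri: "length p - 1 \<le> d c (hd p) + d c (last p)"
    using triangle[of "hd p" c "last p"] d_sym[of c "hd p"] V(2) hlV gpath_ends(1)[OF p(1)] by auto
  then show "length p \<le> 2 * r + 1" using ball[OF hl(1)] ball[OF hl(2)] by auto
  assume len: "length p = 2 * r + 1"
  then have h: "d c (hd p) = r" "d c (last p) = r" using tri ball[OF hl(1)] ball[OF hl(2)] by auto
  then have "hd p \<notin> B" "last p \<notin> B" using assms(3,4) discD(3) by fastforce+
  moreover have "c = p ! r"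
  proof (rule between_unique[of "hd p" "last p"])
    show "p ! r \<in> V" using p V len by (auto intro!: subsetD[OF V(1)] subsetD[OF p(2)])
  qed (use hlV V gpath_ends[OF p(1)] len h d_sym in auto)
  ultimately show "p ! r = c \<and> hd p \<in> A \<and> last p \<in> A" using hl by auto
qed

text \<open>Two points of one class are at distance at most \<open>2 * r\<close>, so a longest path
  joins the two classes across the edge from \<open>a\<close> to \<open>b\<close>. It may be
  traversed in either direction, which is why its middle is given as a set.\<close>

lemma odd_center_paths:
  assumes "connected (A \<union> B)" "disc a r A" "disc b r B" "linked A B"
  shows "\<exists>p. gpath p \<and> set p \<subseteq> A \<union> B \<and> length p = 2 * r + 2"
    "gpath p \<Longrightarrow> set p \<subseteq> A \<union> B \<Longrightarrow> length p \<le> 2 * r + 2"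
    "gpath p \<Longrightarrow> set p \<subseteq> A \<union> B \<Longrightarrow> length p = 2 * r + 2 \<Longrightarrow> {p ! r, p ! Suc r} = {a, b}"
proof -
  have V: "A \<union> B \<subseteq> V" "a \<in> V" "b \<in> V" using assms discD by auto
  have ab: "adj a b" using linked_adj_center assms by blast
  have dab: "d a b = 1" "d b a = 1" using adj_d ab adj_sym by auto
  obtain u where u: "u \<in> A" "d a u = r" "d b u = r + 1"
    using disc_far[OF assms(2) V(3)] dab by (metis add.commute)
  obtain v where v: "v \<in> B" "d b v = r" "d a v = r + 1"
    using disc_far[OF assms(3) V(2)] dab by (metis add.commute)
  have uvV: "u \<in> V" "v \<in> V" using u v V by auto
  have uv: "d u v = 2 * r + 1"
    using d_through_edge[OF uvV(1) ab _ uvV(2)] u v d_sym[of u a] d_sym[of u b] V uvV by auto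
  obtain p where p: "gpath p" "set p \<subseteq> A \<union> B" "hd p = u" "last p = v"
    using connected_path[OF assms(1) V(1)] u v by blast
  then have "length p = 2 * r + 2"
    using gpath_ends(1)[of p] uv unfolding gpath_def by (cases p) auto
  then show "\<exists>p. gpath p \<and> set p \<subseteq> A \<union> B \<and> length p = 2 * r + 2" using p by blast
next
  have V: "A \<union> B \<subseteq> V" "a \<in> V" "b \<in> V" using assms discD by auto
  have ab: "adj a b" using linked_adj_center assms by blast
  have dab: "d a b = 1" "d b a = 1" using adj_d ab adj_sym by auto
  have upper: "d x y \<le> 2 * r" if "x \<in> X" "y \<in> X" "disc c r X" "c \<in> V" for x y c X
    using triangle[of x c y] discD[OF that(3)] that d_sym[of x c]
      by (metis add_mono mult_2 order_trans)
  \<comment> \<open>Equality in the triangle inequalities fixes the distances of both ends to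
    \<open>a\<close> and to \<open>b\<close>, and these determine the two middle vertices.\<close>
  have mixed:
    "d x y \<le> 2 * r + 1 \<and> (d x y = 2 * r + 1 \<longrightarrow> d a x = r \<and> d a y = r + 1 \<and> d b y = r \<and> d b x = r + 1)"
    if "x \<in> A" "y \<in> B" for x y
  proof -
    have xy: "x \<in> V" "y \<in> V" using that V by auto
    have "d a x \<le> r" "d b y \<le> r" using that assms discD by auto
    then show ?thesis
      using triangle[of x a y] triangle[of a b y] triangle[of x b y] triangle[of b a x]
        d_sym[of x a] d_sym[of x b] xy V dab by auto
  qed
  assume p: "gpath p" "set p \<subseteq> A \<union> B"
  then have ne: "p \<noteq> []" unfolding gpath_def by auto
  then have hl: "hd p \<in> A \<union> B" "last p \<in> A \<union> B" using p hd_in_set last_in_set by blast+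
  then have hlV: "hd p \<in> V" "last p \<in> V" using V by auto
  have le: "d x y \<le> 2 * r + 1" if "x \<in> A \<union> B" "y \<in> A \<union> B" for x y
    using that mixed[of x y] mixed[of y x] upper[OF _ _ assms(2) V(2), of x y]
      upper[OF _ _ assms(3) V(3), of x y] d_sym[of x y] V(1)
      by (metis UnE le_SucI Suc_eq_plus1 subsetD)
  have dl: "d (hd p) (last p) = length p - 1" using gpath_ends(1)[OF p(1)] .
  then show "length p \<le> 2 * r + 2" using le[OF hl] by auto
  assume len: "length p = 2 * r + 2"
  have mem: "p ! r \<in> V" "p ! Suc r \<in> V"
    using p V len by (auto intro!: subsetD[OF V(1)] subsetD[OF p(2)])
  have dlen: "d (hd p) (last p) = 2 * r + 1" "d (last p) (hd p) = 2 * r + 1"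
    using dl len d_sym[OF hlV] by auto
  have ends: "d (hd p) (p ! r) = r" "d (p ! r) (last p) = r + 1"
    "d (hd p) (p ! Suc r) = r + 1" "d (p ! Suc r) (last p) = r"
    using gpath_ends[OF p(1)] len by auto
  have notboth: "\<not> (hd p \<in> A \<and> last p \<in> A)" "\<not> (hd p \<in> B \<and> last p \<in> B)"
    using upper[OF _ _ assms(2) V(2)] upper[OF _ _ assms(3) V(3)] dlen by fastforce+
  then consider "hd p \<in> A" "last p \<in> B" | "hd p \<in> B" "last p \<in> A" using hl by blast
  then show "{p ! r, p ! Suc r} = {a, b}"
  proof cases
    case 1
    then have "d a (hd p) = r" "d a (last p) = r + 1" "d b (last p) = r" "d b (hd p) = r + 1"
      using mixed dlen by auto
    then have "p ! r = a" "p ! Suc r = b"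
      using between_unique[OF hlV _ mem(1), of a] between_unique[OF hlV _ mem(2), of b]
        ends dlen V d_sym hlV by auto
    then show ?thesis by simp
  next
    case 2
    then have "d a (last p) = r" "d a (hd p) = r + 1" "d b (hd p) = r" "d b (last p) = r + 1"
      using mixed[OF 2(2,1)] dlen by auto
    then have "p ! r = b" "p ! Suc r = a"
      using between_unique[OF hlV _ mem(1), of b] between_unique[OF hlV _ mem(2), of a]
        ends dlen V d_sym hlV by auto
    then show ?thesis by auto
  qed
qed

section \<open>Radii and centres along a shift orbit\<close>

lemma extend_away: "c \<in> V \<Longrightarrow> z \<in> V \<Longrightarrow> \<exists>y\<in>V. d c y = d c z + k \<and> d z y = k"
proof (induction k)
  case 0 then show ?case by auto
next
  case (Suc k)
  then obtain y where y: "y \<in> V" "d c y = d c z + k" "d z y = k" by auto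
  obtain y' where y': "adj y y'" "d c y' = d c y + 1" using away_ex Suc y by blast
  have "y' \<in> V" using y' adj_in2 by auto
  moreover have "d z y' = Suc k"
    using d_adj[of z y y'] y' y triangle[of c z y'] Suc \<open>y' \<in> V\<close> by auto
  ultimately show ?case using y y' by (intro bexI[of _ y']) auto
qed

text \<open>\<open>X i\<close> stands for the sources in the support of the \<open>i\<close>-th shift; its sinks are \<open>X (i - 1)\<close>.\<close>

definition orbit :: "(int \<Rightarrow> 'a set) \<Rightarrow> (int \<Rightarrow> 'a) \<Rightarrow> (int \<Rightarrow> nat) \<Rightarrow> bool" where
  "orbit X c \<rho> \<longleftrightarrow> (\<forall>i. disc (c i) (\<rho> i) (X i)) \<and> (\<forall>i. nbhd (X i) = X (i - 1) \<union> X (i + 1)) \<and>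
     (\<forall>i j. \<forall>x\<in>X i. \<forall>y\<in>X j. even (d x y) \<longleftrightarrow> even (i - j))"

lemma orbit_linked:
  assumes "orbit X c \<rho>" "j = i + 1 \<or> i = j + 1"
  shows "linked (X i) (X j)"
proof -
  have *: "linked (X i) (X (i + 1))" for i
  proof -
    have "nbhd (X i) = X (i - 1) \<union> X (i + 1)" "nbhd (X (i + 1)) = X i \<union> X (i + 2)"
      using assms(1) unfolding orbit_def by (auto simp: add.assoc)
    moreover have "odd (d x y)" if "x \<in> X i" "y \<in> X (i + 1)" for x y
      using that assms(1) unfolding orbit_def
        by (metis add_diff_cancel_left' dvd_diff_commute odd_one)
    ultimately show ?thesis unfolding linked_def by auto
  qed
  then show ?thesis using assms(2) linked_sym by auto
qed

text \<open>The two neighbours of \<open>i\<close> form an unordered pair, so that one recursion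
  runs both forwards and backwards in time.\<close>

lemma orbit_next:
  assumes "orbit X c \<rho>" "{j, k} = {i - 1, i + 1}" "\<rho> j \<le> \<rho> i"
  shows "\<rho> i \<le> \<rho> k" "\<rho> j < \<rho> i \<Longrightarrow> \<rho> k = \<rho> i + 1" "\<rho> j = \<rho> i \<Longrightarrow> \<rho> k = \<rho> i \<Longrightarrow> c j \<noteq> c k"
proof -
  have "j = i - 1 \<and> k = i + 1 \<or> j = i + 1 \<and> k = i - 1"
    using assms(2) by (auto simp: doubleton_eq_iff)
  then have N: "nbhd (X i) = X j \<union> X k" "linked (X j) (X i)" "linked (X k) (X i)"
    using assms(1) orbit_linked[OF assms(1)] unfolding orbit_def by auto
  have D: "disc (c j) (\<rho> j) (X j)" for j using assms(1) unfolding orbit_def by auto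
  then show "\<rho> i \<le> \<rho> k" "\<rho> j < \<rho> i \<Longrightarrow> \<rho> k = \<rho> i + 1" "\<rho> j = \<rho> i \<Longrightarrow> \<rho> k = \<rho> i \<Longrightarrow> c j \<noteq> c k"
    using next_radius[OF N(1) D D D N(2,3) assms(3)] by blast+
qed

lemma orbit_step:
  assumes "orbit X c \<rho>"
  shows "\<rho> i \<noteq> \<rho> (i + 1) \<Longrightarrow> c i = c (i + 1)"
  "\<rho> i = \<rho> (i + 1) + 1 \<or> \<rho> i = \<rho> (i + 1) \<or> \<rho> (i + 1) = \<rho> i + 1"
    "\<rho> i = \<rho> (i + 1) \<Longrightarrow> adj (c i) (c (i + 1))"
proof -
  have l: "linked (X i) (X (i + 1))" using orbit_linked[OF assms] by blast
  have D: "disc (c j) (\<rho> j) (X j)" for j using assms unfolding orbit_def by auto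
  show "\<rho> i \<noteq> \<rho> (i + 1) \<Longrightarrow> c i = c (i + 1)"
    "\<rho> i = \<rho> (i + 1) + 1 \<or> \<rho> i = \<rho> (i + 1) \<or> \<rho> (i + 1) = \<rho> i + 1"
    "\<rho> i = \<rho> (i + 1) \<Longrightarrow> adj (c i) (c (i + 1))"
    using linked_eq_center[OF l D D] linked_adj_center[OF l D] D by metis+
qed

text \<open>A constant run of radii moves the centre outwards, while every outward descendant of an
  extreme point enters the support; after more than \<open>\<rho>\<close> steps the descendants through two different
  children of that point can no longer lie in one ball around the centre.\<close>

lemma orbit_no_long_run:
  assumes O: "orbit X c \<rho>" and run: "\<And>k. k \<le> \<rho> i + 2 \<Longrightarrow> \<rho> (i + int k) = \<rho> i"
  shows False
proof -
  define R where "R = \<rho> i"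
  define C where "C k = c (i + int k)" for k
  define Y where "Y k = X (i + int k)" for k
  have D: "disc (C k) R (Y k)" if "k \<le> R + 2" for k
    using O run[of k] that unfolding orbit_def C_def Y_def R_def by metis
  have CV: "C k \<in> V" for k using O discD unfolding orbit_def C_def by blast
  have CS: "adj (C k) (C (Suc k))" if "Suc k \<le> R + 2" for k
  proof -
    have "linked (Y k) (Y (Suc k))" unfolding Y_def by (rule orbit_linked[OF O]) auto
    then show ?thesis using linked_adj_center D that by (meson Suc_leD)
  qed
  have Cd: "d (C 0) (C k) \<le> k" if "k \<le> R + 2" for k
    using that
  proof (induction k)
    case 0 then show ?case using CV by auto
  next
    case (Suc k) then show ?case using d_adj[OF CV[of 0] CS[of k]] by auto
  qed
  have N: "nbhd (Y (Suc k)) = Y k \<union> Y (Suc (Suc k))" for k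
    using O unfolding orbit_def Y_def by (auto simp: algebra_simps)
  \<comment> \<open>The centre has moved by one step, so a point of \<open>Y 1\<close> opposite to
    \<open>C 0\<close> is at distance \<open>R + 1\<close> from \<open>C 0\<close>.\<close>
  have "d (C 0) (C 1) = 1" using adj_d CS[of 0] by auto
  then obtain e where e: "e \<in> Y 1" "d (C 0) e = R + 1"
    using disc_far[OF D[of 1] CV[of 0]] by auto
  have eV: "e \<in> V" using e D[of 1] discD(5) by auto
  have desc: "y \<in> Y (Suc k)" if "k \<le> R + 1" "y \<in> V" "d (C 0) y = R + 1 + k" "d e y = k" for k y
    using that
  proof (induction k arbitrary: y)
    case 0 then show ?case using e eV d_eq_0_iff by auto
  next
    case (Suc k)
    then have "e \<noteq> y" using eV by auto
    then obtain x where x: "adj y x" "d e y = d e x + 1" using closer_ex eV Suc by blast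
    have xV: "x \<in> V" using x adj_in2 by auto
    have "d (C 0) x \<le> R + 1 + k" using triangle[OF CV[of 0] eV xV] e x Suc by auto
    then have "d (C 0) x = R + 1 + k" using d_adj[OF CV[of 0] x(1)] Suc by auto
    then have "x \<in> Y (Suc k)" using Suc x xV by auto
    then have "y \<in> Y k \<union> Y (Suc (Suc k))" using N[of k] x adj_sym unfolding nbhd_def by auto
    \<comment> \<open>The distance from \<open>C 0\<close> to \<open>y\<close> is
      \<open>R + k + 2\<close>, out of reach of a ball of radius \<open>R\<close> whose centre is
      within \<open>k\<close> of \<open>C 0\<close>.\<close>
    moreover have "y \<notin> Y k"
    proof
      assume "y \<in> Y k"
      then have "d (C k) y \<le> R" using D[of k] discD(3) Suc by auto
      then show False using triangle[OF CV[of 0] CV[of k] Suc(3)] Cd[of k] Suc by auto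
    qed
    ultimately show ?case by auto
  qed
  \<comment> \<open>A descendant \<open>y\<close> through \<open>z\<close>, at depth
    \<open>R + 1\<close> below \<open>e\<close>, enters \<open>Y (R + 2)\<close>. Its distance
    \<open>2 * R + 2\<close> from \<open>C 0\<close> is the sum of the bounds \<open>R + 2\<close>
    and \<open>R\<close> for the two parts of the way through \<open>C (R + 2)\<close>, so this
    centre lies on the geodesic at the place of \<open>z\<close>. Hence the length demanded of the
    run.\<close>
  have child: "z = C (R + 2)" if z: "adj e z" "d (C 0) z = d (C 0) e + 1" for z
  proof -
    have zV: "z \<in> V" using z adj_in2 by auto
    obtain y where y: "y \<in> V" "d (C 0) y = d (C 0) z + R" "d z y = R"
      using extend_away CV zV by blast
    have "d e y \<le> R + 1" using triangle[OF eV zV y(1)] adj_d[OF z(1)] y by auto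
    moreover have far: "d (C 0) y = R + 1 + (R + 1)" using y(2) z(2) e(2) by linarith
    then have "R + 1 \<le> d e y" using triangle[OF CV[of 0] eV y(1)] e(2) by linarith
    ultimately have "d e y = R + 1" by linarith
    then have "y \<in> Y (Suc (R + 1))" using desc[OF _ y(1) far] by blast
    then have "y \<in> Y (R + 2)" by simp
    then have "d (C (R + 2)) y \<le> R" using discD(3)[OF D] by blast
    moreover have "d (C 0) (C (R + 2)) \<le> R + 2" using Cd by auto
    ultimately have "d (C 0) (C (R + 2)) = R + 2 \<and> d (C (R + 2)) y = R"
      using triangle[OF CV[of 0] CV[of "R + 2"] y(1)] y z e by auto
    then show ?thesis using between_unique[OF CV[of 0] y(1) CV[of "R + 2"] zV] y z e by auto
  qed
  show False using away_ex2[OF CV[of 0] eV] child by metis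
qed

text \<open>Without any descent the radii would be constant on the whole past of an index where they
  are least, against \<open>orbit_no_long_run\<close>. Among the descents one with smallest final
  radius is taken; a further descent right after it would contradict this choice.\<close>

lemma orbit_valley:
  assumes O: "orbit X c \<rho>"
  shows "\<exists>t. \<rho> (t - 1) = \<rho> t + 1 \<and> \<rho> t \<le> \<rho> (t + 1)"
proof -
  have "\<exists>i. \<rho> (i - 1) > \<rho> i"
  proof (rule ccontr)
    assume "\<not> ?thesis"
    then have le: "\<rho> (i - 1) \<le> \<rho> i" for i by (meson not_less)
    obtain i where i: "\<And>j. \<rho> i \<le> \<rho> j" using ex_has_least_nat[of "\<lambda>_. True" _ \<rho>] by blast
    have dec: "\<rho> (i - int k) = \<rho> i" for k
    proof (induction k)
      case (Suc k)
      then have "\<rho> (i - int (Suc k)) \<le> \<rho> i" using le[of "i - int k"] by (simp add: algebra_simps)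
      then show ?case using i le_antisym by blast
    qed auto
    \<comment> \<open>Far enough back for the constant run to have the forbidden length.\<close>
    define j where "j = i - int (\<rho> i + 2)"
    have "\<rho> (j + int k) = \<rho> j" if "k \<le> \<rho> j + 2" for k
    proof -
      have "\<rho> j = \<rho> i" unfolding j_def using dec by blast
      moreover have "j + int k = i - int (\<rho> i + 2 - k)"
        using that calculation unfolding j_def by auto
      ultimately show ?thesis using dec by simp
    qed
    then show False using orbit_no_long_run[OF O] by blast
  qed
  then obtain t where t: "\<rho> (t - 1) > \<rho> t" "\<And>s. \<rho> (s - 1) > \<rho> s \<Longrightarrow> \<rho> t \<le> \<rho> s"
    using ex_has_least_nat[of "\<lambda>i. \<rho> (i - 1) > \<rho> i" _ \<rho>] by blast
  have "\<rho> t \<le> \<rho> (t + 1)" using t(2)[of "t + 1"] by fastforce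
  moreover have "\<rho> (t - 1) = \<rho> t + 1" using t orbit_step(2)[OF O, of "t - 1"] by auto
  ultimately show ?thesis by blast
qed

text \<open>Backwards in time the descent is an increase, and an increase repeats itself with the
  same centre. Two consecutive radii are carried through the induction because the recursion needs
  both.\<close>

lemma orbit_before_valley:
  assumes O: "orbit X c \<rho>" and t: "\<rho> (t - 1) = \<rho> t + 1"
  shows "\<rho> (t - int i) = \<rho> t + i \<and> c (t - int i) = c t"
proof -
  have "\<rho> (t - int i) = \<rho> t + i \<and> \<rho> (t - int (Suc i)) = \<rho> t + Suc i \<and> c (t - int i) = c t" for i
  proof (induction i)
    case 0 then show ?case using t by auto
  next
    case (Suc i)
    have "\<rho> (t - int (Suc (Suc i))) = \<rho> (t - int (Suc i)) + 1"
      by (rule orbit_next(2)[OF O, of "t - int i" _ "t - int (Suc i)"])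
        (use Suc in \<open>auto simp: algebra_simps\<close>)
    moreover have "c (t - int (Suc i)) = c (t - int i)"
      using orbit_step(1)[OF O, of "t - int (Suc i)"] Suc by (simp add: algebra_simps)
    ultimately show ?case using Suc by auto
  qed
  then show ?thesis by blast
qed

lemma orbit_after_valley:
  assumes O: "orbit X c \<rho>" and t: "\<rho> (t + 1) = \<rho> t + 1"
  shows "\<rho> (t + int i) = \<rho> t + i \<and> c (t + int i) = c t"
proof -
  have "\<rho> (t + int i) = \<rho> t + i \<and> \<rho> (t + int (Suc i)) = \<rho> t + Suc i \<and> c (t + int i) = c t" for i
  proof (induction i)
    case 0 then show ?case using t by auto
  next
    case (Suc i)
    have "\<rho> (t + int (Suc (Suc i))) = \<rho> (t + int (Suc i)) + 1"
      by (rule orbit_next(2)[OF O, of "t + int i" _ "t + int (Suc i)"])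
        (use Suc in \<open>auto simp: algebra_simps\<close>)
    moreover have "c (t + int (Suc i)) = c (t + int i)"
      using orbit_step(1)[OF O, of "t + int i"] Suc by (simp add: algebra_simps)
    ultimately show ?case using Suc by auto
  qed
  then show ?thesis by blast
qed

text \<open>\<open>b\<close> is the last index of the plateau that begins at \<open>t\<close>. The
  first departure from it occurs after at most \<open>\<rho> t + 2\<close> steps, which gives the
  bound on \<open>b\<close>; it is an increase, since the radii cannot drop after a step without a
  drop. The third part of \<open>orbit_next\<close> keeps the centres from backtracking.\<close>

lemma orbit_valley_run:
  assumes O: "orbit X c \<rho>" and t: "\<rho> (t - 1) = \<rho> t + 1" "\<rho> t \<le> \<rho> (t + 1)"
  obtains b where "b \<le> \<rho> t + 1" "\<And>k. k \<le> b \<Longrightarrow> \<rho> (t + int k) = \<rho> t"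
    "\<rho> (t + int b + 1) = \<rho> t + 1"
    "gpath (map (\<lambda>k. c (t + int k)) [0..<Suc b])"
proof -
  obtain k0 where k0: "k0 \<le> \<rho> t + 2" "\<rho> (t + int k0) \<noteq> \<rho> t" using orbit_no_long_run[OF O] by metis
  define m where "m = (LEAST k. \<rho> (t + int k) \<noteq> \<rho> t)"
  have m: "\<rho> (t + int m) \<noteq> \<rho> t" "m \<le> \<rho> t + 2" "\<And>k. k < m \<Longrightarrow> \<rho> (t + int k) = \<rho> t"
    unfolding m_def using LeastI[of "\<lambda>k. \<rho> (t + int k) \<noteq> \<rho> t", OF k0(2)]
      Least_le[of "\<lambda>k. \<rho> (t + int k) \<noteq> \<rho> t", OF k0(2)] k0(1) not_less_Least by auto
  have "m \<noteq> 0"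
  proof
    assume "m = 0" then show False using m(1) by simp
  qed
  then obtain b where b: "m = Suc b" using not0_implies_Suc by blast
  have run: "\<rho> (t + int k) = \<rho> t" if "k \<le> b" for k using m(3)[of k] that b by auto
  have "\<rho> (t + int b) \<le> \<rho> (t + int b + 1)"
  proof (cases b)
    case 0 then show ?thesis using t by auto
  next
    case (Suc k)
    show ?thesis
      by (rule orbit_next(1)[OF O, of "t + int k" _ "t + int b"])
        (use run[of k] run[of b] Suc in \<open>auto simp: algebra_simps\<close>)
  qed
  moreover have "\<rho> (t + int b + 1) \<noteq> \<rho> t" using m(1) b by (simp add: algebra_simps)
  ultimately have up: "\<rho> (t + int b + 1) = \<rho> t + 1"
    using orbit_step(2)[OF O, of "t + int b"] run[of b] by auto
  have "gpath (map (\<lambda>k. c (t + int k)) [0..<Suc b])" (is "gpath ?p")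
    unfolding gpath_def
  proof (intro conjI allI impI)
    show "set ?p \<subseteq> V" using O discD(1) unfolding orbit_def by fastforce
    have nth: "?p ! i = c (t + int i)" if "i < length ?p" for i using that by (simp del: upt_Suc)
    fix i assume i: "Suc i < length ?p"
    then have "adj (c (t + int i)) (c (t + int i + 1))"
      using orbit_step(3)[OF O, of "t + int i"] run[of i] run[of "Suc i"]
        by (simp add: algebra_simps)
    then show "adj (?p ! i) (?p ! Suc i)" using nth i by (simp add: algebra_simps del: upt_Suc)
  next
    have nth: "?p ! i = c (t + int i)" if "i < length ?p" for i using that by (simp del: upt_Suc)
    fix i assume i: "Suc (Suc i) < length ?p"
    then have "c (t + int i) \<noteq> c (t + int i + 2)"
      using orbit_next(3)[OF O, of "t + int i" "t + int i + 2" "t + int i + 1"]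
        run[of i] run[of "Suc i"] run[of "Suc (Suc i)"] by (simp add: algebra_simps)
    then show "?p ! i \<noteq> ?p ! Suc (Suc i)" using nth i by (simp add: algebra_simps del: upt_Suc)
  qed simp
  then show ?thesis using that[of b] run up m(2) b by auto
qed

text \<open>Serves to exclude that no new sources appear: then the neighbourhood of the present
  sources would be just the previous set.\<close>

lemma nbhd_eq_radius:
  assumes "nbhd B = A" "disc a r A" "disc b s B"
  shows "r = s + 1"
proof -
  have "disc b (s + 1) A" using disc_nbhd[OF assms(3)] assms(1) by simp
  then have "d b a + r \<le> s + 1" "d a b + (s + 1) \<le> r"
    using disc_in_ball[of _ _ A _ ] assms(2) discD by metis+
  then show ?thesis by auto
qed

end

section \<open>The regular tree as a free product\<close>

lemma tvert_Nil [simp]: "tvert n []"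
  unfolding tvert_def by simp

lemma tvert_Cons: "tvert n (a # v) \<longleftrightarrow> a < n \<and> tvert n v \<and> (v = [] \<or> hd v \<noteq> a)"
proof -
  have "(\<forall>i. Suc i < length (a # v) \<longrightarrow> (a # v) ! i \<noteq> (a # v) ! Suc i) \<longleftrightarrow>
      (v \<noteq> [] \<longrightarrow> a \<noteq> hd v) \<and> (\<forall>i. Suc i < length v \<longrightarrow> v ! i \<noteq> v ! Suc i)" (is "?l \<longleftrightarrow> ?r")
  proof
    assume l: ?l
    show ?r using l[rule_format, of 0] l[rule_format, of "Suc _"] by (auto simp: hd_conv_nth)
  next
    assume ?r
    then show ?l by (auto simp: hd_conv_nth nth_Cons split: nat.split)
  qed
  then show ?thesis unfolding tvert_def by auto
qed

lemma tvert_rev: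
  assumes "tvert n v"
  shows "tvert n (rev v)"
  unfolding tvert_def
proof (intro conjI allI impI)
  show "set (rev v) \<subseteq> {..<n}" using assms unfolding tvert_def by auto
  fix i assume i: "Suc i < length (rev v)"
  define j where "j = length v - Suc (Suc i)"
  have "v ! j \<noteq> v ! Suc j" using assms i unfolding tvert_def j_def by auto
  moreover have "Suc j = length v - Suc i" using i unfolding j_def by auto
  ultimately show "rev v ! i \<noteq> rev v ! Suc i" using i unfolding j_def by (auto simp: rev_nth)
qed

text \<open>The words form the free product of \<open>n\<close> groups of order two; \<open>lmul a\<close> is left multiplication by
  a generator and \<open>lact u w\<close> the reduced form of \<open>u w\<close>.  Hence \<open>wdist c x\<close> is the length of
  \<open>x c\<^sup>-\<^sup>1\<close>.\<close>

definition lmul :: "nat \<Rightarrow> nat list \<Rightarrow> nat list" where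
  "lmul a w = (if w \<noteq> [] \<and> hd w = a then tl w else a # w)"

definition lact :: "nat list \<Rightarrow> nat list \<Rightarrow> nat list" where
  "lact u w = foldr lmul u w"

definition wdist :: "nat list \<Rightarrow> nat list \<Rightarrow> nat" where
  "wdist c x = length (lact x (rev c))"

lemma lact_simps [simp]: "lact [] w = w" "lact (a # u) w = lmul a (lact u w)"
  unfolding lact_def by auto

lemma tvert_lmul: "a < n \<Longrightarrow> tvert n w \<Longrightarrow> tvert n (lmul a w)"
  unfolding lmul_def by (cases w) (auto simp: tvert_Cons)

lemma lmul_lmul: "tvert n w \<Longrightarrow> lmul a (lmul a w) = w"
  unfolding lmul_def by (cases w) (auto simp: tvert_Cons)

lemma tvert_lact: "tvert n u \<Longrightarrow> tvert n w \<Longrightarrow> tvert n (lact u w)"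
  by (induction u) (auto simp: tvert_Cons tvert_lmul)

text \<open>Either the letter is added by definition, or it cancels against the head of
  \<open>u\<close> and the generator is an involution. Hence moving the second argument of
  \<open>wdist\<close> along an edge multiplies the measured word by one letter on the left.\<close>

lemma lact_lmul: "tvert n u \<Longrightarrow> tvert n w \<Longrightarrow> lact (lmul a u) w = lmul a (lact u w)"
  by (cases u)
    (auto simp: lmul_def[of a "[]"] lmul_def[of a "_ # _"] tvert_Cons lmul_lmul[of n] tvert_lact)

lemma lact_rev: "lact u (rev u @ w) = w"
  by (induction u arbitrary: w) (auto simp: lmul_def)

lemma lact_inj: "tvert n u \<Longrightarrow> tvert n w \<Longrightarrow> tvert n w' \<Longrightarrow> lact u w = lact u w' \<Longrightarrow> w = w'"
proof (induction u)
  case (Cons a u)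
  then show ?case using lmul_lmul tvert_lact unfolding lact_simps tvert_Cons by metis
qed simp

lemma length_lmul: "length (lmul a w) = length w + 1 \<or> length w = length (lmul a w) + 1"
  unfolding lmul_def by auto

lemma lmul_inj: "lmul a w = lmul b w \<Longrightarrow> a = b"
proof (cases w)
  case (Cons c w')
  then show "lmul a w = lmul b w \<Longrightarrow> a = b"
    unfolding lmul_def by (auto split: if_splits)
qed (simp add: lmul_def)

lemma tadj_iff_lmul: "tadj n x y \<longleftrightarrow> tvert n x \<and> (\<exists>a<n. y = lmul a x)"
proof
  assume a: "tadj n x y"
  then consider "y \<noteq> []" "x = tl y" | "x \<noteq> []" "y = tl x" unfolding tadj_def by blast
  then show "tvert n x \<and> (\<exists>a<n. y = lmul a x)"
  proof cases
    case 1
    then have "y = hd y # x" by simp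
    then obtain e where e: "y = e # x" by blast
    then have "e < n" "x = [] \<or> hd x \<noteq> e" using a by (auto simp: tadj_def tvert_Cons)
    then show ?thesis using a e unfolding lmul_def tadj_def by auto
  next
    case 2
    then obtain e where e: "x = e # y" by (metis list.collapse)
    then have "e < n" using a by (auto simp: tadj_def tvert_Cons)
    then show ?thesis using a e unfolding lmul_def tadj_def by auto
  qed
next
  assume "tvert n x \<and> (\<exists>a<n. y = lmul a x)"
  then obtain a where a: "tvert n x" "a < n" "y = lmul a x" by blast
  then have "tvert n y" using tvert_lmul by blast
  moreover have "y \<noteq> [] \<and> x = tl y \<or> x \<noteq> [] \<and> y = tl x" using a(3) unfolding lmul_def by auto
  ultimately show "tadj n x y" using a unfolding tadj_def by blast
qed

lemma even_length_lact: "even (length (lact u w)) \<longleftrightarrow> (even (length u) \<longleftrightarrow> even (length w))"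
proof (induction u)
  case (Cons a u)
  then show ?case using length_lmul[of a "lact u w"] by auto
qed simp

lemma even_wdist: "even (wdist u v) \<longleftrightarrow> (even (length u) \<longleftrightarrow> even (length v))"
  unfolding wdist_def even_length_lact by auto

lemma wdist_eq_0_iff: "tvert n x \<Longrightarrow> tvert n y \<Longrightarrow> wdist x y = 0 \<longleftrightarrow> x = y"
  unfolding wdist_def
  using lact_inj[of n y "rev x" "rev y"] lact_rev[of y "[]"] tvert_rev by force

text \<open>The counterpart of \<open>length_lmul\<close> on the right: a generator adds or removes
  a last letter. The symmetry of \<open>wdist\<close> needs it, because there the first argument
  moves, and that argument enters reversed.\<close>

lemma lact_snoc: "lact u (w @ [a]) = lact u w @ [a] \<or> lact u w = lact u (w @ [a]) @ [a]"
proof (induction u)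
  case (Cons b u)
  then show ?case unfolding lact_simps lmul_def
    by (elim disjE; cases "lact u w"; cases "lact u (w @ [a])") auto
qed simp

lemma wdist_adj: "tvert n c \<Longrightarrow> tadj n x y \<Longrightarrow> wdist c y = wdist c x + 1 \<or> wdist c x = wdist c y + 1"
  unfolding tadj_iff_lmul wdist_def using lact_lmul tvert_rev length_lmul by metis

lemma wdist_closer_ex:
  assumes "tvert n c" "tvert n x" "c \<noteq> x"
  shows "\<exists>y. tadj n x y \<and> wdist c x = wdist c y + 1"
proof -
  define w where "w = lact x (rev c)"
  have "w \<noteq> []" using wdist_eq_0_iff[of n c x] assms unfolding w_def wdist_def by auto
  then obtain a w' where w: "w = a # w'" by (cases w) auto
  have "tvert n w" unfolding w_def using assms tvert_lact tvert_rev by blast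
  then have "a < n" using w tvert_Cons by auto
  then have "tadj n x (lmul a x)" using tadj_iff_lmul assms by blast
  moreover have "wdist c (lmul a x) = length w'"
    unfolding wdist_def using lact_lmul[of n x "rev c" a] assms tvert_rev w w_def
      by (auto simp: lmul_def)
  ultimately show ?thesis using w w_def wdist_def by auto
qed

text \<open>Left multiplication by a letter shortens a word only if the letter is the head of the
  word.\<close>

lemma wdist_closer_unique:
  assumes "tvert n c" "tadj n x y" "tadj n x z" "wdist c x = wdist c y + 1"
  "wdist c x = wdist c z + 1"
  shows "y = z"
proof -
  obtain a b where ab: "y = lmul a x" "z = lmul b x" and x: "tvert n x"
    using assms unfolding tadj_iff_lmul by blast
  have "length (lact x (rev c)) = length (lmul e (lact x (rev c))) + 1 \<Longrightarrow> e = hd (lact x (rev c))"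
    for e
    unfolding lmul_def by (auto split: if_splits)
  then have "a = b"
    using assms ab x lact_lmul[of n x "rev c"] tvert_rev unfolding wdist_def by metis
  then show ?thesis using ab by simp
qed

text \<open>One inequality suffices, as exchanging the arguments gives the other. Going outwards
  from \<open>c\<close>, each edge adds one on the right and at most one on the left.\<close>

lemma wdist_sym_le: "tvert n c \<Longrightarrow> tvert n x \<Longrightarrow> wdist x c \<le> wdist c x"
proof (induction "wdist c x" arbitrary: x)
  case 0
  then show ?case using wdist_eq_0_iff by force
next
  case (Suc k)
  then have "c \<noteq> x" using wdist_eq_0_iff by force
  then obtain y where y: "tadj n x y" "wdist c x = wdist c y + 1" using wdist_closer_ex Suc by metis
  then have "wdist y c \<le> wdist c y" using Suc tadj_def by auto
  moreover obtain a where "rev x = rev y @ [a] \<or> rev y = rev x @ [a]"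
    using y(1) unfolding tadj_def by (metis hd_Cons_tl rev.simps(2))
  then have "wdist x c \<le> wdist y c + 1"
    using lact_snoc[of c "rev y" a] lact_snoc[of c "rev x" a] unfolding wdist_def by auto
  ultimately show ?case using y by auto
qed

lemma tree_words:
  assumes "3 \<le> n"
  shows "tree_metric {v. tvert n v} (tadj n) wdist"
proof
  fix x y z c assume "c \<in> {v. tvert n v}" "tadj n x y" "tadj n x z"
    "wdist c x = wdist c y + 1" "wdist c x = wdist c z + 1"
  then show "y = z" using wdist_closer_unique by blast
next
  fix x y assume "x \<in> {v. tvert n v}" "y \<in> {v. tvert n v}"
  then show "wdist x y = wdist y x" using wdist_sym_le by (simp add: le_antisym)
next
  fix x assume "x \<in> {v. tvert n v}"
  then have "tadj n x (lmul a x)" if "a < 3" for a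
    using that assms order_less_le_trans unfolding tadj_iff_lmul by blast
  then show "\<exists>y1 y2 y3. tadj n x y1 \<and> tadj n x y2 \<and> tadj n x y3 \<and> y1 \<noteq> y2 \<and> y1 \<noteq> y3 \<and> y2 \<noteq> y3"
    using lmul_inj[of 0 x 1] lmul_inj[of 0 x 2] lmul_inj[of 1 x 2]
    by (intro exI[of _ "lmul 0 x"] exI[of _ "lmul 1 x"] exI[of _ "lmul 2 x"]) auto
next
  fix x y assume "tadj n x y"
  then show "x \<in> {v. tvert n v}" "tadj n y x" unfolding tadj_def by auto
next
  fix c x y assume "c \<in> {v. tvert n v}" "tadj n x y"
  then show "wdist c y = wdist c x + 1 \<or> wdist c x = wdist c y + 1" using wdist_adj by blast
next
  fix c x assume "c \<in> {v. tvert n v}" "x \<in> {v. tvert n v}"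
  then show "wdist c x = 0 \<longleftrightarrow> c = x" "c \<noteq> x \<Longrightarrow> \<exists>y. tadj n x y \<and> wdist c x = wdist c y + 1"
    using wdist_eq_0_iff wdist_closer_ex by auto
qed

lemma tadj_parity: "tadj n x y \<Longrightarrow> even (length x) \<longleftrightarrow> odd (length y)"
  unfolding tadj_def by (metis even_Suc length_Suc_conv list.collapse)

lemma set_nbrs: 
  assumes "tvert n x"
  shows "set (nbrs n x) = {y. tadj n x y}"
proof (cases x)
  case Nil
  then show ?thesis unfolding nbrs_def tadj_iff_lmul lmul_def by auto
next
  case (Cons a x')
  then have "{y. tadj n x y} = (\<lambda>b. lmul b x) ` {..<n}" using assms unfolding tadj_iff_lmul by auto
  also have "\<dots> = insert (lmul a x) ((\<lambda>b. lmul b x) ` ({..<n} - {a}))"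
    using Cons assms by (auto simp: tvert_Cons)
  also have "(\<lambda>b. lmul b x) ` ({..<n} - {a}) = (\<lambda>b. b # x) ` ({..<n} - {a})"
    using Cons unfolding lmul_def by (intro image_cong) auto
  finally show ?thesis using Cons unfolding nbrs_def lmul_def by auto
qed

lemma distinct_nbrs: "distinct (nbrs n x)"
proof -
  have "tl x \<noteq> a # x" for a by (cases x) (auto dest: arg_cong[of _ _ length])
  then show ?thesis unfolding nbrs_def by (auto simp: distinct_map inj_on_def)
qed

section \<open>Kernels and cokernels of matrices\<close>

lemmas carrD = carrier_matD

lemma mult_assoc_dim:
  fixes A :: "'k::semiring_0 mat"
  shows "dim_col A = dim_row B \<Longrightarrow> dim_col B = dim_row C \<Longrightarrow> A * B * C = A * (B * C)"
  by (rule assoc_mult_mat[of _ "dim_row A" "dim_col A" _ "dim_col B" _ "dim_col C"]) auto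

lemma mult_assoc_cancel:
  fixes A :: "'k::semiring_1 mat"
  assumes "A * B = 1\<^sub>m k" "dim_col A = dim_row B" "dim_row C = dim_col B"
  shows "A * (B * C) = C"
proof -
  have "k = dim_col B" using arg_cong[OF assms(1), of dim_col] by simp
  moreover have "A * (B * C) = A * B * C" by (rule mult_assoc_dim[symmetric]) (use assms in auto)
  ultimately show ?thesis using assms left_mult_one_mat[of C k "dim_col C"] by auto
qed

lemma mat_1_minus_mult:
  fixes A :: "'k::ring_1 mat"
  assumes "A \<in> carrier_mat n n" "B \<in> carrier_mat n m"
  shows "(1\<^sub>m n - A) * B = B - A * B"
  using assms by (subst minus_mult_distrib_mat[of _ n n]) auto

lemma mat_mult_1_minus:
  fixes A :: "'k::ring_1 mat"
  assumes "A \<in> carrier_mat n n" "B \<in> carrier_mat m n"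
  shows "B * (1\<^sub>m n - A) = B - B * A"
  using assms by (subst mult_minus_distrib_mat[of _ m n]) auto

lemma mat_diff_eq_0:
  fixes A :: "'k::ring_1 mat"
  assumes "A \<in> carrier_mat n m" "B \<in> carrier_mat n m"
  shows "A - B = 0\<^sub>m n m \<longleftrightarrow> A = B"
proof
  assume e: "A - B = 0\<^sub>m n m"
  show "A = B"
  proof (rule eq_matI)
    fix i j assume "i < dim_row B" "j < dim_col B"
    then have ij: "i < n" "j < m" using assms by auto
    then have "(A - B) $$ (i, j) = 0" unfolding e by simp
    moreover have "(A - B) $$ (i, j) = A $$ (i, j) - B $$ (i, j)" using assms ij by simp
    ultimately show "A $$ (i, j) = B $$ (i, j)" by simp
  qed (use assms in auto)
qed (use assms in auto)

text \<open>Juxtaposition, written as a block matrix without lower rows so that the block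
  multiplication rule applies.\<close>

definition acols :: "'k::zero mat \<Rightarrow> 'k mat \<Rightarrow> 'k mat" where
  "acols A B = four_block_mat A B (0\<^sub>m 0 (dim_col A)) (0\<^sub>m 0 (dim_col B))"

lemma dim_acols [simp]: "dim_row (acols A B) = dim_row A"
"dim_col (acols A B) = dim_col A + dim_col B"
  unfolding acols_def by auto

lemma acols_carrier [simp]:
  "A \<in> carrier_mat m n \<Longrightarrow> B \<in> carrier_mat m p \<Longrightarrow> acols A B \<in> carrier_mat m (n + p)"
  unfolding acols_def by auto

lemma index_acols:
  "A \<in> carrier_mat m n \<Longrightarrow> B \<in> carrier_mat m p \<Longrightarrow> i < m \<Longrightarrow> j < n + p \<Longrightarrow>
    acols A B $$ (i, j) = (if j < n then A $$ (i, j) else B $$ (i, j - n))"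
  unfolding acols_def by auto

lemma acols_eq_iff:
  assumes "A \<in> carrier_mat m n" "B \<in> carrier_mat m p" "A' \<in> carrier_mat m n" "B' \<in> carrier_mat m p"
  shows "acols A B = acols A' B' \<longleftrightarrow> A = A' \<and> B = B'"
proof
  assume e: "acols A B = acols A' B'"
  have "A = A'"
  proof (rule eq_matI)
    fix i j assume "i < dim_row A'" "j < dim_col A'"
    then show "A $$ (i, j) = A' $$ (i, j)"
      using index_acols[OF assms(1,2), of i j] index_acols[OF assms(3,4), of i j] assms(3) e by auto
  qed (use assms in auto)
  moreover have "B = B'"
  proof (rule eq_matI)
    fix i j assume "i < dim_row B'" "j < dim_col B'"
    then show "B $$ (i, j) = B' $$ (i, j)"
      using index_acols[OF assms(1,2), of i "n + j"] index_acols[OF assms(3,4), of i "n + j"]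
        assms(4) e by auto
  qed (use assms in auto)
  ultimately show "A = A' \<and> B = B'" by simp
qed simp

lemma mult_acols:
  fixes X :: "'k::semiring_0 mat"
  assumes "X \<in> carrier_mat q m" "A \<in> carrier_mat m n" "B \<in> carrier_mat m p"
  shows "X * acols A B = acols (X * A) (X * B)"
proof (rule eq_matI)
  have c: "X * A \<in> carrier_mat q n" "X * B \<in> carrier_mat q p" using assms by auto
  fix i j assume "i < dim_row (acols (X * A) (X * B))" "j < dim_col (acols (X * A) (X * B))"
  then have ij: "i < q" "j < n + p" using assms by auto
  have "col (acols A B) j = (if j < n then col A j else col B (j - n))"
    using assms ij by (intro eq_vecI) (auto simp: index_acols[OF assms(2,3)])
  then show "(X * acols A B) $$ (i, j) = acols (X * A) (X * B) $$ (i, j)"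
    using assms ij index_acols[OF c ij] by auto
qed (use assms in auto)

lemma acols_mult_append_rows:
  fixes A :: "'k::semiring_0 mat"
  assumes "A \<in> carrier_mat m n" "B \<in> carrier_mat m p" "C \<in> carrier_mat n q" "D \<in> carrier_mat p q"
  shows "acols A B * (C @\<^sub>r D) = A * C + B * D"
proof -
  have "acols A B * (C @\<^sub>r D) = four_block_mat (A * C + B * D) (A * 0\<^sub>m n 0 + B * 0\<^sub>m p 0)
      (0\<^sub>m 0 n * C + 0\<^sub>m 0 p * D) (0\<^sub>m 0 n * 0\<^sub>m n 0 + 0\<^sub>m 0 p * 0\<^sub>m p 0)"
    unfolding acols_def append_rows_def carrD[OF assms(1)] carrD[OF assms(2)]
      carrD[OF assms(3)] carrD[OF assms(4)]
    by (rule mult_four_block_mat) (use assms in auto)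
  also have "\<dots> = A * C + B * D" using assms by (intro eq_matI) auto
  finally show ?thesis .
qed

lemma append_rows_mult_acols:
  fixes A :: "'k::semiring_0 mat"
  assumes "A \<in> carrier_mat n m" "B \<in> carrier_mat p m" "C \<in> carrier_mat m q" "D \<in> carrier_mat m r"
  shows "(A @\<^sub>r B) * acols C D = four_block_mat (A * C) (A * D) (B * C) (B * D)"
proof -
  have "(A @\<^sub>r B) * acols C D = four_block_mat (A * C + 0\<^sub>m n 0 * 0\<^sub>m 0 q) (A * D + 0\<^sub>m n 0 * 0\<^sub>m 0 r)
      (B * C + 0\<^sub>m p 0 * 0\<^sub>m 0 q) (B * D + 0\<^sub>m p 0 * 0\<^sub>m 0 r)"
    unfolding acols_def append_rows_def carrD[OF assms(1)] carrD[OF assms(2)]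
      carrD[OF assms(3)] carrD[OF assms(4)]
    by (rule mult_four_block_mat) (use assms in auto)
  also have "\<dots> = four_block_mat (A * C) (A * D) (B * C) (B * D)"
    using assms by (intro cong_four_block_mat eq_matI) auto
  finally show ?thesis .
qed

lemma acols_mult_four_block:
  fixes A :: "'k::semiring_0 mat"
  assumes "A \<in> carrier_mat m n" "B \<in> carrier_mat m p"
    "E \<in> carrier_mat n q" "F \<in> carrier_mat n r" "G \<in> carrier_mat p q" "H \<in> carrier_mat p r"
  shows "acols A B * four_block_mat E F G H = acols (A * E + B * G) (A * F + B * H)"
proof -
  have "acols A B * four_block_mat E F G H = four_block_mat (A * E + B * G) (A * F + B * H)
      (0\<^sub>m 0 n * E + 0\<^sub>m 0 p * G) (0\<^sub>m 0 n * F + 0\<^sub>m 0 p * H)"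
    unfolding acols_def carrD[OF assms(1)] carrD[OF assms(2)]
    by (rule mult_four_block_mat) (use assms in auto)
  also have "\<dots> = acols (A * E + B * G) (A * F + B * H)"
    unfolding acols_def using assms by (intro cong_four_block_mat eq_matI) auto
  finally show ?thesis .
qed

text \<open>Induction on the number of columns, with one-sided inverses of both factors carried
  along. The last column is split into a part in the column space of \<open>P\<close> and a
  remainder; only a nonzero remainder raises the rank.\<close>

lemma full_rank_factorization_ex:
  fixes A :: "'k::field mat"
  assumes "A \<in> carrier_mat m n"
  shows "\<exists>r P Q P' Q'. P \<in> carrier_mat m r \<and> Q \<in> carrier_mat r n \<and> P' \<in> carrier_mat r m \<and>
    Q' \<in> carrier_mat n r \<and> A = P * Q \<and> P' * P = 1\<^sub>m r \<and> Q * Q' = 1\<^sub>m r"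
  using assms
proof (induction n arbitrary: A)
  case 0
  have "A = 0\<^sub>m m 0 * 0\<^sub>m 0 0" using 0 by (intro eq_matI) auto
  moreover have "0\<^sub>m 0 m * 0\<^sub>m m 0 = (1\<^sub>m 0 :: 'k mat)" "0\<^sub>m 0 0 * 0\<^sub>m 0 0 = (1\<^sub>m 0 :: 'k mat)"
    by (auto intro!: eq_matI)
  ultimately show ?case by (metis zero_carrier_mat)
next
  case (Suc n)
  define A1 where "A1 = mat m n (\<lambda>(i, j). A $$ (i, j))"
  define a where "a = mat m 1 (\<lambda>(i, j). A $$ (i, n))"
  have A: "A = acols A1 a"
    using Suc(2) unfolding acols_def A1_def a_def by (intro eq_matI) (auto simp: less_Suc_eq)
  have c: "A1 \<in> carrier_mat m n" "a \<in> carrier_mat m 1" unfolding A1_def a_def by auto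
  obtain r P Q P' Q' where
    PQ: "P \<in> carrier_mat m r" "Q \<in> carrier_mat r n" "P' \<in> carrier_mat r m" "Q' \<in> carrier_mat n r"
    "A1 = P * Q" "P' * P = 1\<^sub>m r" "Q * Q' = 1\<^sub>m r" using Suc(1)[OF c(1)] by blast
  \<comment> \<open>\<open>P * P'\<close> projects onto the column space found so far, and
    \<open>P'\<close> kills the remainder.\<close>
  define f where "f = a - P * (P' * a)"
  have fc: "f \<in> carrier_mat m 1" using c PQ unfolding f_def by auto
  have af: "a = P * (P' * a) + f" unfolding f_def using c PQ by (intro eq_matI) auto
  have P'f: "P' * f = 0\<^sub>m r 1"
  proof -
    have "P' * f = P' * a - P' * (P * (P' * a))"
      unfolding f_def using c PQ by (subst mult_minus_distrib_mat[of _ r m _ 1]) auto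
    also have "P' * (P * (P' * a)) = P' * a"
      using mult_assoc_cancel[OF PQ(6), of "P' * a"] PQ c by auto
    finally show ?thesis using PQ c by auto
  qed
  show ?case
  proof (cases "f = 0\<^sub>m m 1")
    case True
    have P'a: "P' * a \<in> carrier_mat r 1" using PQ c by auto
    define Q2 where "Q2 = acols Q (P' * a)"
    define Q2' where "Q2' = Q' @\<^sub>r 0\<^sub>m 1 r"
    have "a = P * (P' * a)" using af True PQ c by (metis mult_carrier_mat right_add_zero_mat)
    then have 1: "A = P * Q2"
      unfolding Q2_def A using mult_acols[OF PQ(1,2) P'a] PQ(5) by simp
    have 2: "Q2 * Q2' = 1\<^sub>m r"
      unfolding Q2_def Q2'_def using acols_mult_append_rows[OF PQ(2) P'a PQ(4) zero_carrier_mat]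
        right_mult_zero_mat[OF P'a, of r] PQ by simp
    have 3: "Q2 \<in> carrier_mat r (Suc n)" "Q2' \<in> carrier_mat (Suc n) r"
      unfolding Q2_def Q2'_def using PQ(2,4) P'a acols_carrier[OF PQ(2) P'a]
        carrier_append_rows[OF PQ(4) zero_carrier_mat[of 1 r]] by auto
    show ?thesis using PQ(1,3,6) 1 2 3 by blast
  next
    case False
    have "f = 0\<^sub>m m 1" if "\<And>i. i < m \<Longrightarrow> f $$ (i, 0) = 0" using fc that by (intro eq_matI) auto
    then obtain i where i: "i < m" "f $$ (i, 0) \<noteq> 0" using False by blast
    \<comment> \<open>\<open>E\<close> reads off a nonzero entry of \<open>f\<close>, scaled to one.
      Subtracting its action on the old column space gives a row \<open>l\<close> with
      \<open>l * P = 0\<close> and \<open>l * f = 1\<close>.\<close>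
    define E where "E = mat 1 m (\<lambda>(_, j). if j = i then 1 / f $$ (i, 0) else 0)"
    define l where "l = E - E * P * P'"
    have Ec: "E \<in> carrier_mat 1 m" unfolding E_def by auto
    have lc: "l \<in> carrier_mat 1 m" unfolding l_def using Ec PQ by auto
    have lP: "l * P = 0\<^sub>m 1 r"
    proof -
      have "l * P = E * P - E * P * P' * P"
        unfolding l_def using Ec PQ by (subst minus_mult_distrib_mat[of _ 1 m]) auto
      also have "E * P * P' * P = E * P * (P' * P)" using Ec PQ by (simp add: mult_assoc_dim)
      finally show ?thesis using Ec PQ by auto
    qed
    have "E * f = 1\<^sub>m 1"
      using fc i unfolding E_def
        by (intro eq_matI)
          (auto simp: scalar_prod_def if_distrib if_distribR sum.delta cong: if_cong)
    moreover have "E * P * P' * f = E * P * (P' * f)" using Ec PQ fc by (simp add: mult_assoc_dim)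
    ultimately have lf: "l * f = 1\<^sub>m 1"
      unfolding l_def using Ec PQ fc P'f by (subst minus_mult_distrib_mat[of _ 1 m]) auto
    have P'a: "P' * a \<in> carrier_mat r 1" and Q'a: "- (Q' * (P' * a)) \<in> carrier_mat n 1"
      using PQ c by auto
    define P2 where "P2 = acols P f"
    define L2 where "L2 = P' @\<^sub>r l"
    define Q2 where "Q2 = four_block_mat Q (P' * a) (0\<^sub>m 1 n) (1\<^sub>m 1)"
    define Q2' where "Q2' = four_block_mat Q' (- (Q' * (P' * a))) (0\<^sub>m 1 r) (1\<^sub>m 1)"
    have 1: "A = P2 * Q2"
      unfolding P2_def Q2_def A
      using acols_mult_four_block[OF PQ(1) fc PQ(2) P'a zero_carrier_mat one_carrier_mat] PQ c fc af
        by simp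
    have 2: "L2 * P2 = 1\<^sub>m (Suc r)"
      unfolding P2_def L2_def
      using append_rows_mult_acols[OF PQ(3) lc PQ(1) fc] PQ(6) lP lf P'f by simp
    have "Q2 * Q2' = four_block_mat (Q * Q' + P' * a * 0\<^sub>m 1 r) (Q * (- (Q' * (P' * a))) + P' * a * 1\<^sub>m 1)
        (0\<^sub>m 1 n * Q' + 1\<^sub>m 1 * 0\<^sub>m 1 r) (0\<^sub>m 1 n * (- (Q' * (P' * a))) + 1\<^sub>m 1 * 1\<^sub>m 1)"
      unfolding Q2_def Q2'_def
      by (rule mult_four_block_mat[OF PQ(2) P'a zero_carrier_mat one_carrier_mat PQ(4) Q'a zero_carrier_mat one_carrier_mat])
    also have "Q * Q' + P' * a * 0\<^sub>m 1 r = 1\<^sub>m r" using PQ right_mult_zero_mat[OF P'a, of r] by simp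
    also have "Q * (- (Q' * (P' * a))) + P' * a * 1\<^sub>m 1 = 0\<^sub>m r 1"
    proof -
      have e: "Q * (Q' * (P' * a)) = P' * a"
        using mult_assoc_cancel[OF PQ(7), of "P' * a"] PQ c by auto
      have "Q * (- (Q' * (P' * a))) = - (Q * (Q' * (P' * a)))"
        by (rule uminus_mult_right_mat) (use PQ in auto)
      then show ?thesis
        unfolding e right_mult_one_mat[OF P'a] using uminus_l_inv_mat[OF P'a] by simp
    qed
    also have "0\<^sub>m 1 n * Q' + 1\<^sub>m 1 * 0\<^sub>m 1 r = 0\<^sub>m 1 r" using PQ by simp
    also have "0\<^sub>m 1 n * (- (Q' * (P' * a))) + 1\<^sub>m 1 * 1\<^sub>m 1 = 1\<^sub>m 1"
      using left_mult_zero_mat[OF Q'a, of 1] by simp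
    finally have 3: "Q2 * Q2' = 1\<^sub>m (Suc r)" by simp
    have "P2 \<in> carrier_mat m (Suc r)" "L2 \<in> carrier_mat (Suc r) m"
      using acols_carrier[OF PQ(1) fc] carrier_append_rows[OF PQ(3) lc]
        unfolding P2_def L2_def by simp_all
    moreover have "Q2 \<in> carrier_mat (Suc r) (Suc n)" "Q2' \<in> carrier_mat (Suc n) (Suc r)"
      unfolding Q2_def Q2'_def
      using four_block_carrier_mat[OF PQ(2) one_carrier_mat[of 1]]
        four_block_carrier_mat[OF PQ(4) one_carrier_mat[of 1]]
      by simp_all
    ultimately show ?thesis using 1 2 3 by blast
  qed
qed

lemma full_rank_factorization:
  fixes A :: "'k::field mat"
  assumes "A \<in> carrier_mat m n"
  obtains r P Q P' Q' where "P \<in> carrier_mat m r" "Q \<in> carrier_mat r n" "P' \<in> carrier_mat r m"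
    "Q' \<in> carrier_mat n r" "A = P * Q" "P' * P = 1\<^sub>m r" "Q * Q' = 1\<^sub>m r"
  using full_rank_factorization_ex[OF assms] by blast

lemma factor_columns:
  fixes B :: "'k::field mat"
  assumes "B \<in> carrier_mat n k" "X \<in> carrier_mat n p"
    and "\<And>j. j < p \<Longrightarrow> \<exists>w\<in>carrier_vec k. col X j = B *\<^sub>v w"
  shows "\<exists>W\<in>carrier_mat k p. X = B * W"
proof -
  obtain w where w: "\<And>j. j < p \<Longrightarrow> w j \<in> carrier_vec k \<and> col X j = B *\<^sub>v w j" using assms(3) by metis
  define W where "W = mat_of_cols k (map w [0..<p])"
  have W: "W \<in> carrier_mat k p" unfolding W_def by auto
  have cW: "col W j = w j" if "j < p" for j
    using that w unfolding W_def by (subst col_mat_of_cols) auto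
  have "X = B * W"
  proof (rule mat_col_eqI)
    fix j assume "j < dim_col (B * W)"
    then have j: "j < p" using W by auto
    then have "col (B * W) j = B *\<^sub>v col W j" using assms(1) W by (metis col_mult2)
    then show "col X j = col (B * W) j" using w cW j by auto
  qed (use assms W in auto)
  then show ?thesis using W by blast
qed

text \<open>In a full rank factorisation \<open>E = P * Q\<close> both outer factors can be
  cancelled, so \<open>E * E = E\<close> turns into \<open>Q * P = 1\<close>.\<close>

lemma idem_split:
  fixes E :: "'k::field mat"
  assumes "E \<in> carrier_mat n n" "E * E = E"
  obtains k B R where "B \<in> carrier_mat n k" "R \<in> carrier_mat k n" "E = B * R" "R * B = 1\<^sub>m k"
proof -
  obtain r P Q P' Q' where
    f: "P \<in> carrier_mat n r" "Q \<in> carrier_mat r n" "P' \<in> carrier_mat r n" "Q' \<in> carrier_mat n r"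
    "E = P * Q" "P' * P = 1\<^sub>m r" "Q * Q' = 1\<^sub>m r" using full_rank_factorization[OF assms(1)] .
  have e1: "P' * E = Q" using mult_assoc_cancel[OF f(6), of Q] f by simp
  have e2: "E * Q' = P" unfolding f(5) using mult_assoc_dim[of P Q Q'] f by simp
  have "E * (E * Q') = E * Q'"
    using mult_assoc_dim[of E E Q'] f(4) assms by (metis carrD)
  then have "P' * E * (E * Q') = P' * (E * Q')"
    using mult_assoc_dim[of P' E "E * Q'"] f(3,4) assms(1) by (metis carrD index_mult_mat(2))
  then have "Q * P = 1\<^sub>m r" unfolding e1 e2 f(6) .
  then show ?thesis using that f by blast
qed

text \<open>\<open>kernel_basis A B\<close>: the columns of \<open>B\<close> form a basis of the kernel of \<open>A\<close>, expressed by a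
  partial splitting so that the dual notion is its transpose.\<close>

definition kernel_basis :: "'k::field mat \<Rightarrow> 'k mat \<Rightarrow> bool" where
  "kernel_basis A B \<longleftrightarrow> dim_row B = dim_col A \<and>
     (\<exists>L\<in>carrier_mat (dim_col B) (dim_col A). \<exists>R\<in>carrier_mat (dim_col A) (dim_row A).
       L * B = 1\<^sub>m (dim_col B) \<and> A * B = 0\<^sub>m (dim_row A) (dim_col B) \<and> B * L + R * A = 1\<^sub>m
       (dim_col A))"

lemma mult_unit_cols:
  fixes A :: "'k::field mat"
  assumes "A \<in> carrier_mat m n" "\<And>w. w \<in> carrier_vec n \<Longrightarrow> A *\<^sub>v w = 0\<^sub>v m"
  shows "A = 0\<^sub>m m n"
proof (rule mat_col_eqI)
  fix j assume "j < dim_col (0\<^sub>m m n :: 'k mat)"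
  then have j: "j < n" by auto
  then have "col A j = A *\<^sub>v unit_vec n j"
    using col_mult2[OF assms(1) one_carrier_mat j] assms(1) by simp
  then show "col A j = col (0\<^sub>m m n) j" using assms j by auto
qed (use assms in auto)

text \<open>A generalised inverse \<open>G\<close> of \<open>A\<close> gives the projection
  \<open>1 - G * A\<close> onto the kernel. Splitting it shows that the description under
  \<open>SOME\<close> can be met; the basis actually chosen is then compared with the same
  projection.\<close>

lemma ker_choice:
  fixes A :: "'k::field mat"
  shows "snd (ker_choice A) \<in> carrier_mat (dim_col A) (fst (ker_choice A))"
  "kernel_basis A (snd (ker_choice A))"
proof -
  define m n where "m = dim_row A" and "n = dim_col A"
  have Ac: "A \<in> carrier_mat m n" unfolding m_def n_def by auto
  let ?P = "\<lambda>(k, B). B \<in> carrier_mat n k \<and>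
     (\<forall>v\<in>carrier_vec n. A *\<^sub>v v = 0\<^sub>v m \<longleftrightarrow> (\<exists>w\<in>carrier_vec k. v = B *\<^sub>v w)) \<and>
     (\<forall>w\<in>carrier_vec k. \<forall>w'\<in>carrier_vec k. B *\<^sub>v w = B *\<^sub>v w' \<longrightarrow> w = w')"
  obtain r P Q P' Q' where
    f: "P \<in> carrier_mat m r" "Q \<in> carrier_mat r n" "P' \<in> carrier_mat r m" "Q' \<in> carrier_mat n r"
    "A = P * Q" "P' * P = 1\<^sub>m r" "Q * Q' = 1\<^sub>m r" using full_rank_factorization[OF Ac] .
  define G where "G = Q' * P'"
  have G: "G \<in> carrier_mat n m" using f unfolding G_def by auto
  have GA: "G * A = Q' * Q"
    unfolding G_def f(5) using f mult_assoc_cancel[OF f(6), of Q] by (simp add: mult_assoc_dim)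
  have AGA: "A * (G * A) = A"
    unfolding GA unfolding f(5) using f mult_assoc_cancel[OF f(7), of Q]
      by (simp add: mult_assoc_dim)
  define E where "E = 1\<^sub>m n - G * A"
  have Ec: "E \<in> carrier_mat n n" unfolding E_def using G Ac by auto
  have AE: "A * E = 0\<^sub>m m n" unfolding E_def using G Ac AGA by (subst mat_mult_1_minus[of _ n]) auto
  have "E * E = E - (G * A) * E"
    unfolding E_def using G Ac by (subst mat_1_minus_mult[of _ n _ n]) auto
  also have "(G * A) * E = 0\<^sub>m n n" using mult_assoc_dim[of G A E] G Ac Ec AE by simp
  also have "E - 0\<^sub>m n n = E" using Ec by (intro eq_matI) auto
  finally have EE: "E * E = E" .
  have Ev: "E *\<^sub>v v = v" if "v \<in> carrier_vec n" "A *\<^sub>v v = 0\<^sub>v m" for v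
  proof -
    have "E *\<^sub>v v = 1\<^sub>m n *\<^sub>v v - (G * A) *\<^sub>v v"
      unfolding E_def using that G Ac by (subst minus_mult_distrib_mat_vec[of _ n n]) auto
    also have "(G * A) *\<^sub>v v = G *\<^sub>v (A *\<^sub>v v)" using that G Ac assoc_mult_mat_vec by blast
    finally show ?thesis using that G by (auto intro!: eq_vecI)
  qed
  obtain k B S where B: "B \<in> carrier_mat n k" "S \<in> carrier_mat k n" "E = B * S" "S * B = 1\<^sub>m k"
    by (rule idem_split[OF Ec EE])
  have AB: "A * B = 0\<^sub>m m k"
  proof -
    have "B = B * (S * B)" using B by simp
    also have "\<dots> = E * B" unfolding B(3) using B mult_assoc_dim[of B S B] by simp
    finally have "A * B = A * (E * B)" by simp
    also have "\<dots> = (A * E) * B" using Ac Ec B mult_assoc_dim[of A E B] by simp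
    finally show ?thesis using AE B by simp
  qed
  have "?P (k, B)"
  proof (intro case_prodI conjI ballI impI)
    show "B \<in> carrier_mat n k" by fact
    fix v :: "'k vec" assume v: "v \<in> carrier_vec n"
    show "A *\<^sub>v v = 0\<^sub>v m \<longleftrightarrow> (\<exists>w\<in>carrier_vec k. v = B *\<^sub>v w)"
    proof
      assume "A *\<^sub>v v = 0\<^sub>v m"
      then have "v = B *\<^sub>v (S *\<^sub>v v)" using Ev v B assoc_mult_mat_vec by metis
      then show "\<exists>w\<in>carrier_vec k. v = B *\<^sub>v w" using B v by (metis mult_mat_vec_carrier)
    next
      assume "\<exists>w\<in>carrier_vec k. v = B *\<^sub>v w"
      then obtain w where w: "w \<in> carrier_vec k" "v = B *\<^sub>v w" by auto
      then have "A *\<^sub>v v = (A * B) *\<^sub>v w" using Ac B assoc_mult_mat_vec by metis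
      then show "A *\<^sub>v v = 0\<^sub>v m" using AB w by (auto intro!: eq_vecI)
    qed
  next
    fix w w' :: "'k vec" assume w: "w \<in> carrier_vec k" "w' \<in> carrier_vec k" "B *\<^sub>v w = B *\<^sub>v w'"
    then have "S *\<^sub>v (B *\<^sub>v w) = S *\<^sub>v (B *\<^sub>v w')" by simp
    then show "w = w'" using w B assoc_mult_mat_vec[of S k n B k] by (metis one_mult_mat_vec)
  qed
  then have "?P (ker_choice A)" unfolding ker_choice_def m_def n_def by (rule someI)
  moreover obtain k B where kB: "ker_choice A = (k, B)" by fastforce
  ultimately have P: "B \<in> carrier_mat n k"
    "\<And>v. v \<in> carrier_vec n \<Longrightarrow> A *\<^sub>v v = 0\<^sub>v m \<longleftrightarrow> (\<exists>w\<in>carrier_vec k. v = B *\<^sub>v w)"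
    "\<And>w w'. w \<in> carrier_vec k \<Longrightarrow> w' \<in> carrier_vec k \<Longrightarrow> B *\<^sub>v w = B *\<^sub>v w' \<Longrightarrow> w = w'" by auto
  show "snd (ker_choice A) \<in> carrier_mat (dim_col A) (fst (ker_choice A))"
    using P kB unfolding n_def by auto
  have AB: "A * B = 0\<^sub>m m k"
  proof (rule mult_unit_cols)
    fix w :: "'k vec" assume w: "w \<in> carrier_vec k"
    then have "A *\<^sub>v (B *\<^sub>v w) = 0\<^sub>v m" using P(1) P(2)[of "B *\<^sub>v w"] by auto
    then show "A * B *\<^sub>v w = 0\<^sub>v m" using w P(1) Ac assoc_mult_mat_vec by metis
  qed (use Ac P in auto)
  \<comment> \<open>The projection factors through the chosen basis as \<open>E = B * W\<close>.
    Since \<open>E\<close> fixes \<open>B\<close> and \<open>B\<close> is injective,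
    \<open>W\<close> is a left inverse of \<open>B\<close>.\<close>
  have "\<exists>W\<in>carrier_mat k n. E = B * W"
  proof (rule factor_columns[OF P(1) Ec])
    fix j assume j: "j < n"
    have "A *\<^sub>v col E j = col (A * E) j" using Ac Ec j by (metis col_mult2)
    also have "\<dots> = 0\<^sub>v m" using AE j by auto
    finally show "\<exists>w\<in>carrier_vec k. col E j = B *\<^sub>v w" using P(2)[of "col E j"] Ec by auto
  qed
  then obtain W where W: "W \<in> carrier_mat k n" "E = B * W" by blast
  have GAB: "G * A * B = 0\<^sub>m n k" using mult_assoc_dim[of G A B] G Ac P AB by simp
  have EB: "E * B = B"
    unfolding E_def using G Ac P GAB by (subst mat_1_minus_mult[of _ n _ k]) auto
  have WB: "W * B = 1\<^sub>m k"
  proof (rule mat_col_eqI)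
    fix j assume "j < dim_col (1\<^sub>m k :: 'k mat)"
    then have j: "j < k" by auto
    have "B *\<^sub>v col (W * B) j = col (B * (W * B)) j"
      using W P j by (intro col_mult2[symmetric]) auto
    also have "B * (W * B) = B * 1\<^sub>m k" using EB W P mult_assoc_dim[of B W B] by simp
    also have "col (B * 1\<^sub>m k) j = B *\<^sub>v col (1\<^sub>m k) j" using P j by (intro col_mult2) auto
    finally show "col (W * B) j = col (1\<^sub>m k) j" using P(3) W P(1) j by auto
  qed (use W P in auto)
  have "E + G * A = 1\<^sub>m n" unfolding E_def using G Ac by (intro eq_matI) auto
  then have "B * W + G * A = 1\<^sub>m n" using W(2) by simp
  then show "kernel_basis A (snd (ker_choice A))"
    unfolding kernel_basis_def kB using P(1) W(1) G WB AB Ac by auto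
qed

text \<open>The projection is now \<open>1 - A * G\<close>, which kills the image. The transposed
  form of the conclusion lets later arguments about kernels apply to cokernels.\<close>

lemma coker_choice:
  fixes A :: "'k::field mat"
  shows "snd (coker_choice A) \<in> carrier_mat (fst (coker_choice A)) (dim_row A)"
    "kernel_basis (transpose_mat A) (transpose_mat (snd (coker_choice A)))"
proof -
  define m n where "m = dim_row A" and "n = dim_col A"
  have Ac: "A \<in> carrier_mat m n" unfolding m_def n_def by auto
  let ?P = "\<lambda>(c, C). C \<in> carrier_mat c m \<and>
     (\<forall>u\<in>carrier_vec c. \<exists>v\<in>carrier_vec m. C *\<^sub>v v = u) \<and>
     (\<forall>v\<in>carrier_vec m. C *\<^sub>v v = 0\<^sub>v c \<longleftrightarrow> (\<exists>w\<in>carrier_vec n. v = A *\<^sub>v w))"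
  obtain r P Q P' Q' where
    f: "P \<in> carrier_mat m r" "Q \<in> carrier_mat r n" "P' \<in> carrier_mat r m" "Q' \<in> carrier_mat n r"
    "A = P * Q" "P' * P = 1\<^sub>m r" "Q * Q' = 1\<^sub>m r" using full_rank_factorization[OF Ac] .
  define G where "G = Q' * P'"
  have G: "G \<in> carrier_mat n m" using f unfolding G_def by auto
  have AG: "A * G = P * P'"
    unfolding G_def f(5) using f mult_assoc_cancel[OF f(7), of P'] by (simp add: mult_assoc_dim)
  have AGA: "A * G * A = A"
    unfolding AG unfolding f(5) using f mult_assoc_cancel[OF f(6), of Q]
      by (simp add: mult_assoc_dim)
  define E where "E = 1\<^sub>m m - A * G"
  have Ec: "E \<in> carrier_mat m m" unfolding E_def using G Ac by auto
  have EA: "E * A = 0\<^sub>m m n"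
    unfolding E_def using G Ac AGA by (subst mat_1_minus_mult[of _ m _ n]) auto
  have "E * E = E - E * (A * G)"
    using G Ac Ec mat_mult_1_minus[of "A * G" m E m] unfolding E_def by auto
  also have "E * (A * G) = 0\<^sub>m m m" using mult_assoc_dim[of E A G] G Ac Ec EA by simp
  also have "E - 0\<^sub>m m m = E" using Ec by (intro eq_matI) auto
  finally have EE: "E * E = E" .
  obtain k B S where B: "B \<in> carrier_mat m k" "S \<in> carrier_mat k m" "E = B * S" "S * B = 1\<^sub>m k"
    by (rule idem_split[OF Ec EE])
  have SA: "S * A = 0\<^sub>m k n"
  proof -
    have "S * A = S * (B * (S * A))"
      using mult_assoc_cancel[OF B(4), of S] B Ac by (simp add: mult_assoc_cancel)
    also have "B * (S * A) = E * A" unfolding B(3) using B Ac by (simp add: mult_assoc_dim)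
    finally show ?thesis using EA B by simp
  qed
  have "?P (k, S)"
  proof (intro case_prodI conjI ballI)
    show "S \<in> carrier_mat k m" by fact
    fix u :: "'k vec" assume u: "u \<in> carrier_vec k"
    have "S *\<^sub>v (B *\<^sub>v u) = u" using u B assoc_mult_mat_vec[of S k m B k u] by simp
    then show "\<exists>v\<in>carrier_vec m. S *\<^sub>v v = u" using B u by (metis mult_mat_vec_carrier)
  next
    fix v :: "'k vec" assume v: "v \<in> carrier_vec m"
    show "S *\<^sub>v v = 0\<^sub>v k \<longleftrightarrow> (\<exists>w\<in>carrier_vec n. v = A *\<^sub>v w)"
    proof
      assume "S *\<^sub>v v = 0\<^sub>v k"
      then have "E *\<^sub>v v = 0\<^sub>v m"
        unfolding B(3) using B v assoc_mult_mat_vec[of B m k S m v] by (auto intro!: eq_vecI)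
      moreover have "E *\<^sub>v v = v - (A * G) *\<^sub>v v"
        unfolding E_def using v G Ac by (subst minus_mult_distrib_mat_vec[of _ m m]) auto
      moreover have "A * G *\<^sub>v v = A *\<^sub>v (G *\<^sub>v v)" using v G Ac assoc_mult_mat_vec by blast
      ultimately have e: "v - A *\<^sub>v (G *\<^sub>v v) = 0\<^sub>v m" by simp
      have "v = A *\<^sub>v (G *\<^sub>v v)"
      proof (rule eq_vecI)
        fix i assume i: "i < dim_vec (A *\<^sub>v (G *\<^sub>v v))"
        then have "(v - A *\<^sub>v (G *\<^sub>v v)) $ i = 0" using e Ac by auto
        then show "v $ i = (A *\<^sub>v (G *\<^sub>v v)) $ i" using i by auto
      qed (use v Ac in auto)
      then show "\<exists>w\<in>carrier_vec n. v = A *\<^sub>v w" using G v by (metis mult_mat_vec_carrier)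
    next
      assume "\<exists>w\<in>carrier_vec n. v = A *\<^sub>v w"
      then obtain w where w: "w \<in> carrier_vec n" "v = A *\<^sub>v w" by auto
      then have "S *\<^sub>v v = (S * A) *\<^sub>v w" using Ac B assoc_mult_mat_vec by metis
      then show "S *\<^sub>v v = 0\<^sub>v k" using SA w by (auto intro!: eq_vecI)
    qed
  qed
  then have "?P (coker_choice A)" unfolding coker_choice_def m_def n_def by (rule someI)
  moreover obtain c C where cC: "coker_choice A = (c, C)" by fastforce
  ultimately have P: "C \<in> carrier_mat c m"
    "\<And>u. u \<in> carrier_vec c \<Longrightarrow> \<exists>v\<in>carrier_vec m. C *\<^sub>v v = u"
    "\<And>v. v \<in> carrier_vec m \<Longrightarrow> C *\<^sub>v v = 0\<^sub>v c \<longleftrightarrow> (\<exists>w\<in>carrier_vec n. v = A *\<^sub>v w)" by auto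
  show "snd (coker_choice A) \<in> carrier_mat (fst (coker_choice A)) (dim_row A)"
    using P cC unfolding m_def by auto
  have "\<exists>R\<in>carrier_mat m c. 1\<^sub>m c = C * R"
    by (rule factor_columns[OF P(1)]) (use P(2) in \<open>auto, metis unit_vec_carrier\<close>)
  then obtain R where R: "R \<in> carrier_mat m c" "C * R = 1\<^sub>m c" by metis
  have CA: "C * A = 0\<^sub>m c n"
  proof (rule mult_unit_cols)
    fix w :: "'k vec" assume w: "w \<in> carrier_vec n"
    then have "C *\<^sub>v (A *\<^sub>v w) = 0\<^sub>v c" using Ac P(3)[of "A *\<^sub>v w"] by auto
    then show "C * A *\<^sub>v w = 0\<^sub>v c" using w P(1) Ac assoc_mult_mat_vec by metis
  qed (use Ac P in auto)
  \<comment> \<open>\<open>C\<close> kills \<open>1 - R * C\<close>, so the columns of this matrix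
    lie in the image of \<open>A\<close>; this yields the second summand of the splitting.\<close>
  define F where "F = 1\<^sub>m m - R * C"
  have Fc: "F \<in> carrier_mat m m" unfolding F_def using R P by auto
  have CF: "C * F = 0\<^sub>m c m"
  proof -
    have "C * F = C - C * (R * C)"
      unfolding F_def using R P by (subst mat_mult_1_minus[of _ m _ c]) auto
    also have "C * (R * C) = C" using mult_assoc_cancel[OF R(2), of C] R P by simp
    finally show ?thesis using P by simp
  qed
  have "\<exists>W\<in>carrier_mat n m. F = A * W"
  proof (rule factor_columns[OF Ac Fc])
    fix j assume j: "j < m"
    have "C *\<^sub>v col F j = col (C * F) j" using P Fc j by (metis col_mult2)
    also have "\<dots> = 0\<^sub>v c" using CF j by auto
    finally show "\<exists>w\<in>carrier_vec n. col F j = A *\<^sub>v w" using P(3)[of "col F j"] Fc by auto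
  qed
  then obtain W where W: "W \<in> carrier_mat n m" "F = A * W" by blast
  have "R * C + F = 1\<^sub>m m" unfolding F_def using R P by (intro eq_matI) auto
  then have sum: "R * C + A * W = 1\<^sub>m m" using W(2) by simp
  show "kernel_basis (transpose_mat A) (transpose_mat (snd (coker_choice A)))"
    unfolding kernel_basis_def cC snd_conv
  proof (intro conjI bexI)
    show "transpose_mat R * transpose_mat C = 1\<^sub>m (dim_col (transpose_mat C))"
      using transpose_mult[OF P(1) R(1)] R P by simp
    show "transpose_mat A * transpose_mat C = 0\<^sub>m (dim_row (transpose_mat A)) (dim_col (transpose_mat C))"
      using transpose_mult[OF P(1) Ac] CA P Ac by simp
    show "transpose_mat C * transpose_mat R + transpose_mat W * transpose_mat A = 1\<^sub>m (dim_col (transpose_mat A))"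
      using transpose_mult[OF R(1) P(1)] transpose_mult[OF Ac W(1)]
        transpose_add[of "R * C" m m "A * W"] sum R P Ac W
      by auto
  qed (use R P Ac W in auto)
qed

section \<open>Reflections of representations\<close>

fun hcat :: "nat \<Rightarrow> 'k::zero mat list \<Rightarrow> 'k mat" where
  "hcat m [] = 0\<^sub>m m 0"
| "hcat m (A # As) = acols A (hcat m As)"

lemma hcat_carrier:
  "(\<And>y. y \<in> set ys \<Longrightarrow> a y \<in> carrier_mat m (d y)) \<Longrightarrow>
    hcat m (map a ys) \<in> carrier_mat m (sum_list (map d ys))"
  by (induction ys) auto

lemma hcat_eq_iff:
  "(\<And>y. y \<in> set ys \<Longrightarrow> a y \<in> carrier_mat m (d y)) \<Longrightarrow>
   (\<And>y. y \<in> set ys \<Longrightarrow> b y \<in> carrier_mat m (d y)) \<Longrightarrow>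
    hcat m (map a ys) = hcat m (map b ys) \<longleftrightarrow> (\<forall>y\<in>set ys. a y = b y)"
proof (induction ys)
  case (Cons z ys)
  have c: "hcat m (map a ys) \<in> carrier_mat m (sum_list (map d ys))"
    "hcat m (map b ys) \<in> carrier_mat m (sum_list (map d ys))"
    using Cons(2,3) by (auto intro!: hcat_carrier)
  have z: "a z \<in> carrier_mat m (d z)" "b z \<in> carrier_mat m (d z)" using Cons(2,3) by auto
  show ?case using Cons acols_eq_iff[OF z(1) c(1) z(2) c(2)] by auto
qed simp

lemma mult_hcat:
  fixes X :: "'k::semiring_0 mat"
  assumes "X \<in> carrier_mat q m"
  shows "(\<And>y. y \<in> set ys \<Longrightarrow> a y \<in> carrier_mat m (d y)) \<Longrightarrow>
    X * hcat m (map a ys) = hcat q (map (\<lambda>y. X * a y) ys)"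
proof (induction ys)
  case (Cons z ys)
  have c: "hcat m (map a ys) \<in> carrier_mat m (sum_list (map d ys))"
    using Cons(2) by (auto intro!: hcat_carrier)
  have z: "a z \<in> carrier_mat m (d z)" using Cons(2) by auto
  show ?case using Cons mult_acols[OF assms z c] by auto
qed (use assms in auto)

lemma hcat_zero: "hcat m (map (\<lambda>y. 0\<^sub>m m (d y)) ys) = 0\<^sub>m m (sum_list (map d ys))"
  by (induction ys) (auto simp: acols_def)

lemma diag_block_carrier:
  "(\<And>y. y \<in> set ys \<Longrightarrow> e y \<in> carrier_mat (d y) (d y)) \<Longrightarrow>
    diag_block_mat (map e ys) \<in> carrier_mat (sum_list (map d ys)) (sum_list (map d ys))"
  by (induction ys) (auto simp: Let_def)

lemma hcat_mult_diag:
  fixes a :: "'a \<Rightarrow> 'k::semiring_0 mat"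
  shows "(\<And>y. y \<in> set ys \<Longrightarrow> a y \<in> carrier_mat m (d y)) \<Longrightarrow>
   (\<And>y. y \<in> set ys \<Longrightarrow> e y \<in> carrier_mat (d y) (d y)) \<Longrightarrow>
    hcat m (map a ys) * diag_block_mat (map e ys) = hcat m (map (\<lambda>y. a y * e y) ys)"
proof (induction ys)
  case (Cons z ys)
  let ?s = "sum_list (map d ys)"
  have c: "hcat m (map a ys) \<in> carrier_mat m ?s" using Cons(2) by (auto intro!: hcat_carrier)
  have D: "diag_block_mat (map e ys) \<in> carrier_mat ?s ?s"
    using Cons(3) by (auto intro!: diag_block_carrier)
  have z: "a z \<in> carrier_mat m (d z)" "e z \<in> carrier_mat (d z) (d z)" using Cons(2,3) by auto
  have "acols (a z) (hcat m (map a ys)) *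
      four_block_mat (e z) (0\<^sub>m (d z) ?s) (0\<^sub>m ?s (d z)) (diag_block_mat (map e ys)) =
    acols (a z * e z) (hcat m (map a ys) * diag_block_mat (map e ys))"
    using acols_mult_four_block[OF z(1) c z(2) zero_carrier_mat zero_carrier_mat D]
      right_mult_zero_mat[OF z(1), of ?s] right_mult_zero_mat[OF c, of "d z"] z c D by simp
  moreover have "hcat m (map a ys) * diag_block_mat (map e ys) = hcat m (map (\<lambda>y. a y * e y) ys)"
    using Cons by auto
  ultimately show ?case by (simp add: Let_def carrD[OF z(2)] carrD[OF D])
qed auto

lemma diag_block_mult:
  fixes e :: "'a \<Rightarrow> 'k::semiring_0 mat"
  shows "(\<And>y. y \<in> set ys \<Longrightarrow> e y \<in> carrier_mat (d y) (d y)) \<Longrightarrow>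
   (\<And>y. y \<in> set ys \<Longrightarrow> f y \<in> carrier_mat (d y) (d y)) \<Longrightarrow>
    diag_block_mat (map e ys) * diag_block_mat (map f ys) = diag_block_mat (map (\<lambda>y. e y * f y) ys)"
proof (induction ys)
  case (Cons z ys)
  let ?s = "sum_list (map d ys)"
  have D: "diag_block_mat (map e ys) \<in> carrier_mat ?s ?s"
    "diag_block_mat (map f ys) \<in> carrier_mat ?s ?s"
    using Cons(2,3) by (auto intro!: diag_block_carrier)
  have z: "e z \<in> carrier_mat (d z) (d z)" "f z \<in> carrier_mat (d z) (d z)" using Cons(2,3) by auto
  have "four_block_mat (e z) (0\<^sub>m (d z) ?s) (0\<^sub>m ?s (d z)) (diag_block_mat (map e ys)) *
      four_block_mat (f z) (0\<^sub>m (d z) ?s) (0\<^sub>m ?s (d z)) (diag_block_mat (map f ys)) =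
    four_block_mat (e z * f z) (0\<^sub>m (d z) ?s) (0\<^sub>m ?s (d z))
    (diag_block_mat (map e ys) * diag_block_mat (map f ys))"
    using mult_four_block_mat[OF z(1) zero_carrier_mat zero_carrier_mat D(1) z(2) zero_carrier_mat zero_carrier_mat D(2)]
      z D by simp
  moreover have I:
    "diag_block_mat (map e ys) * diag_block_mat (map f ys) = diag_block_mat (map (\<lambda>y. e y * f y) ys)"
    using Cons by auto
  moreover have "dim_row (diag_block_mat (map (\<lambda>y. e y * f y) ys)) = ?s"
    "dim_col (diag_block_mat (map (\<lambda>y. e y * f y) ys)) = ?s"
    using D by (auto simp flip: I)
  ultimately show ?case
    by (simp add: Let_def carrD[OF z(1)] carrD[OF z(2)] carrD[OF D(1)] carrD[OF D(2)])
qed (auto intro!: eq_matI)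

lemma diag_block_one:
  "(\<And>y. y \<in> set ys \<Longrightarrow> e y = 1\<^sub>m (d y)) \<Longrightarrow> diag_block_mat (map e ys) = 1\<^sub>m (sum_list (map d ys))"
  by (induction ys) (auto simp: Let_def intro!: eq_matI)

lemma diag_block_zero:
  "(\<And>y. y \<in> set ys \<Longrightarrow> e y = 0\<^sub>m (d y) (d y)) \<Longrightarrow>
    diag_block_mat (map e ys) = 0\<^sub>m (sum_list (map d ys)) (sum_list (map d ys))"
  by (induction ys) (auto simp: Let_def)

lemma transpose_diag_block:
  "(\<And>y. y \<in> set ys \<Longrightarrow> e y \<in> carrier_mat (d y) (d y)) \<Longrightarrow>
   transpose_mat (diag_block_mat (map e ys)) = diag_block_mat (map (\<lambda>y. transpose_mat (e y)) ys)"
proof (induction ys)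
  case (Cons z ys)
  let ?s = "sum_list (map d ys)"
  have D: "diag_block_mat (map e ys) \<in> carrier_mat ?s ?s"
    using Cons(2) by (auto intro!: diag_block_carrier)
  have z: "e z \<in> carrier_mat (d z) (d z)" using Cons(2) by auto
  have I: "transpose_mat (diag_block_mat (map e ys)) = diag_block_mat (map (\<lambda>y. transpose_mat (e y)) ys)"
    using Cons by auto
  then have "dim_row (diag_block_mat (map (\<lambda>y. transpose_mat (e y)) ys)) = ?s"
    "dim_col (diag_block_mat (map (\<lambda>y. transpose_mat (e y)) ys)) = ?s"
    using D by (metis carrD index_transpose_mat(2,3))+
  then show ?case
    using transpose_four_block_mat[OF z zero_carrier_mat[of "d z" ?s] zero_carrier_mat[of ?s "d z"] D] I D z
    by (simp add: Let_def)
qed auto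

lemma blk_idx_spec:
  "c < sum_list ds \<Longrightarrow> blk_idx ds c = (j, c') \<Longrightarrow>
    j < length ds \<and> c' < ds ! j \<and> c = sum_list (take j ds) + c'"
proof (induction ds arbitrary: c j c')
  case (Cons d ds)
  show ?case
  proof (cases "c < d")
    case True then show ?thesis using Cons by auto
  next
    case False
    obtain i b where ib: "blk_idx ds (c - d) = (i, b)" by fastforce
    then have "j = Suc i" "c' = b" using Cons(3) False by auto
    moreover have "i < length ds \<and> b < ds ! i \<and> c - d = sum_list (take i ds) + b"
      using Cons(1)[OF _ ib] Cons(2) False by auto
    ultimately show ?thesis using False by auto
  qed
qed simp

lemma blk_off_nth:
  assumes "distinct ys" "j < length ys"
  shows "blk_off d ys (ys ! j) = sum_list (take j (map d ys))"
proof -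
  have "takeWhile (\<lambda>z. z \<noteq> ys ! j) ys = take j ys"
    by (rule takeWhile_eq_take_P_nth) (use assms in \<open>auto simp: nth_eq_iff_index_eq\<close>)
  then show ?thesis unfolding blk_off_def by (simp add: take_map)
qed

lemma index_hcat:
  "(\<And>y. y \<in> set ys \<Longrightarrow> a y \<in> carrier_mat m (d y)) \<Longrightarrow> i < m \<Longrightarrow> c < sum_list (map d ys) \<Longrightarrow>
    hcat m (map a ys) $$ (i, c) = (let (j, c') = blk_idx (map d ys) c in a (ys ! j) $$ (i, c'))"
proof (induction ys arbitrary: c)
  case (Cons z ys)
  have h: "hcat m (map a ys) \<in> carrier_mat m (sum_list (map d ys))"
    using Cons(2) by (auto intro!: hcat_carrier)
  have z: "a z \<in> carrier_mat m (d z)" using Cons(2) by auto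
  show ?case using index_acols[OF z h Cons(3), of c] Cons(1)[of "c - d z"] Cons(2-4)
    by (auto simp: Let_def split: prod.splits)
qed simp

section \<open>Representations and duality\<close>

abbreviation (input) sinkv :: "'k qmod \<Rightarrow> nat list \<Rightarrow> bool" where
  "sinkv M v \<equiv> is_sink (orient M) v"

lemma nbrs_opposite: 
  assumes "tvert n x" "y \<in> set (nbrs n x)"
  shows "tadj n x y" "tadj n y x" "tvert n y" "is_sink w y \<longleftrightarrow> \<not> is_sink w x"
proof -
  show "tadj n x y" using assms set_nbrs by blast
  then show "tadj n y x" "tvert n y" "is_sink w y \<longleftrightarrow> \<not> is_sink w x"
    using tadj_parity unfolding is_sink_def tadj_def by blast+
qed

lemma arr_carrier:
  assumes "valid_mod n M" "tvert n x" "y \<in> set (nbrs n x)"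
  shows "sinkv M x \<Longrightarrow> arr M y x \<in> carrier_mat (dimv M x) (dimv M y)"
    "\<not> sinkv M x \<Longrightarrow> arr M x y \<in> carrier_mat (dimv M y) (dimv M x)"
  using assms nbrs_opposite[OF assms(2,3)]
    unfolding valid_mod_def is_arrow_def is_source_def by blast+

abbreviation (input) ndim :: "nat \<Rightarrow> 'k qmod \<Rightarrow> nat list \<Rightarrow> nat" where
  "ndim n M x \<equiv> sum_list (map (dimv M) (nbrs n x))"

lemma phi_mat_carrier [simp]: "phi_mat n M x \<in> carrier_mat (dimv M x) (ndim n M x)"
  unfolding phi_mat_def Let_def by auto

lemma psi_mat_carrier [simp]: "psi_mat n M x \<in> carrier_mat (ndim n M x) (dimv M x)"
  unfolding psi_mat_def Let_def by auto

text \<open>As a row of arrow matrices, \<open>phi_mat\<close> turns the commutation relations for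
  all arrows into a sink into one matrix identity, and back.\<close>

lemma phi_mat_hcat:
  assumes "valid_mod n M" "tvert n x" "sinkv M x"
  shows "phi_mat n M x = hcat (dimv M x) (map (\<lambda>y. arr M y x) (nbrs n x))"
proof (rule eq_matI)
  have c: "arr M y x \<in> carrier_mat (dimv M x) (dimv M y)" if "y \<in> set (nbrs n x)" for y
    using arr_carrier(1)[OF assms(1,2) that assms(3)] .
  note h = hcat_carrier[of "nbrs n x" "\<lambda>y. arr M y x", OF c]
  fix i j assume "i < dim_row (hcat (dimv M x) (map (\<lambda>y. arr M y x) (nbrs n x)))"
    "j < dim_col (hcat (dimv M x) (map (\<lambda>y. arr M y x) (nbrs n x)))"
  then have ij: "i < dimv M x" "j < ndim n M x" using h by auto
  then show "phi_mat n M x $$ (i, j) = hcat (dimv M x) (map (\<lambda>y. arr M y x) (nbrs n x)) $$ (i, j)"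
    using index_hcat[of "nbrs n x" "\<lambda>y. arr M y x", OF c ij]
      unfolding phi_mat_def by (simp add: Let_def)
next
  have c: "arr M y x \<in> carrier_mat (dimv M x) (dimv M y)" if "y \<in> set (nbrs n x)" for y
    using arr_carrier(1)[OF assms(1,2) that assms(3)] .
  note h = hcat_carrier[of "nbrs n x" "\<lambda>y. arr M y x", OF c]
  show "dim_row (phi_mat n M x) = dim_row (hcat (dimv M x) (map (\<lambda>y. arr M y x) (nbrs n x)))"
    "dim_col (phi_mat n M x) = dim_col (hcat (dimv M x) (map (\<lambda>y. arr M y x) (nbrs n x)))"
    using h carrD[OF phi_mat_carrier] by auto
qed

text \<open>The linear dual: transposed arrows on the opposite quiver. It exchanges reflections at
  sinks and at sources, so that only one kind has to be studied.\<close>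

definition dualm :: "'k qmod \<Rightarrow> 'k qmod" where
  "dualm M = \<lparr> orient = \<not> orient M, dimv = dimv M, arr = (\<lambda>x y. transpose_mat (arr M y x)) \<rparr>"

lemma dualm_simps [simp]: "orient (dualm M) = (\<not> orient M)" "dimv (dualm M) = dimv M"
  "arr (dualm M) x y = transpose_mat (arr M y x)" "dualm (dualm M) = M"
  unfolding dualm_def by auto

lemma is_sink_Not [simp]: "is_sink (\<not> w) v \<longleftrightarrow> \<not> is_sink w v"
  unfolding is_sink_def by auto

lemma is_arrow_Not: "is_arrow n (\<not> w) x y \<longleftrightarrow> is_arrow n w y x"
  unfolding is_arrow_def is_source_def tadj_def by auto

lemma valid_dualm [simp]: "valid_mod n (dualm M) \<longleftrightarrow> valid_mod n M"
  unfolding valid_mod_def by (auto simp: is_arrow_Not)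

lemma phi_mat_dualm:
  assumes "valid_mod n M" "tvert n x" "\<not> sinkv M x"
  shows "phi_mat n (dualm M) x = transpose_mat (psi_mat n M x)"
proof (rule eq_matI)
  fix i j assume "i < dim_row (transpose_mat (psi_mat n M x))"
  "j < dim_col (transpose_mat (psi_mat n M x))"
  then have ij: "i < dimv M x" "j < ndim n M x" using carrD[OF psi_mat_carrier[of n M x]] by auto
  obtain b c where bc: "blk_idx (map (dimv M) (nbrs n x)) j = (b, c)" by fastforce
  then have b: "b < length (nbrs n x)" "c < dimv M (nbrs n x ! b)"
    using blk_idx_spec[OF ij(2) bc] by auto
  then have "arr M x (nbrs n x ! b) \<in> carrier_mat (dimv M (nbrs n x ! b)) (dimv M x)"
    using arr_carrier(2)[OF assms(1,2) _ assms(3)] by simp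
  then show "phi_mat n (dualm M) x $$ (i, j) = transpose_mat (psi_mat n M x) $$ (i, j)"
    using ij bc b unfolding phi_mat_def psi_mat_def Let_def by auto
qed (use carrD[OF psi_mat_carrier[of n M x]] carrD[OF phi_mat_carrier[of n "dualm M" x]] in auto)

lemma psi_mat_dualm:
  assumes "valid_mod n M" "tvert n x" "sinkv M x"
  shows "psi_mat n (dualm M) x = transpose_mat (phi_mat n M x)"
  using phi_mat_dualm[of n "dualm M" x] assms by simp

text \<open>\<open>is_refl n M N\<close>: \<open>N\<close> arises from \<open>M\<close> by reflection at all sinks, for some choice of kernel
  bases.  Reflection at all sources is the same relation between the dual representations.\<close>

definition is_refl :: "nat \<Rightarrow> 'k::field qmod \<Rightarrow> 'k qmod \<Rightarrow> bool" where
  "is_refl n M N \<longleftrightarrow> valid_mod n M \<and> valid_mod n N \<and> orient N = (\<not> orient M) \<and>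
     (\<forall>v. \<not> sinkv M v \<longrightarrow> dimv N v = dimv M v) \<and>
     (\<forall>x. tvert n x \<and> sinkv M x \<longrightarrow> kernel_basis (phi_mat n M x) (psi_mat n N x))"

section \<open>Reflections and their supports\<close>

lemma zero_inner_mult:
  fixes A :: "'k::semiring_0 mat"
  assumes "A \<in> carrier_mat m 0" "B \<in> carrier_mat 0 p"
  shows "A * B = 0\<^sub>m m p"
  using assms by (intro eq_matI) (auto simp: scalar_prod_def)

lemma one_eq_zero_mat: "(1\<^sub>m k :: 'k::zero_neq_one mat) = 0\<^sub>m k k \<longleftrightarrow> k = 0"
proof
  assume e: "(1\<^sub>m k :: 'k mat) = 0\<^sub>m k k"
  show "k = 0"
  proof (rule ccontr)
    assume "k \<noteq> 0"
    then have "(1\<^sub>m k :: 'k mat) $$ (0, 0) = 1" "(0\<^sub>m k k :: 'k mat) $$ (0, 0) = 0" by auto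
    then show False using e by simp
  qed
qed auto

lemma kernel_basis_dim_col_0:
  assumes "kernel_basis A B" "dim_col A = 0"
  shows "dim_col B = 0"
proof -
  obtain L where L: "L \<in> carrier_mat (dim_col B) 0" "L * B = 1\<^sub>m (dim_col B)" "dim_row B = 0"
    using assms unfolding kernel_basis_def by auto
  then have "L * B = 0\<^sub>m (dim_col B) (dim_col B)" by (intro zero_inner_mult) auto
  then show ?thesis using L one_eq_zero_mat by metis
qed

lemma kernel_basis_dim_row_0:
  assumes "kernel_basis A B" "dim_row A = 0" "dim_col B = 0"
  shows "dim_col A = 0"
proof -
  let ?n = "dim_col A"
  obtain L R where L: "L \<in> carrier_mat 0 ?n" "R \<in> carrier_mat ?n 0" "B * L + R * A = 1\<^sub>m ?n"
    "dim_row B = ?n"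
    using assms unfolding kernel_basis_def by auto
  then have "B * L = 0\<^sub>m ?n ?n" "R * A = 0\<^sub>m ?n ?n" using assms by (auto intro!: zero_inner_mult)
  then have "1\<^sub>m ?n = (0\<^sub>m ?n ?n :: 'a mat)" using L(3) by simp
  then show ?thesis using one_eq_zero_mat by metis
qed

lemma dim_shift_0:
  fixes M :: "'k::field qmod"
  assumes "tvert n x" "\<And>y. tadj n x y \<Longrightarrow> dimv M y = 0" 
  shows "fst (ker_choice (phi_mat n M x)) = 0"
    "fst (coker_choice (psi_mat n M x)) = 0"
proof -
  have z: "ndim n M x = 0" using assms set_nbrs by (auto simp: sum_list_eq_0_iff)
  then show "fst (ker_choice (phi_mat n M x)) = 0"
    using kernel_basis_dim_col_0[OF ker_choice(2)[of "phi_mat n M x"]]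
      ker_choice(1)[of "phi_mat n M x"]
      carrD[OF phi_mat_carrier[of n M x]] by simp
  show "fst (coker_choice (psi_mat n M x)) = 0"
    using kernel_basis_dim_col_0[OF coker_choice(2)[of "psi_mat n M x"]]
      coker_choice(1)[of "psi_mat n M x"]
      carrD[OF psi_mat_carrier[of n M x]] z by simp
qed

lemma finite_nbhd: "finite S \<Longrightarrow> (\<And>x. x \<in> S \<Longrightarrow> tvert n x) \<Longrightarrow> finite {y. \<exists>x\<in>S. tadj n x y}"
proof -
  assume S: "finite S" "\<And>x. x \<in> S \<Longrightarrow> tvert n x"
  then have "{y. \<exists>x\<in>S. tadj n x y} \<subseteq> (\<Union>x\<in>S. set (nbrs n x))" using set_nbrs by blast
  moreover have "finite (\<Union>x\<in>S. set (nbrs n x))" using S(1) by blast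
  ultimately show ?thesis by (rule finite_subset)
qed

text \<open>A new vertex space can be nonzero only next to the old support, and a finite set has
  finitely many neighbours.\<close>

lemma valid_shift:
  fixes M :: "'k::field qmod"
  assumes "valid_mod n M"
  shows "valid_mod n (shift n M)" "valid_mod n (shift_minus n M)"
proof -
  define S where "S = {v. dimv M v \<noteq> 0}"
  have S: "finite S" "\<And>x. x \<in> S \<Longrightarrow> tvert n x" using assms unfolding valid_mod_def S_def by auto
  have "finite (S \<union> {y. \<exists>x\<in>S. tadj n x y})" using S finite_nbhd by blast
  moreover have zero: "dimv (shift n M) v = 0" "dimv (shift_minus n M) v = 0"
    if "v \<notin> S \<union> {y. \<exists>x\<in>S. tadj n x y}" for v
  proof -
    have "dimv M v = 0" using that unfolding S_def by auto
    moreover have "dimv M y = 0" if "tadj n v y" for y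
      using that \<open>v \<notin> _\<close> unfolding S_def tadj_def by auto
    ultimately show "dimv (shift n M) v = 0" "dimv (shift_minus n M) v = 0"
      using dim_shift_0[of n v M] by (simp_all add: shift_def shift_minus_def Let_def)
  qed
  have "{v. dimv (shift n M) v \<noteq> 0} \<subseteq> S \<union> {y. \<exists>x\<in>S. tadj n x y}"
    "{v. dimv (shift_minus n M) v \<noteq> 0} \<subseteq> S \<union> {y. \<exists>x\<in>S. tadj n x y}"
    using zero by (metis (mono_tags, lifting) mem_Collect_eq subsetI)+
  ultimately have "finite {v. dimv (shift n M) v \<noteq> 0}" "finite {v. dimv (shift_minus n M) v \<noteq> 0}"
    using finite_subset by blast+
  then show "valid_mod n (shift n M)" "valid_mod n (shift_minus n M)"
    unfolding valid_mod_def
    by (auto simp: shift_def shift_minus_def Let_def is_arrow_def is_source_def tadj_def)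
qed

text \<open>\<open>shift\<close> cuts the kernel matrix into blocks at the offsets
  \<open>blk_off\<close>, and \<open>psi_mat\<close> stacks them again. The offsets match
  \<open>blk_idx\<close> because the neighbours are distinct.\<close>

lemma psi_mat_shift:
  fixes M :: "'k::field qmod"
  assumes "tvert n x" "sinkv M x"
  shows "psi_mat n (shift n M) x = snd (ker_choice (phi_mat n M x))"
proof (rule eq_matI)
  let ?B = "snd (ker_choice (phi_mat n M x))" and ?ys = "nbrs n x"
  have B: "?B \<in> carrier_mat (ndim n M x) (fst (ker_choice (phi_mat n M x)))"
    using ker_choice(1)[of "phi_mat n M x"] carrD[OF phi_mat_carrier[of n M x]] by simp
  have ds: "map (dimv (shift n M)) ?ys = map (dimv M) ?ys"
    using nbrs_opposite[OF assms(1)] assms(2) by (auto simp: shift_def Let_def)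
  have dx: "dimv (shift n M) x = fst (ker_choice (phi_mat n M x))"
    using assms by (simp add: shift_def Let_def)
  show "dim_row (psi_mat n (shift n M) x) = dim_row ?B"
    "dim_col (psi_mat n (shift n M) x) = dim_col ?B"
    using B carrD[OF psi_mat_carrier[of n "shift n M" x]] ds dx by auto
  fix r i assume "r < dim_row ?B" "i < dim_col ?B"
  then have ri: "r < ndim n M x" "i < fst (ker_choice (phi_mat n M x))" using B by auto
  obtain j c where jc: "blk_idx (map (dimv M) ?ys) r = (j, c)" by fastforce
  then have j: "j < length ?ys" "c < dimv M (?ys ! j)"
    "r = sum_list (take j (map (dimv M) ?ys)) + c"
    using blk_idx_spec[OF ri(1) jc] by auto
  then have "arr (shift n M) x (?ys ! j) $$ (c, i) = ?B $$ (r, i)"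
    using assms ri blk_off_nth[OF distinct_nbrs j(1), of "dimv M"] by (simp add: shift_def Let_def)
  then show "psi_mat n (shift n M) x $$ (r, i) = ?B $$ (r, i)"
    unfolding psi_mat_def Let_def ds dx using jc ri by simp
qed

lemma phi_mat_shift_minus:
  fixes M :: "'k::field qmod"
  assumes "tvert n x" "\<not> sinkv M x"
  shows "phi_mat n (shift_minus n M) x = snd (coker_choice (psi_mat n M x))"
proof (rule eq_matI)
  let ?C = "snd (coker_choice (psi_mat n M x))" and ?ys = "nbrs n x"
  have C: "?C \<in> carrier_mat (fst (coker_choice (psi_mat n M x))) (ndim n M x)"
    using coker_choice(1)[of "psi_mat n M x"] carrD[OF psi_mat_carrier[of n M x]] by simp
  have ds: "map (dimv (shift_minus n M)) ?ys = map (dimv M) ?ys"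
    using nbrs_opposite[OF assms(1)] assms(2) by (auto simp: shift_minus_def is_source_def Let_def)
  have dx: "dimv (shift_minus n M) x = fst (coker_choice (psi_mat n M x))"
    using assms by (simp add: shift_minus_def is_source_def Let_def)
  show "dim_row (phi_mat n (shift_minus n M) x) = dim_row ?C"
    "dim_col (phi_mat n (shift_minus n M) x) = dim_col ?C"
    using C carrD[OF phi_mat_carrier[of n "shift_minus n M" x]] ds dx by auto
  fix i r assume "i < dim_row ?C" "r < dim_col ?C"
  then have ri: "r < ndim n M x" "i < fst (coker_choice (psi_mat n M x))" using C by auto
  obtain j c where jc: "blk_idx (map (dimv M) ?ys) r = (j, c)" by fastforce
  then have j: "j < length ?ys" "c < dimv M (?ys ! j)"
    "r = sum_list (take j (map (dimv M) ?ys)) + c"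
    using blk_idx_spec[OF ri(1) jc] by auto
  then have "arr (shift_minus n M) (?ys ! j) x $$ (i, c) = ?C $$ (i, r)"
    using assms ri blk_off_nth[OF distinct_nbrs j(1), of "dimv M"]
    by (simp add: shift_minus_def is_source_def Let_def)
  then show "phi_mat n (shift_minus n M) x $$ (i, r) = ?C $$ (i, r)"
    unfolding phi_mat_def Let_def ds dx using jc ri by simp
qed

lemma is_refl_shift:
  assumes "valid_mod n M"
  shows "is_refl n M (shift n M)"
  unfolding is_refl_def
proof (intro conjI allI impI)
  fix v assume "\<not> sinkv M v"
  then show "dimv (shift n M) v = dimv M v"
    using assms unfolding valid_mod_def by (simp add: shift_def Let_def)
next
  fix x assume "tvert n x \<and> sinkv M x"
  then show "kernel_basis (phi_mat n M x) (psi_mat n (shift n M) x)"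
    using psi_mat_shift ker_choice(2) by metis
qed (use assms valid_shift in \<open>auto simp: shift_def Let_def\<close>)

lemma is_refl_shift_minus:
  assumes "valid_mod n M"
  shows "is_refl n (dualm M) (dualm (shift_minus n M))"
  unfolding is_refl_def
proof (intro conjI allI impI)
  fix v assume "\<not> sinkv (dualm M) v"
  then show "dimv (dualm (shift_minus n M)) v = dimv (dualm M) v"
    using assms unfolding valid_mod_def by (simp add: shift_minus_def is_source_def Let_def)
next
  fix x assume "tvert n x \<and> sinkv (dualm M) x"
  then have x: "tvert n x" "\<not> sinkv M x" by auto
  have "sinkv (shift_minus n M) x" using x by (simp add: shift_minus_def Let_def)
  then have
    "psi_mat n (dualm (shift_minus n M)) x = transpose_mat (snd (coker_choice (psi_mat n M x)))"
    using psi_mat_dualm[OF valid_shift(2)[OF assms] x(1)] phi_mat_shift_minus[OF x] by simp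
  then show "kernel_basis (phi_mat n (dualm M) x) (psi_mat n (dualm (shift_minus n M)) x)"
    using phi_mat_dualm[OF assms x] coker_choice(2) by metis
qed (use assms valid_shift in \<open>auto simp: shift_minus_def Let_def\<close>)

text \<open>The two extreme cases of a kernel: a map to zero has the whole sum over the neighbours
  as kernel, and a map from zero has kernel zero.\<close>

lemma is_refl_supp:
  assumes "is_refl n M N"
  shows "\<not> sinkv M v \<Longrightarrow> v \<in> supp N \<longleftrightarrow> v \<in> supp M"
    "sinkv M v \<Longrightarrow> v \<notin> supp M \<Longrightarrow> tadj n v y \<Longrightarrow> y \<in> supp M \<Longrightarrow> v \<in> supp N"
    "sinkv M v \<Longrightarrow> v \<in> supp N \<Longrightarrow> \<exists>y\<in>supp M. tadj n v y"
proof -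
  show "\<not> sinkv M v \<Longrightarrow> v \<in> supp N \<longleftrightarrow> v \<in> supp M" using assms unfolding is_refl_def supp_def by auto
next
  assume v: "sinkv M v" "v \<notin> supp M" "tadj n v y" "y \<in> supp M"
  then have tv: "tvert n v" unfolding tadj_def by auto
  then have k: "kernel_basis (phi_mat n M v) (psi_mat n N v)"
    using assms v unfolding is_refl_def by auto
  have "y \<in> set (nbrs n v)" using v set_nbrs[OF tv] by auto
  then have nz: "ndim n M v \<noteq> 0" using v(4) unfolding supp_def by (auto simp: sum_list_eq_0_iff)
  have "dimv N v \<noteq> 0"
  proof
    assume "dimv N v = 0"
    then have "dim_col (phi_mat n M v) = 0"
      using kernel_basis_dim_row_0[OF k] v(2) carrD[OF phi_mat_carrier[of n M v]]
        carrD[OF psi_mat_carrier[of n N v]] unfolding supp_def by simp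
    then have "ndim n M v = 0" by (simp only: carrD(2)[OF phi_mat_carrier[of n M v]])
    then show False by (rule notE[OF nz])
  qed
  then show "v \<in> supp N" unfolding supp_def by simp
next
  assume v: "sinkv M v" "v \<in> supp N"
  then have tv: "tvert n v" using assms unfolding is_refl_def valid_mod_def supp_def by auto
  then have k: "kernel_basis (phi_mat n M v) (psi_mat n N v)"
    using assms v unfolding is_refl_def by auto
  have nz: "ndim n M v \<noteq> 0"
  proof
    assume "ndim n M v = 0"
    then have "dim_col (phi_mat n M v) = 0" by (simp only: carrD(2)[OF phi_mat_carrier[of n M v]])
    then have "dim_col (psi_mat n N v) = 0" by (rule kernel_basis_dim_col_0[OF k])
    then show False using v(2) carrD(2)[OF psi_mat_carrier[of n N v]] unfolding supp_def by simp
  qed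
  have "\<exists>y\<in>set (nbrs n v). dimv M y \<noteq> 0"
  proof (rule ccontr)
    assume "\<not> ?thesis"
    then have "ndim n M v = 0" by (auto simp: sum_list_eq_0_iff)
    then show False by (rule notE[OF nz])
  qed
  then show "\<exists>y\<in>supp M. tadj n v y" using set_nbrs[OF tv] unfolding supp_def by auto
qed

section \<open>Idempotent endomorphisms and indecomposability\<close>

definition idem_endo :: "nat \<Rightarrow> 'k::field qmod \<Rightarrow> (nat list \<Rightarrow> 'k mat) \<Rightarrow> bool" where
  "idem_endo n M e \<longleftrightarrow> is_hom n M M e \<and> (\<forall>v. e v * e v = e v)"

text \<open>This form of indecomposability passes through reflections directly: if \<open>N\<close> is the reflection of
  \<open>M\<close>, then at each sink the space of \<open>M\<close> is the cokernel of the inclusion of the space of \<open>N\<close>, so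
  idempotents of \<open>N\<close> induce idempotents of \<open>M\<close>.\<close>

definition indec :: "nat \<Rightarrow> 'k::field qmod \<Rightarrow> bool" where
  "indec n M \<longleftrightarrow> valid_mod n M \<and> \<not> zero_mod M \<and>
     (\<forall>e. idem_endo n M e \<longrightarrow>
       (\<forall>v. e v = 0\<^sub>m (dimv M v) (dimv M v)) \<or> (\<forall>v. e v = 1\<^sub>m (dimv M v)))"

lemma indecE:
  assumes "indec n M" "idem_endo n M e"
  obtains "\<And>v. e v = 0\<^sub>m (dimv M v) (dimv M v)" | "\<And>v. e v = 1\<^sub>m (dimv M v)"
  using assms unfolding indec_def by blast

lemma idem_endo_carrier: "idem_endo n M e \<Longrightarrow> e v \<in> carrier_mat (dimv M v) (dimv M v)"
  unfolding idem_endo_def is_hom_def by auto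

lemma idem_endo_dualm:
  assumes "valid_mod n M" "idem_endo n (dualm M) e"
  shows "idem_endo n M (\<lambda>v. transpose_mat (e v))"
proof -
  have c: "e v \<in> carrier_mat (dimv M v) (dimv M v)" for v
    using idem_endo_carrier[OF assms(2)] by simp
  have "arr M x y * transpose_mat (e x) = transpose_mat (e y) * arr M x y"
    if a: "is_arrow n (orient M) x y" for x y
  proof -
    have A: "arr M x y \<in> carrier_mat (dimv M y) (dimv M x)"
      using assms(1) a unfolding valid_mod_def by blast
    have "transpose_mat (arr M x y) * e y = e x * transpose_mat (arr M x y)"
      using assms(2) a unfolding idem_endo_def is_hom_def by (auto simp: is_arrow_Not)
    from arg_cong[OF this, of transpose_mat] show ?thesis
      using transpose_mult[OF transpose_carrier_mat[THEN iffD2, OF A] c[of y]]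
        transpose_mult[OF c[of x] transpose_carrier_mat[THEN iffD2, OF A]] by simp
  qed
  moreover have "transpose_mat (e v) * transpose_mat (e v) = transpose_mat (e v)" for v
    using transpose_mult[OF c[of v] c[of v]] assms(2) unfolding idem_endo_def by simp
  ultimately show ?thesis using c unfolding idem_endo_def is_hom_def by simp
qed

lemma indec_dualm:
  assumes "indec n M"
  shows "indec n (dualm M)"
  unfolding indec_def
proof (intro conjI allI impI)
  show "valid_mod n (dualm M)" "\<not> zero_mod (dualm M)"
    using assms unfolding indec_def zero_mod_def by auto
  fix e assume e: "idem_endo n (dualm M) e"
  have "(\<forall>v. transpose_mat (e v) = 0\<^sub>m (dimv M v) (dimv M v)) \<or> (\<forall>v. transpose_mat (e v) = 1\<^sub>m (dimv M v))"
    using assms idem_endo_dualm[OF _ e] unfolding indec_def by blast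
  then have
    "(\<forall>v. e v = transpose_mat (0\<^sub>m (dimv M v) (dimv M v))) \<or> (\<forall>v. e v = transpose_mat (1\<^sub>m (dimv M v)))"
    by (metis transpose_transpose)
  then show
    "(\<forall>v. e v = 0\<^sub>m (dimv (dualm M) v) (dimv (dualm M) v)) \<or> (\<forall>v. e v = 1\<^sub>m (dimv (dualm M) v))"
    by simp
qed

lemma sink_arrow:
  assumes "is_arrow n (orient M) y x"
  shows "tvert n x" "sinkv M x" "y \<in> set (nbrs n x)" "\<not> sinkv M y" "tvert n y"
  using assms set_nbrs[of n x] unfolding is_arrow_def is_source_def tadj_def by auto

text \<open>A projection onto a complement of the image of \<open>phi_mat\<close> at
  \<open>x\<close>, extended by zero, is an idempotent endomorphism. If it vanishes,
  \<open>phi_mat\<close> is onto. If it is the identity, \<open>M\<close> lives at the sink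
  \<open>x\<close> alone and its reflection is zero.\<close>

lemma indec_phi_right_inverse:
  fixes M N :: "'k::field qmod"
  assumes "indec n M" "is_refl n M N" "\<not> zero_mod N" "tvert n x" "sinkv M x"
  shows "\<exists>R\<in>carrier_mat (ndim n M x) (dimv M x). phi_mat n M x * R = 1\<^sub>m (dimv M x)"
proof -
  define m A where "m = dimv M x" and "A = phi_mat n M x"
  have valid: "valid_mod n M" using assms(1) unfolding indec_def by auto
  have Ac: "A \<in> carrier_mat m (ndim n M x)" unfolding A_def m_def by simp
  obtain r P Q P' Q' where f: "P \<in> carrier_mat m r" "Q \<in> carrier_mat r (ndim n M x)"
    "P' \<in> carrier_mat r m" "Q' \<in> carrier_mat (ndim n M x) r"
    "A = P * Q" "P' * P = 1\<^sub>m r" "Q * Q' = 1\<^sub>m r" using full_rank_factorization[OF Ac] .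
  define F where "F = 1\<^sub>m m - P * P'"
  have Fc: "F \<in> carrier_mat m m" unfolding F_def using f by auto
  have "P * P' * P = P" using mult_assoc_dim[of P P' P] f by simp
  then have FP: "F * P = 0\<^sub>m m r"
    unfolding F_def using f by (subst mat_1_minus_mult[of _ m _ r]) auto
  have FA: "F * A = 0\<^sub>m m (ndim n M x)"
    unfolding f(5) using mult_assoc_dim[of F P Q] FP Fc f(1,2) by simp
  have FPP: "F * (P * P') = 0\<^sub>m m m" using mult_assoc_dim[of F P P'] FP Fc f(1,3) by simp
  have "F * F = F - F * (P * P')"
    using mat_mult_1_minus[of "P * P'" m F m] f(1,3) Fc unfolding F_def by simp
  also have "\<dots> = F" unfolding FPP using Fc by (intro eq_matI) auto
  finally have FF: "F * F = F" .
  define e where "e v = (if v = x then F else 0\<^sub>m (dimv M v) (dimv M v))" for v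
  have "idem_endo n M e"
    unfolding idem_endo_def is_hom_def
  proof (intro conjI allI impI)
    fix v
    show "e v \<in> carrier_mat (dimv M v) (dimv M v)" "e v * e v = e v"
      using Fc FF unfolding e_def m_def by auto
  next
    fix y z assume a: "is_arrow n (orient M) y z"
    have c: "arr M y z \<in> carrier_mat (dimv M z) (dimv M y)"
      using valid a unfolding valid_mod_def by blast
    have "y \<noteq> x" using sink_arrow[OF a] assms(5) by auto
    show "arr M y z * e y = e z * arr M y z"
    proof (cases "z = x")
      case True
      have c': "arr M y x \<in> carrier_mat m (dimv M y)" if "y \<in> set (nbrs n x)" for y
        using arr_carrier(1)[OF valid assms(4) that assms(5)] m_def by simp
      have "hcat m (map (\<lambda>y. F * arr M y x) (nbrs n x)) = F * A"
        unfolding A_def phi_mat_hcat[OF valid assms(4,5)]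
          using mult_hcat[OF Fc, of "nbrs n x" "\<lambda>y. arr M y x" "dimv M"] c'
        unfolding m_def by simp
      also have "\<dots> = hcat m (map (\<lambda>y. 0\<^sub>m m (dimv M y)) (nbrs n x))" unfolding FA hcat_zero ..
      finally have "F * arr M y x = 0\<^sub>m m (dimv M y)"
        using hcat_eq_iff[of "nbrs n x" "\<lambda>y. F * arr M y x" m "dimv M" "\<lambda>y. 0\<^sub>m m (dimv M y)"] c' Fc
          sink_arrow(3)[OF a] True by auto
      then show ?thesis using c \<open>y \<noteq> x\<close> True unfolding e_def m_def by simp
    qed (use c \<open>y \<noteq> x\<close> in \<open>simp add: e_def\<close>)
  qed simp
  then show ?thesis
  proof (rule indecE[OF assms(1)])
    assume "\<And>v. e v = 0\<^sub>m (dimv M v) (dimv M v)"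
    then have "F = 0\<^sub>m m m" unfolding e_def m_def by metis
    then have "1\<^sub>m m = P * P'"
      using mat_diff_eq_0[of "1\<^sub>m m" m m "P * P'"] f unfolding F_def by simp
    moreover have "A * (Q' * P') = P * P'"
      unfolding f(5) using mult_assoc_dim[of P Q "Q' * P'"] mult_assoc_cancel[OF f(7), of P'] f(1-4)
        by simp
    ultimately have "A * (Q' * P') = 1\<^sub>m m" by simp
    then show ?thesis using f(3,4) unfolding A_def m_def by (intro bexI[of _ "Q' * P'"]) auto
  next
    assume one: "\<And>v. e v = 1\<^sub>m (dimv M v)"
    have dim0: "dimv M v = 0" if "v \<noteq> x" for v
      using one[of v] that one_eq_zero_mat[of "dimv M v"] unfolding e_def by metis
    have S: "supp M \<subseteq> {x}"
    proof
      fix v assume "v \<in> supp M"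
      then have "dimv M v \<noteq> 0" unfolding supp_def by simp
      then show "v \<in> {x}" using dim0[of v] by (cases "v = x") simp_all
    qed
    have "v \<notin> supp N" for v
    proof
      assume v: "v \<in> supp N"
      show False
      proof (cases "sinkv M v")
        case True
        then obtain y where "y \<in> supp M" "tadj n v y" using is_refl_supp(3)[OF assms(2)] v by blast
        then have "\<not> sinkv M y" "sinkv M y"
          using True tadj_parity S assms(5) unfolding is_sink_def by auto
        then show False by simp
      next
        case False
        then show False using is_refl_supp(1)[OF assms(2)] v S assms(5) by auto
      qed
    qed
    then show ?thesis using assms(3) unfolding zero_mod_def supp_def by auto
  qed
qed

text \<open>Write A for \<open>phi_mat n M x\<close>, B for \<open>psi_mat n N x\<close>, and D for
  the given idempotent on the sum over the neighbours of a sink \<open>x\<close>. With a right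
  inverse R of A, the action of D on the cokernel of B is A D R. That the resulting idempotent is 0
  or 1 is read off for \<open>e\<close> directly at the sources of \<open>M\<close>, and then at the
  sinks because B is injective.\<close>

lemma indec_refl:
  fixes M N :: "'k::field qmod"
  assumes "indec n M" "is_refl n M N" "\<not> zero_mod N"
  shows "indec n N"
  unfolding indec_def
proof (intro conjI allI impI)
  show "valid_mod n N" "\<not> zero_mod N" using assms unfolding is_refl_def by auto
  fix e assume e: "idem_endo n N e"
  have valid: "valid_mod n M" "valid_mod n N" using assms unfolding is_refl_def by auto
  have oN: "orient N = (\<not> orient M)" using assms(2) unfolding is_refl_def by auto
  have dN: "dimv N v = dimv M v" if "\<not> sinkv M v \<or> \<not> tvert n v" for v
    using that assms(2) unfolding is_refl_def valid_mod_def by auto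
  have ec: "e v \<in> carrier_mat (dimv N v) (dimv N v)" for v using idem_endo_carrier[OF e] .
  define D where "D x = diag_block_mat (map e (nbrs n x))" for x
  have "\<exists>L R. L \<in> carrier_mat (dimv N x) (ndim n M x) \<and> R \<in> carrier_mat (ndim n M x) (dimv M x) \<and>
      L * psi_mat n N x = 1\<^sub>m (dimv N x) \<and> phi_mat n M x * R = 1\<^sub>m (dimv M x) \<and>
      phi_mat n M x * psi_mat n N x = 0\<^sub>m (dimv M x) (dimv N x) \<and>
      psi_mat n N x * L + R * phi_mat n M x = 1\<^sub>m (ndim n M x) \<and>
      psi_mat n N x \<in> carrier_mat (ndim n M x) (dimv N x)"
    if x: "tvert n x" "sinkv M x" for x
  proof -
    let ?A = "phi_mat n M x" and ?B = "psi_mat n N x"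
    have Ac: "?A \<in> carrier_mat (dimv M x) (ndim n M x)" by simp
    have k: "kernel_basis ?A ?B" using assms(2) x unfolding is_refl_def by auto
    then have Bc: "?B \<in> carrier_mat (ndim n M x) (dimv N x)"
      using carrD[OF psi_mat_carrier[of n N x]] carrD[OF Ac] unfolding kernel_basis_def by auto
    obtain L R where LR: "L \<in> carrier_mat (dimv N x) (ndim n M x)"
      "R \<in> carrier_mat (ndim n M x) (dimv M x)"
      "L * ?B = 1\<^sub>m (dimv N x)" "?A * ?B = 0\<^sub>m (dimv M x) (dimv N x)"
      "?B * L + R * ?A = 1\<^sub>m (ndim n M x)"
      using k carrD[OF Bc] carrD[OF Ac] unfolding kernel_basis_def by auto
    obtain S where S: "S \<in> carrier_mat (ndim n M x) (dimv M x)" "?A * S = 1\<^sub>m (dimv M x)"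
      using indec_phi_right_inverse[OF assms x] by blast
    have "?A = ?A * (?B * L + R * ?A)" unfolding LR(5) using right_mult_one_mat[OF Ac] by simp
    also have "\<dots> = ?A * (?B * L) + ?A * (R * ?A)" using Ac Bc LR
      by (intro mult_add_distrib_mat[of _ "dimv M x" "ndim n M x" _ "ndim n M x"]) auto
    also have "?A * (?B * L) = 0\<^sub>m (dimv M x) (ndim n M x)"
      using mult_assoc_dim[of ?A ?B L] LR(1,4) carrD[OF Bc] carrD[OF Ac] carrD[OF LR(1)] by simp
    also have "\<dots> + ?A * (R * ?A) = ?A * (R * ?A)"
      by (rule left_add_zero_mat[OF mult_carrier_mat[OF Ac mult_carrier_mat[OF LR(2) Ac]]])
    also have "\<dots> = ?A * R * ?A"
      using mult_assoc_dim[of ?A R ?A] carrD[OF Ac] carrD[OF LR(2)] by simp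
    \<comment> \<open>The splitting of the kernel gives only \<open>A * R * A = A\<close>; the right
      inverse \<open>S\<close> improves this to \<open>A * R = 1\<close>.\<close>
    finally have "?A * R * ?A * S = ?A * S" by simp
    then have "?A * R * (?A * S) = ?A * S" using mult_assoc_dim[of "?A * R" ?A S]
        carrD[OF Ac] carrD[OF S(1)] carrD[OF LR(2)] by simp
    then have "?A * R = 1\<^sub>m (dimv M x)"
      unfolding S(2) using right_mult_one_mat[OF mult_carrier_mat[OF Ac LR(2)]] by simp
    then show ?thesis using LR Bc by blast
  qed
  then obtain L R where LR: "\<And>x. tvert n x \<Longrightarrow> sinkv M x \<Longrightarrow>
      L x \<in> carrier_mat (dimv N x) (ndim n M x) \<and> R x \<in> carrier_mat (ndim n M x) (dimv M x) \<and>
      L x * psi_mat n N x = 1\<^sub>m (dimv N x) \<and> phi_mat n M x * R x = 1\<^sub>m (dimv M x) \<and>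
      phi_mat n M x * psi_mat n N x = 0\<^sub>m (dimv M x) (dimv N x) \<and>
      psi_mat n N x * L x + R x * phi_mat n M x = 1\<^sub>m (ndim n M x) \<and>
      psi_mat n N x \<in> carrier_mat (ndim n M x) (dimv N x)" by metis
  have ey: "e y \<in> carrier_mat (dimv M y) (dimv M y)"
    if "tvert n x" "sinkv M x" "y \<in> set (nbrs n x)" for x y
    using ec[of y] dN[of y] nbrs_opposite(4)[OF that(1,3)] that(2) by metis
  have Dc: "D x \<in> carrier_mat (ndim n M x) (ndim n M x)" if "tvert n x" "sinkv M x" for x
    unfolding D_def using diag_block_carrier[of "nbrs n x" e "dimv M"] ey[OF that] by blast
  have DD: "D x * D x = D x" if "tvert n x" "sinkv M x" for x
  proof -
    have "D x * D x = diag_block_mat (map (\<lambda>y. e y * e y) (nbrs n x))"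
      unfolding D_def by (rule diag_block_mult[of _ _ "dimv M"]) (use ey[OF that] in auto)
    then show ?thesis using e unfolding D_def idem_endo_def by simp
  qed
  \<comment> \<open>This is commutation of \<open>e\<close> with all arrows out of \<open>x\<close>
    at once. It is computed on transposes, where the column of arrows becomes a row of
    blocks.\<close>
  have DB: "D x * psi_mat n N x = psi_mat n N x * e x" if x: "tvert n x" "sinkv M x" for x
  proof -
    let ?B = "psi_mat n N x"
    have xN: "\<not> sinkv N x" using x oN by simp
    have Bc: "?B \<in> carrier_mat (ndim n M x) (dimv N x)" using LR[OF x] by blast
    have BT: "transpose_mat ?B = hcat (dimv N x) (map (\<lambda>y. transpose_mat (arr N x y)) (nbrs n x))"
      using phi_mat_dualm[OF valid(2) x(1) xN] phi_mat_hcat[of n "dualm N" x] valid(2) x xN by simp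
    have c: "transpose_mat (arr N x y) \<in> carrier_mat (dimv N x) (dimv M y)"
      if "y \<in> set (nbrs n x)" for y
      using arr_carrier(2)[OF valid(2) x(1) that xN] dN[of y] nbrs_opposite(4)[OF x(1) that] x(2)
        by auto
    have "transpose_mat (D x * ?B) = transpose_mat ?B * transpose_mat (D x)"
      using transpose_mult[OF Dc[OF x] Bc] .
    also have
      "\<dots> = hcat (dimv N x) (map (\<lambda>y. transpose_mat (arr N x y) * transpose_mat (e y)) (nbrs n x))"
      unfolding BT D_def using transpose_diag_block[of "nbrs n x" e "dimv M"] ey[OF x]
        hcat_mult_diag[of "nbrs n x" "\<lambda>y. transpose_mat (arr N x y)" "dimv N x" "dimv M" "\<lambda>y. transpose_mat (e y)"] c
      by auto
    also have
      "\<dots> = hcat (dimv N x) (map (\<lambda>y. transpose_mat (e x) * transpose_mat (arr N x y)) (nbrs n x))"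
    proof (intro arg_cong[of _ _ "hcat (dimv N x)"] map_cong refl)
      fix y assume y: "y \<in> set (nbrs n x)"
      have "is_arrow n (orient N) x y"
        using nbrs_opposite[OF x(1) y] x(2) oN unfolding is_arrow_def is_source_def by simp
      then have "arr N x y * e x = e y * arr N x y"
        using e unfolding idem_endo_def is_hom_def by blast
      moreover have "arr N x y \<in> carrier_mat (dimv M y) (dimv N x)" using c[OF y] by simp
      ultimately show
        "transpose_mat (arr N x y) * transpose_mat (e y) = transpose_mat (e x) * transpose_mat (arr N x y)"
        using transpose_mult[of "arr N x y" _ _ "e x"] transpose_mult[OF ey[OF x y], of "arr N x y"]
          ec[of x] by metis
    qed
    also have "\<dots> = transpose_mat (e x) * transpose_mat ?B"
      unfolding BT
        using mult_hcat[of "transpose_mat (e x)" "dimv N x" "dimv N x" "nbrs n x" "\<lambda>y. transpose_mat (arr N x y)" "dimv M"]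
        ec[of x] c by simp
    also have "\<dots> = transpose_mat (?B * e x)" using transpose_mult[OF Bc ec[of x]] by simp
    finally show ?thesis by (metis transpose_transpose)
  qed
  define f where "f v = (if tvert n v \<and> sinkv M v then phi_mat n M v * (D v * R v) else e v)" for v
  \<comment> \<open>Insert \<open>1 = B * L + R * A\<close> after \<open>A * D\<close>: the first
    summand dies because \<open>A * D * B = A * B * e = 0\<close>.\<close>
  have fA: "f x * phi_mat n M x = phi_mat n M x * D x" if x: "tvert n x" "sinkv M x" for x
  proof -
    let ?A = "phi_mat n M x" and ?B = "psi_mat n N x"
    have Ac: "?A \<in> carrier_mat (dimv M x) (ndim n M x)" by simp
    have Bc: "?B \<in> carrier_mat (ndim n M x) (dimv N x)" using LR[OF x] by blast
    have L: "L x \<in> carrier_mat (dimv N x) (ndim n M x)" and R: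
      "R x \<in> carrier_mat (ndim n M x) (dimv M x)"
      using LR[OF x] by auto
    have RA: "R x * ?A \<in> carrier_mat (ndim n M x) (ndim n M x)"
      "?B * L x \<in> carrier_mat (ndim n M x) (ndim n M x)"
      using mult_carrier_mat[OF R Ac] mult_carrier_mat[OF Bc L] .
    have AD: "?A * D x \<in> carrier_mat (dimv M x) (ndim n M x)"
      using mult_carrier_mat[OF Ac Dc[OF x]] .
    have "?A * D x * (?B * L x) = ?A * (D x * ?B) * L x"
      using mult_assoc_dim[of "?A * D x" ?B "L x"] mult_assoc_dim[of ?A "D x" ?B] carrD[OF Ac]
        carrD[OF Bc] carrD[OF L] carrD[OF Dc[OF x]] by simp
    also have "?A * (D x * ?B) = ?A * ?B * e x"
      unfolding DB[OF x] using mult_assoc_dim[of ?A ?B "e x"] carrD[OF Ac]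
        carrD[OF Bc] carrD[OF ec[of x]] by simp
    also have "\<dots> = 0\<^sub>m (dimv M x) (dimv N x)" using LR[OF x] ec[of x] by simp
    also have "\<dots> * L x = 0\<^sub>m (dimv M x) (ndim n M x)" using L by simp
    finally have z: "?A * D x * (?B * L x) = 0\<^sub>m (dimv M x) (ndim n M x)" .
    have "?A * D x = ?A * D x * (?B * L x + R x * ?A)"
      using LR[OF x] right_mult_one_mat[OF AD] by simp
    also have "\<dots> = ?A * D x * (?B * L x) + ?A * D x * (R x * ?A)" using AD RA
      by (intro mult_add_distrib_mat[of _ "dimv M x" "ndim n M x" _ "ndim n M x"]) auto
    also have "\<dots> = ?A * D x * (R x * ?A)"
      unfolding z by (rule left_add_zero_mat[OF mult_carrier_mat[OF AD RA(1)]])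
    also have "\<dots> = f x * ?A"
      unfolding f_def
        using x mult_assoc_dim[of "?A * D x" "R x" ?A] mult_assoc_dim[of ?A "D x" "R x"]
        carrD[OF Ac] carrD[OF R] carrD[OF Dc[OF x]] by simp
    finally show ?thesis by simp
  qed
  have fc: "f v \<in> carrier_mat (dimv M v) (dimv M v)" for v
    using ec[of v] dN[of v] LR[of v] Dc[of v] phi_mat_carrier[of n M v] unfolding f_def
    by (metis mult_carrier_mat)
  have "idem_endo n M f"
    unfolding idem_endo_def is_hom_def
  proof (intro conjI allI impI)
    fix v
    show "f v \<in> carrier_mat (dimv M v) (dimv M v)" by (rule fc)
    show "f v * f v = f v"
    proof (cases "tvert n v \<and> sinkv M v")
      case True
      then have x: "tvert n v" "sinkv M v" by auto
      let ?A = "phi_mat n M v"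
      have Ac: "?A \<in> carrier_mat (dimv M v) (ndim n M v)" by simp
      have R: "R v \<in> carrier_mat (ndim n M v) (dimv M v)" using LR[OF x] by auto
      have fv: "f v = ?A * (D v * R v)" using True unfolding f_def by simp
      have "f v * f v = f v * ?A * (D v * R v)"
        using mult_assoc_dim[of "f v" ?A "D v * R v"] fv carrD[OF fc[of v]] carrD[OF Ac]
          carrD[OF Dc[OF x]] by simp
      also have "\<dots> = ?A * (D v * D v * R v)"
        unfolding fA[OF x]
          using mult_assoc_dim[of ?A "D v" "D v * R v"] mult_assoc_dim[of "D v" "D v" "R v"]
          carrD[OF R] carrD[OF Ac] carrD[OF Dc[OF x]] by simp
      finally show ?thesis unfolding DD[OF x] fv .
    next
      case False
      then have "f v = e v" unfolding f_def by (rule if_not_P)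
      then show ?thesis using e unfolding idem_endo_def by simp
    qed
  next
    fix y x assume a: "is_arrow n (orient M) y x"
    note x = sink_arrow(1,2)[OF a]
    have c: "arr M y x \<in> carrier_mat (dimv M x) (dimv M y)" if "y \<in> set (nbrs n x)" for y
      using arr_carrier(1)[OF valid(1) x(1) that x(2)] .
    have "hcat (dimv M x) (map (\<lambda>y. f x * arr M y x) (nbrs n x)) = hcat (dimv M x) (map (\<lambda>y. arr M y x * e y) (nbrs n x))"
      using fA[OF x] mult_hcat[OF fc[of x], of "nbrs n x" "\<lambda>y. arr M y x" "dimv M"] c
        hcat_mult_diag[of "nbrs n x" "\<lambda>y. arr M y x" "dimv M x" "dimv M" e] ey[OF x]
      unfolding phi_mat_hcat[OF valid(1) x] D_def by simp
    moreover have "f x * arr M y x \<in> carrier_mat (dimv M x) (dimv M y)"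
      "arr M y x * e y \<in> carrier_mat (dimv M x) (dimv M y)" if "y \<in> set (nbrs n x)" for y
      using mult_carrier_mat[OF fc c[OF that]] mult_carrier_mat[OF c[OF that] ey[OF x that]] .
    ultimately have "f x * arr M y x = arr M y x * e y"
      using hcat_eq_iff[of "nbrs n x" "\<lambda>y. f x * arr M y x" "dimv M x" "dimv M" "\<lambda>y. arr M y x * e y"]
        sink_arrow(3)[OF a] by blast
    then show "arr M y x * f y = f x * arr M y x" using sink_arrow(4)[OF a] unfolding f_def by simp
  qed simp
  then show "(\<forall>v. e v = 0\<^sub>m (dimv N v) (dimv N v)) \<or> (\<forall>v. e v = 1\<^sub>m (dimv N v))"
  proof (rule indecE[OF assms(1)])
    assume z: "\<And>v. f v = 0\<^sub>m (dimv M v) (dimv M v)"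
    have 1: "e v = 0\<^sub>m (dimv N v) (dimv N v)" if "\<not> (tvert n v \<and> sinkv M v)" for v
      using z[of v] that dN[of v] unfolding f_def by auto
    have "e v = 0\<^sub>m (dimv N v) (dimv N v)" for v
    proof (cases "tvert n v \<and> sinkv M v")
      case True
      then have x: "tvert n v" "sinkv M v" by auto
      let ?B = "psi_mat n N v"
      have Bc: "?B \<in> carrier_mat (ndim n M v) (dimv N v)" and L:
        "L v \<in> carrier_mat (dimv N v) (ndim n M v)"
        and LB: "L v * ?B = 1\<^sub>m (dimv N v)" using LR[OF x] by auto
      have "e y = 0\<^sub>m (dimv M y) (dimv M y)" if "y \<in> set (nbrs n v)" for y
        using 1[of y] dN[of y] nbrs_opposite(4)[OF x(1) that] x(2) by metis
      then have "D v = 0\<^sub>m (ndim n M v) (ndim n M v)" unfolding D_def by (rule diag_block_zero)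
      then have "?B * e v = 0\<^sub>m (ndim n M v) (dimv N v)" using DB[OF x] Bc by simp
      moreover have "L v * (?B * e v) = e v"
        using mult_assoc_cancel[OF LB, of "e v"] carrD[OF L] carrD[OF Bc] carrD[OF ec[of v]] by simp
      ultimately show ?thesis using L by simp
    qed (use 1 in blast)
    then show ?thesis by blast
  next
    assume z: "\<And>v. f v = 1\<^sub>m (dimv M v)"
    have 1: "e v = 1\<^sub>m (dimv N v)" if "\<not> (tvert n v \<and> sinkv M v)" for v
      using z[of v] that dN[of v] unfolding f_def by auto
    have "e v = 1\<^sub>m (dimv N v)" for v
    proof (cases "tvert n v \<and> sinkv M v")
      case True
      then have x: "tvert n v" "sinkv M v" by auto
      let ?B = "psi_mat n N v"
      have Bc: "?B \<in> carrier_mat (ndim n M v) (dimv N v)" and L: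
        "L v \<in> carrier_mat (dimv N v) (ndim n M v)"
        and LB: "L v * ?B = 1\<^sub>m (dimv N v)" using LR[OF x] by auto
      have "e y = 1\<^sub>m (dimv M y)" if "y \<in> set (nbrs n v)" for y
        using 1[of y] dN[of y] nbrs_opposite(4)[OF x(1) that] x(2) by metis
      then have "D v = 1\<^sub>m (ndim n M v)" unfolding D_def by (rule diag_block_one)
      then have "?B * e v = ?B" using DB[OF x] Bc by simp
      moreover have "L v * (?B * e v) = e v"
        using mult_assoc_cancel[OF LB, of "e v"] carrD[OF L] carrD[OF Bc] carrD[OF ec[of v]] by simp
      ultimately show ?thesis using LB by simp
    qed (use 1 in blast)
    then show ?thesis by blast
  qed
qed

lemma complementary_idem:
  fixes E :: "'k::field mat"
  assumes "E \<in> carrier_mat n n" "E * E = E"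
  shows "(1\<^sub>m n - E) * (1\<^sub>m n - E) = 1\<^sub>m n - E" "E * (1\<^sub>m n - E) = 0\<^sub>m n n"
  "(1\<^sub>m n - E) * E = 0\<^sub>m n n"
proof -
  show 1: "E * (1\<^sub>m n - E) = 0\<^sub>m n n" using mat_mult_1_minus[OF assms(1,1)] assms by simp
  show "(1\<^sub>m n - E) * E = 0\<^sub>m n n" using mat_1_minus_mult[OF assms(1,1)] assms by simp
  have "(1\<^sub>m n - E) * (1\<^sub>m n - E) = (1\<^sub>m n - E) - E * (1\<^sub>m n - E)"
    using mat_1_minus_mult[OF assms(1) minus_carrier_mat[OF assms(1)]] by simp
  also have "\<dots> = 1\<^sub>m n - E" unfolding 1 using assms(1) by (intro eq_matI) auto
  finally show "(1\<^sub>m n - E) * (1\<^sub>m n - E) = 1\<^sub>m n - E" .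
qed

text \<open>Inserting \<open>R * B = 1\<close> on the left and \<open>R' * B' = 1\<close> on the
  right creates the vanishing product.\<close>

lemma split_orthogonal:
  fixes B :: "'k::field mat"
  assumes "B \<in> carrier_mat n k" "R \<in> carrier_mat k n" "B' \<in> carrier_mat n k'"
  "R' \<in> carrier_mat k' n"
    "R * B = 1\<^sub>m k" "R' * B' = 1\<^sub>m k'" "(B * R) * (B' * R') = 0\<^sub>m n n"
  shows "R * B' = 0\<^sub>m k k'"
proof -
  note d = carrier_matD[OF assms(1)] carrD[OF assms(2)] carrD[OF assms(3)] carrD[OF assms(4)]
  have "R * B' = R * (B * (R * B'))" using mult_assoc_cancel[OF assms(5), of "R * B'"] d by simp
  also have "\<dots> = R * (B * (R * (B' * (R' * B'))))"
    unfolding assms(6) using right_mult_one_mat[OF assms(3)] by simp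
  also have "\<dots> = R * (((B * R) * (B' * R')) * B')"
    using mult_assoc_dim[of "B * R" "B' * R'" B'] mult_assoc_dim[of B R "B' * R' * B'"]
      mult_assoc_dim[of B' R' B'] d by simp
  also have "\<dots> = 0\<^sub>m k k'" unfolding assms(7) using assms(2,3) by simp
  finally show ?thesis .
qed

text \<open>The idempotent and its complement are split vertex by vertex. Their images carry
  representations \<open>X\<close> and \<open>Y\<close> whose direct sum is isomorphic to
  \<open>M\<close>, so one of them is zero.\<close>

lemma indecomposable_imp_indec:
  fixes M :: "'k::field qmod"
  assumes ind: "indecomposable n M"
  shows "indec n M"
  unfolding indec_def
proof (intro conjI allI impI)
  show valid: "valid_mod n M" and "\<not> zero_mod M" using ind unfolding indecomposable_def by auto
  fix e assume e: "idem_endo n M e"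
  have ec: "e v \<in> carrier_mat (dimv M v) (dimv M v)" for v using idem_endo_carrier[OF e] .
  have ee: "e v * e v = e v" for v using e unfolding idem_endo_def by blast
  have "\<exists>k B R. B \<in> carrier_mat (dimv M v) k \<and> R \<in> carrier_mat k (dimv M v) \<and> e v = B * R \<and> R * B = 1\<^sub>m k" for v
    using idem_split[OF ec ee] by metis
  then obtain k B R where s: "\<And>v. B v \<in> carrier_mat (dimv M v) (k v)"
    "\<And>v. R v \<in> carrier_mat (k v) (dimv M v)"
    "\<And>v. e v = B v * R v" "\<And>v. R v * B v = 1\<^sub>m (k v)" by metis
  define e' where "e' v = 1\<^sub>m (dimv M v) - e v" for v
  have ec': "e' v \<in> carrier_mat (dimv M v) (dimv M v)" for v
    unfolding e'_def by (rule minus_carrier_mat[OF ec])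
  have ee': "e' v * e' v = e' v" for v unfolding e'_def by (rule complementary_idem[OF ec ee])
  have "\<exists>k B R. B \<in> carrier_mat (dimv M v) k \<and> R \<in> carrier_mat k (dimv M v) \<and> e' v = B * R \<and> R * B = 1\<^sub>m k" for v
    using idem_split[OF ec' ee'] by metis
  then obtain k' B' R' where s': "\<And>v. B' v \<in> carrier_mat (dimv M v) (k' v)"
    "\<And>v. R' v \<in> carrier_mat (k' v) (dimv M v)"
    "\<And>v. e' v = B' v * R' v" "\<And>v. R' v * B' v = 1\<^sub>m (k' v)" by metis
  have orth: "R v * B' v = 0\<^sub>m (k v) (k' v)" "R' v * B v = 0\<^sub>m (k' v) (k v)" for v
    using split_orthogonal[OF s(1,2) s'(1,2) s(4) s'(4), of v]
      split_orthogonal[OF s'(1,2) s(1,2) s'(4) s(4), of v]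
      complementary_idem(2,3)[OF ec[of v] ee] s(3)[of v] s'(3)[of v] unfolding e'_def by simp_all
  define X where "X = \<lparr> orient = orient M, dimv = k, arr = (\<lambda>x y. R y * (arr M x y * B x)) \<rparr>"
  define Y where "Y = \<lparr> orient = orient M, dimv = k', arr = (\<lambda>x y. R' y * (arr M x y * B' x)) \<rparr>"
  have k0: "k v = 0 \<and> k' v = 0" if "dimv M v = 0" for v
  proof -
    have "R v * B v = 0\<^sub>m (k v) (k v)" "R' v * B' v = 0\<^sub>m (k' v) (k' v)"
      using zero_inner_mult[of "R v" "k v" "B v" "k v"]
        zero_inner_mult[of "R' v" "k' v" "B' v" "k' v"]
        s(1,2)[of v] s'(1,2)[of v] unfolding that by blast+
    then show ?thesis using s(4)[of v] s'(4)[of v] by (simp add: one_eq_zero_mat)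
  qed
  have arrc: "arr M x y \<in> carrier_mat (dimv M y) (dimv M x)" if "is_arrow n (orient M) x y" for x y
    using valid that unfolding valid_mod_def by blast
  have fin: "finite {v. dimv M v \<noteq> 0}" "\<And>v. \<not> tvert n v \<Longrightarrow> dimv M v = 0"
    using valid unfolding valid_mod_def by auto
  have sub: "{v. k v \<noteq> 0} \<subseteq> {v. dimv M v \<noteq> 0}" "{v. k' v \<noteq> 0} \<subseteq> {v. dimv M v \<noteq> 0}"
    unfolding subset_iff mem_Collect_eq using k0 by metis+
  have validX: "valid_mod n X"
    unfolding valid_mod_def X_def using finite_subset[OF sub(1) fin(1)] fin(2) k0
      mult_carrier_mat[OF s(2) mult_carrier_mat[OF arrc s(1)]] by auto
  have validY: "valid_mod n Y"
    unfolding valid_mod_def Y_def using finite_subset[OF sub(2) fin(1)] fin(2) k0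
      mult_carrier_mat[OF s'(2) mult_carrier_mat[OF arrc s'(1)]] by auto
  define f where "f v = R v @\<^sub>r R' v" for v
  define g where "g v = acols (B v) (B' v)" for v
  have fc: "f v \<in> carrier_mat (k v + k' v) (dimv M v)" for v
    unfolding f_def using s(2) s'(2) by (rule carrier_append_rows)
  have gc: "g v \<in> carrier_mat (dimv M v) (k v + k' v)" for v
    unfolding g_def using s(1) s'(1) by (rule acols_carrier)
  have gf: "g v * f v = 1\<^sub>m (dimv M v)" for v
  proof -
    have "g v * f v = B v * R v + B' v * R' v"
      unfolding f_def g_def by (rule acols_mult_append_rows[OF s(1) s'(1) s(2) s'(2)])
    also have "\<dots> = e v + e' v" using s(3) s'(3) by simp
    also have "\<dots> = 1\<^sub>m (dimv M v)" unfolding e'_def using ec[of v] by (intro eq_matI) auto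
    finally show ?thesis .
  qed
  have fg: "f v * g v = 1\<^sub>m (k v + k' v)" for v
    unfolding f_def g_def using append_rows_mult_acols[OF s(2) s'(2) s(1) s'(1)] s(4) s'(4) orth
      by simp
  define S where "S = dsum_mod X Y"
  have S: "orient S = orient M" "dimv S v = k v + k' v" for v
    unfolding S_def dsum_mod_def X_def Y_def by auto
  \<comment> \<open>Arrows commute with \<open>e\<close>, so the two off-diagonal blocks
    vanish.\<close>
  have arrS: "arr S x y = f y * (arr M x y * g x)" if a: "is_arrow n (orient M) x y" for x y
  proof -
    note ac = arrc[OF a]
    have com: "arr M x y * e x = e y * arr M x y"
      using e a unfolding idem_endo_def is_hom_def by blast
    have "R y * e y = R y" unfolding s(3)
      by (rule mult_assoc_cancel[OF s(4)[of y]])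
        (use carrD[OF s(1)[of y]] carrD[OF s(2)[of y]] in simp_all)
    have eB: "e x * B x = B x" unfolding s(3) using mult_assoc_dim[of "B x" "R x" "B x"] s(4)[of x]
        carrD[OF s(1)[of x]] carrD[OF s(2)[of x]] right_mult_one_mat[OF s(1)[of x]] by simp
    have eB': "e x * B' x = 0\<^sub>m (dimv M x) (k' x)"
      unfolding s(3) using mult_assoc_dim[of "B x" "R x" "B' x"] orth(1)[of x]
        carrD[OF s(1)[of x]] carrD[OF s(2)[of x]] carrD[OF s'(1)[of x]]
        right_mult_zero_mat[OF s(1)[of x]] by simp
    have R'e: "R' y * e y = 0\<^sub>m (k' y) (dimv M y)"
      unfolding s(3) using mult_assoc_dim[of "R' y" "B y" "R y"] orth(2)[of y]
        carrD[OF s(1)[of y]] carrD[OF s(2)[of y]] carrD[OF s'(2)[of y]]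
        left_mult_zero_mat[OF s(2)[of y]] by simp
    note dims = carrier_matD[OF s(1)[of x]] carrD[OF s(2)[of y]] carrD[OF s'(1)[of x]]
      carrD[OF s'(2)[of y]] carrD[OF ac] carrD[OF ec[of x]] carrD[OF ec[of y]]
    have 1: "R y * (arr M x y * B' x) = 0\<^sub>m (k y) (k' x)"
    proof -
      have "R y * (arr M x y * B' x) = R y * (e y * (arr M x y * B' x))"
        using mult_assoc_dim[of "R y" "e y" "arr M x y * B' x"] \<open>R y * e y = R y\<close> dims by simp
      also have "e y * (arr M x y * B' x) = arr M x y * (e x * B' x)"
        using mult_assoc_dim[of "e y" "arr M x y" "B' x"]
          mult_assoc_dim[of "arr M x y" "e x" "B' x"] com dims by simp
      also have "R y * \<dots> = 0\<^sub>m (k y) (k' x)"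
        unfolding eB' using right_mult_zero_mat[OF ac] right_mult_zero_mat[OF s(2)[of y]] by simp
      finally show ?thesis .
    qed
    have 2: "R' y * (arr M x y * B x) = 0\<^sub>m (k' y) (k x)"
    proof -
      have "R' y * (arr M x y * B x) = R' y * (arr M x y * (e x * B x))" using eB by simp
      also have "arr M x y * (e x * B x) = e y * (arr M x y * B x)"
        using mult_assoc_dim[of "e y" "arr M x y" "B x"] mult_assoc_dim[of "arr M x y" "e x" "B x"]
          com dims by simp
      also have "R' y * (e y * (arr M x y * B x)) = R' y * e y * (arr M x y * B x)"
        using mult_assoc_dim[of "R' y" "e y" "arr M x y * B x"] dims by simp
      also have "\<dots> = 0\<^sub>m (k' y) (k x)" unfolding R'e
        by (rule left_mult_zero_mat[OF mult_carrier_mat[OF ac s(1)[of x]]])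
      finally show ?thesis .
    qed
    have "f y * (arr M x y * g x) = (R y @\<^sub>r R' y) * acols (arr M x y * B x) (arr M x y * B' x)"
      unfolding f_def g_def mult_acols[OF ac s(1) s'(1)] ..
    also have "\<dots> = four_block_mat (R y * (arr M x y * B x)) (R y * (arr M x y * B' x))
        (R' y * (arr M x y * B x)) (R' y * (arr M x y * B' x))"
      by (rule append_rows_mult_acols[OF s(2) s'(2) mult_carrier_mat[OF ac s(1)] mult_carrier_mat[OF ac s'(1)]])
    finally show ?thesis unfolding 1 2 S_def dsum_mod_def X_def Y_def by simp
  qed
  have "iso_mod n M S"
    unfolding iso_mod_def
  proof (rule exI[of _ f], rule exI[of _ g], intro conjI allI)
    show "is_hom n M S f"
      unfolding is_hom_def
    proof (intro conjI allI impI)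
      fix x y assume a: "is_arrow n (orient M) x y"
      have "arr S x y * f x = f y * (arr M x y * (g x * f x))"
        unfolding arrS[OF a]
        using mult_assoc_dim[of "f y" "arr M x y * g x" "f x"]
          mult_assoc_dim[of "arr M x y" "g x" "f x"]
          carrD[OF fc[of y]] carrD[OF fc[of x]] carrD[OF gc[of x]] carrD[OF arrc[OF a]] by simp
      then show "arr S x y * f x = f y * arr M x y"
        unfolding gf using right_mult_one_mat[OF arrc[OF a]] by simp
    qed (use S fc in auto)
    show "is_hom n S M g"
      unfolding is_hom_def
    proof (intro conjI allI impI)
      fix x y assume "is_arrow n (orient S) x y"
      then have a: "is_arrow n (orient M) x y" using S by simp
      have "g y * arr S x y = arr M x y * g x"
        unfolding arrS[OF a]
        by (rule mult_assoc_cancel[OF gf])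
          (use carrD[OF fc[of y]] carrD[OF gc[of y]] carrD[OF arrc[OF a]] in simp_all)
      then show "arr M x y * g x = g y * arr S x y" by simp
    qed (use S gc in auto)
  qed (use gf fg S in auto)
  moreover have "orient X = orient M" "orient Y = orient M" unfolding X_def Y_def by simp_all
  ultimately have "zero_mod X \<or> zero_mod Y"
    using ind validX validY unfolding indecomposable_def S_def by blast
  then show "(\<forall>v. e v = 0\<^sub>m (dimv M v) (dimv M v)) \<or> (\<forall>v. e v = 1\<^sub>m (dimv M v))"
  proof
    assume "zero_mod X"
    then have "k v = 0" for v unfolding zero_mod_def X_def by simp
    then have "e v = 0\<^sub>m (dimv M v) (dimv M v)" for v
      using zero_inner_mult s(1,2)[of v] s(3)[of v] by metis
    then show ?thesis by blast
  next
    assume "zero_mod Y"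
    then have "k' v = 0" for v unfolding zero_mod_def Y_def by simp
    then have "e' v = 0\<^sub>m (dimv M v) (dimv M v)" for v
      using zero_inner_mult s'(1,2)[of v] s'(3)[of v] by metis
    then have "e v = 1\<^sub>m (dimv M v)" for v
      using mat_diff_eq_0[OF one_carrier_mat ec[of v]] unfolding e'_def by metis
    then show ?thesis by blast
  qed
qed

lemma empty_mat_eq:
  assumes "A \<in> carrier_mat m n" "B \<in> carrier_mat m n" "n = 0 \<or> m = 0"
  shows "A = B"
  using assms by (intro eq_matI) auto

text \<open>The identity on \<open>A\<close>, extended by zero, is an idempotent endomorphism:
  arrows inside the support do not leave \<open>A\<close>, and the matrices of all other arrows are
  empty.\<close>

lemma indec_supp_connected:
  fixes M :: "'k::field qmod"
  assumes "indec n M" "A \<subseteq> supp M" "A \<noteq> {}" and cl: "\<And>x y. x \<in> A \<Longrightarrow> y \<in> supp M \<Longrightarrow> tadj n x y \<Longrightarrow> y \<in> A"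
  shows "A = supp M"
proof -
  have valid: "valid_mod n M" using assms unfolding indec_def by auto
  define e where "e v = (if v \<in> A then 1\<^sub>m (dimv M v) else 0\<^sub>m (dimv M v) (dimv M v) :: 'k mat)"
  for v
  have "idem_endo n M e"
    unfolding idem_endo_def is_hom_def
  proof (intro conjI allI impI)
    fix x y assume a: "is_arrow n (orient M) x y"
    have c: "arr M x y \<in> carrier_mat (dimv M y) (dimv M x)"
      using valid a unfolding valid_mod_def by blast
    have t: "tadj n x y" "tadj n y x" using a unfolding is_arrow_def tadj_def by auto
    show "arr M x y * e x = e y * arr M x y"
    proof (cases "x \<in> supp M \<and> y \<in> supp M")
      case True
      then have "x \<in> A \<longleftrightarrow> y \<in> A" using cl t by blast
      then show ?thesis using c unfolding e_def by auto
    next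
      case False
      then have "dimv M x = 0 \<or> dimv M y = 0" unfolding supp_def by auto
      moreover have "e x \<in> carrier_mat (dimv M x) (dimv M x)"
        "e y \<in> carrier_mat (dimv M y) (dimv M y)"
        unfolding e_def by auto
      then have "arr M x y * e x \<in> carrier_mat (dimv M y) (dimv M x)"
        "e y * arr M x y \<in> carrier_mat (dimv M y) (dimv M x)"
        using c mult_carrier_mat by blast+
      ultimately show ?thesis using empty_mat_eq by blast
    qed
  qed (auto simp: e_def)
  then show ?thesis
  proof (rule indecE[OF assms(1)])
    assume z: "\<And>v. e v = 0\<^sub>m (dimv M v) (dimv M v)"
    obtain v where v: "v \<in> A" using assms by blast
    then have "(1\<^sub>m (dimv M v) :: 'k mat) = 0\<^sub>m (dimv M v) (dimv M v)"
      using z[of v] unfolding e_def by simp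
    then show ?thesis using v assms(2) unfolding one_eq_zero_mat supp_def by auto
  next
    assume z: "\<And>v. e v = 1\<^sub>m (dimv M v)"
    have "v \<in> A" if v: "v \<in> supp M" for v
    proof (rule ccontr)
      assume "v \<notin> A"
      then have "(1\<^sub>m (dimv M v) :: 'k mat) = 0\<^sub>m (dimv M v) (dimv M v)"
        using z[of v] unfolding e_def by simp
      then show False using v unfolding one_eq_zero_mat supp_def by auto
    qed
    then show ?thesis using assms(2) by blast
  qed
qed

text \<open>The transpose of \<open>T\<close> is injective and has cokernel \<open>A\<close>, so its
  columns span the kernel of \<open>A\<close>, as do those of \<open>B\<close>. Only simultaneous
  vanishing is recorded, as supports see nothing more.\<close>

lemma kernel_basis_kersp_transpose:
  fixes A B T S :: "'k::field mat"
  assumes "kernel_basis A B" "kernel_basis T (transpose_mat A)"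
    and S: "S \<in> carrier_mat (dim_col T) (dim_row T)" "T * S = 1\<^sub>m (dim_row T)"
  shows "dim_col B = 0 \<longleftrightarrow> dim_row T = 0"
proof -
  define c n k d where "c = dim_row A" and "n = dim_col A" and "k = dim_col B" and "d = dim_row T"
  obtain L R where LR: "L \<in> carrier_mat k n" "R \<in> carrier_mat n c" "L * B = 1\<^sub>m k" "A * B = 0\<^sub>m c k"
    "B * L + R * A = 1\<^sub>m n"
    using assms(1) unfolding kernel_basis_def c_def n_def k_def by blast
  have B: "B \<in> carrier_mat n k"
    using assms(1) unfolding kernel_basis_def n_def k_def by (intro carrier_matI) auto
  have A: "A \<in> carrier_mat c n" unfolding c_def n_def by auto
  have "dim_col T = n" using assms(2) unfolding kernel_basis_def n_def by simp
  then have T: "T \<in> carrier_mat d n" and Sc: "S \<in> carrier_mat n d" using S unfolding d_def by auto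
  obtain L' R' where LR': "L' \<in> carrier_mat c n" "R' \<in> carrier_mat n d"
    "T * transpose_mat A = 0\<^sub>m d c"
    "transpose_mat A * L' + R' * T = 1\<^sub>m n"
    using assms(2) unfolding kernel_basis_def \<open>dim_col T = n\<close> index_transpose_mat c_def[symmetric]
      n_def[symmetric] d_def[symmetric] by blast
  have AT: "transpose_mat A \<in> carrier_mat n c" using A by simp
  have "k = 0" if "d = 0"
  proof -
    have "R' * T = 0\<^sub>m n n" using zero_inner_mult LR'(2) T unfolding that by blast
    then have "transpose_mat A * L' = 1\<^sub>m n" using LR'(4) mult_carrier_mat[OF AT LR'(1)] by simp
    then have BT: "transpose_mat B = transpose_mat B * (transpose_mat A * L')"
      using right_mult_one_mat[of "transpose_mat B" k n] B by simp
    have "transpose_mat B * transpose_mat A = 0\<^sub>m k c" using transpose_mult[OF A B] LR(4) by simp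
    moreover have
      "transpose_mat B * transpose_mat A * L' = transpose_mat B * (transpose_mat A * L')"
      by (rule mult_assoc_dim) (use A B LR'(1) in auto)
    ultimately have "transpose_mat B = 0\<^sub>m k n" using BT left_mult_zero_mat[OF LR'(1), of k] by simp
    then have "B = 0\<^sub>m n k" by (metis transpose_transpose zero_transpose_mat)
    then have "1\<^sub>m k = (0\<^sub>m k k :: 'k mat)" using LR(3) right_mult_zero_mat[OF LR(1), of k] by simp
    then show ?thesis using one_eq_zero_mat by metis
  qed
  moreover have "d = 0" if "k = 0"
  proof -
    have "B * L = 0\<^sub>m n n" using zero_inner_mult LR(1) B unfolding that by blast
    then have "R * A = 1\<^sub>m n" using LR(5) mult_carrier_mat[OF LR(2) A] by simp
    then have AR: "transpose_mat A * transpose_mat R = 1\<^sub>m n"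
      using transpose_mult[OF LR(2) A] by simp
    have "T * transpose_mat A * transpose_mat R = T * (transpose_mat A * transpose_mat R)"
      by (rule mult_assoc_dim) (use A T LR(2) in auto)
    then have "T = 0\<^sub>m d n"
      unfolding LR'(3) AR
        using right_mult_one_mat[OF T] left_mult_zero_mat[of "transpose_mat R" c n d] LR(2) by simp
    then have "1\<^sub>m d = (0\<^sub>m d d :: 'k mat)"
      using S(2) left_mult_zero_mat[OF Sc, of d] unfolding d_def by simp
    then show ?thesis using one_eq_zero_mat by metis
  qed
  ultimately show ?thesis unfolding k_def d_def by blast
qed

lemma orient_shift [simp]: "orient (shift n M) = (\<not> orient M)"
"orient (shift_minus n M) = (\<not> orient M)"
  unfolding shift_def shift_minus_def Let_def by auto

lemma zero_mod_dualm [simp]: "zero_mod (dualm M) \<longleftrightarrow> zero_mod M"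
  unfolding zero_mod_def by simp

text \<open>The part of the isomorphism between \<open>shift n (shift_minus n N)\<close> and
  \<open>N\<close> that supports can see. It bridges the step from a negative power to its
  successor.\<close>

lemma supp_shift_shift_minus:
  fixes N :: "'k::field qmod"
  assumes "indec n N" "\<not> zero_mod (shift_minus n N)"
  shows "supp (shift n (shift_minus n N)) = supp N"
proof -
  define N' N'' where "N' = shift_minus n N" and "N'' = shift n N'"
  have valid: "valid_mod n N" "valid_mod n N'"
    using assms valid_shift unfolding indec_def N'_def by auto
  have r1: "is_refl n (dualm N) (dualm N')"
    unfolding N'_def using is_refl_shift_minus[OF valid(1)] .
  have r2: "is_refl n N' N''" unfolding N''_def using is_refl_shift[OF valid(2)] .
  have oN': "orient N' = (\<not> orient N)" unfolding N'_def by simp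
  have "dimv N'' v = 0 \<longleftrightarrow> dimv N v = 0" for v
  proof (cases "tvert n v")
    case False
    then show ?thesis using r2 valid unfolding is_refl_def valid_mod_def by simp
  next
    case tv: True
    show ?thesis
    proof (cases "sinkv N v")
      case True
      then have "dimv N'' v = dimv N' v" "dimv N' v = dimv N v"
        using r1 r2 oN' unfolding is_refl_def by simp_all
      then show ?thesis by simp
    next
      case False
      then have v: "sinkv N' v" "sinkv (dualm N) v" "\<not> sinkv (dualm N') v" using oN' by auto
      have k1: "kernel_basis (phi_mat n N' v) (psi_mat n N'' v)"
        using r2 tv v unfolding is_refl_def by blast
      have k2: "kernel_basis (phi_mat n (dualm N) v) (psi_mat n (dualm N') v)"
        using r1 tv v unfolding is_refl_def by blast
      have "psi_mat n (dualm N') v = transpose_mat (phi_mat n N' v)"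
        by (rule psi_mat_dualm[OF valid(2) tv v(1)])
      then have k2': "kernel_basis (phi_mat n (dualm N) v) (transpose_mat (phi_mat n N' v))"
        using k2 by simp
      have "\<not> zero_mod (dualm N')" using assms(2) N'_def by simp
      then obtain S where S: "S \<in> carrier_mat (ndim n (dualm N) v) (dimv (dualm N) v)"
        "phi_mat n (dualm N) v * S = 1\<^sub>m (dimv (dualm N) v)"
        using indec_phi_right_inverse[OF indec_dualm[OF assms(1)] r1 _ tv v(2)] by blast
      note d = carrier_matD[OF phi_mat_carrier[of n "dualm N" v]]
      have "dim_col (psi_mat n N'' v) = 0 \<longleftrightarrow> dim_row (phi_mat n (dualm N) v) = 0"
        by (rule kernel_basis_kersp_transpose[OF k1 k2', of S]) (use S d in simp_all)
      then show ?thesis using d(1) carrD(2)[OF psi_mat_carrier[of n N'' v]] by simp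
    qed
  qed
  then show ?thesis unfolding supp_def N'_def N''_def by simp
qed

section \<open>Supports along the shift orbit\<close>

lemma iso_mod_refl:
  assumes "valid_mod n M"
  shows "iso_mod n M M"
  unfolding iso_mod_def
proof (intro exI[of _ "\<lambda>v. 1\<^sub>m (dimv M v)"] conjI allI)
  have "arr M x y * 1\<^sub>m (dimv M x) = 1\<^sub>m (dimv M y) * arr M x y"
    if "is_arrow n (orient M) x y" for x y
  proof -
    have "arr M x y \<in> carrier_mat (dimv M y) (dimv M x)"
      using assms that unfolding valid_mod_def by blast
    then show ?thesis by simp
  qed
  then show "is_hom n M M (\<lambda>v. 1\<^sub>m (dimv M v))" "is_hom n M M (\<lambda>v. 1\<^sub>m (dimv M v))"
    unfolding is_hom_def by simp_all
qed auto

definition sinks :: "'k qmod \<Rightarrow> nat list set" where "sinks M = {v \<in> supp M. sinkv M v}"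
definition sources :: "'k qmod \<Rightarrow> nat list set" where "sources M = {v \<in> supp M. \<not> sinkv M v}"

lemma supp_eq: "supp M = sinks M \<union> sources M"
  unfolding sinks_def sources_def by auto

lemma sinks_dualm [simp]: "sinks (dualm M) = sources M" "sources (dualm M) = sinks M"
  unfolding sinks_def sources_def supp_def by auto

lemma orient_shift_minus_funpow: "orient ((shift_minus n ^^ i) M) \<longleftrightarrow> (orient M \<longleftrightarrow> even i)"
  by (induction i) auto

lemma orient_shift_funpow: "orient ((shift n ^^ i) M) \<longleftrightarrow> (orient M \<longleftrightarrow> even i)"
  by (induction i) auto

lemma orient_shift_pow: "orient (shift_pow n t M) \<longleftrightarrow> (orient M \<longleftrightarrow> even t)"
  unfolding shift_pow_def by (auto simp: orient_shift_minus_funpow orient_shift_funpow even_nat_iff)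

text \<open>The step rules hold only on their own side of zero, because negative powers are built
  from \<open>shift_minus\<close>; hence the later case distinctions on the sign of the
  index.\<close>

lemma shift_pow_Suc: "t \<ge> 0 \<Longrightarrow> shift_pow n (t + 1) M = shift n (shift_pow n t M)"
  unfolding shift_pow_def by (simp add: nat_add_distrib)

lemma shift_pow_pred: "t \<le> 0 \<Longrightarrow> shift_pow n (t - 1) M = shift_minus n (shift_pow n t M)"
proof -
  assume "t \<le> 0"
  then have "nat (- (t - 1)) = Suc (nat (- t))" by simp
  then show ?thesis using \<open>t \<le> 0\<close> unfolding shift_pow_def by (cases "t = 0") auto
qed

section \<open>Supports of indecomposable representations as pairs of discs\<close>

locale regular_tree =
  fixes n :: nat
  assumes three_le: "3 \<le> n"
begin

sublocale tree_metric "{v. tvert n v}" "tadj n" wdist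
  using tree_words[OF three_le] .

lemma is_path_gpath: "is_path n p \<longleftrightarrow> gpath p"
  unfolding is_path_def gpath_def by auto

lemma indec_supp:
  assumes "indec n M"
  shows "finite (supp M)" "supp M \<subseteq> {v. tvert n v}" "supp M \<noteq> {}" "connected (supp M)"
    "finite (sinks M)" "finite (sources M)" "sinks M \<subseteq> {v. tvert n v}" "sources M \<subseteq> {v. tvert n v}"
proof -
  show 1: "finite (supp M)" "supp M \<subseteq> {v. tvert n v}" "supp M \<noteq> {}"
    using assms unfolding indec_def valid_mod_def supp_def zero_mod_def by auto
  show "connected (supp M)"
    unfolding connected_def using indec_supp_connected[OF assms] by blast
  show "finite (sinks M)" "finite (sources M)" "sinks M \<subseteq> {v. tvert n v}"
    "sources M \<subseteq> {v. tvert n v}"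
    using 1 supp_eq[of M] by auto
qed

lemma sinks_sources_parity:
  "x \<in> sinks M \<Longrightarrow> y \<in> sinks M \<Longrightarrow> even (wdist x y)" "x \<in> sources M \<Longrightarrow> y \<in> sources M \<Longrightarrow> even (wdist x y)"
  "x \<in> sinks M \<Longrightarrow> y \<in> sources M \<Longrightarrow> odd (wdist x y)"
  unfolding sinks_def sources_def is_sink_def even_wdist by auto

lemma indec_linked:
  assumes "indec n M" "sinks M \<noteq> {}" "sources M \<noteq> {}"
  shows "linked (sinks M) (sources M)"
  using connected_linked[of "sinks M" "sources M"] indec_supp[OF assms(1)] assms(2,3)
    sinks_sources_parity[of _ M]
  unfolding supp_eq[of M] by blast

lemma disc_sinks_ex: "indec n M \<Longrightarrow> sinks M \<noteq> {} \<Longrightarrow> \<exists>c r. disc c r (sinks M)"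
  using disc_ex[of "sinks M"] indec_supp(5,7)[of M] sinks_sources_parity(1)[of _ M] by blast

lemma disc_sources_ex: "indec n M \<Longrightarrow> sources M \<noteq> {} \<Longrightarrow> \<exists>c r. disc c r (sources M)"
  using disc_ex[of "sources M"] indec_supp(6,8)[of M] sinks_sources_parity(2)[of _ M] by blast

lemma disc_unique: "disc c r X \<Longrightarrow> disc c' r' X \<Longrightarrow> c = c' \<and> r = r'"
proof -
  assume d: "disc c r X" "disc c' r' X"
  then have "wdist c' c + r \<le> r'" "wdist c c' + r' \<le> r"
    using disc_in_ball[OF d(1), of c' r'] disc_in_ball[OF d(2), of c r] discD by blast+
  then show ?thesis using d_eq_0_iff[of c c'] d discD(1) by auto
qed

lemma refl_sinks: "is_refl n M N \<Longrightarrow> sinks N = sources M"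
  using is_refl_supp(1)[of n M N] unfolding is_refl_def sinks_def sources_def by auto

lemma refl_sources_subset: "is_refl n M N \<Longrightarrow> sources N \<subseteq> nbhd (sources M)"
proof
  fix v assume r: "is_refl n M N" and v: "v \<in> sources N"
  then have s: "sinkv M v" unfolding sources_def is_refl_def by auto
  then obtain y where y: "y \<in> supp M" "tadj n v y"
    using is_refl_supp(3)[OF r] v unfolding sources_def by blast
  then have "y \<in> sources M" using s tadj_parity[OF y(2)] unfolding sources_def is_sink_def by auto
  then show "v \<in> nbhd (sources M)" using y adj_sym unfolding nbhd_def by blast
qed

text \<open>A neighbour of a source in the support is a sink; if it carries the zero space, the
  reflection fills it. That all old sinks are such neighbours comes from connectedness of the
  support.\<close>

lemma refl_nbhd:
  assumes "indec n M" "is_refl n M N" "sources M \<noteq> {}"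
  shows "nbhd (sources M) = sinks M \<union> sources N"
proof
  show "nbhd (sources M) \<subseteq> sinks M \<union> sources N"
  proof
    fix v assume "v \<in> nbhd (sources M)"
    then obtain y where y: "y \<in> sources M" "tadj n y v" unfolding nbhd_def by blast
    then have s: "sinkv M v" using tadj_parity[OF y(2)] unfolding sources_def is_sink_def by auto
    show "v \<in> sinks M \<union> sources N"
    proof (cases "v \<in> supp M")
      case False
      then have "v \<in> supp N"
        using is_refl_supp(2)[OF assms(2) s] y adj_sym unfolding sources_def by blast
      then show ?thesis using s assms(2) unfolding sources_def is_refl_def by auto
    qed (use s in \<open>auto simp: sinks_def\<close>)
  qed
  have "sinks M \<subseteq> nbhd (sources M)"
    using indec_linked[OF assms(1) _ assms(3)] unfolding linked_def by (cases "sinks M = {}") auto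
  then show "sinks M \<union> sources N \<subseteq> nbhd (sources M)" using refl_sources_subset[OF assms(2)] by auto
qed

text \<open>A condition that reflection at the sinks preserves and that keeps the reflection nonzero; it
  replaces the isomorphism \<open>\<sigma> \<sigma>\<^sup>- M \<cong> M\<close> when the orbit is continued in both directions from one
  of its members.\<close>

definition grow :: "'k::field qmod \<Rightarrow> bool" where
  "grow M \<longleftrightarrow> indec n M \<and> sinks M \<noteq> {} \<and> sources M \<noteq> {} \<and>
     (\<forall>a r b s. disc a r (sinks M) \<longrightarrow> disc b s (sources M) \<longrightarrow> r \<le> s)"

text \<open>The neighbourhood of the sources has radius \<open>s + 1\<close>, more than that of the
  sinks, so new sources must appear; \<open>next_radius\<close> keeps their radius from
  dropping.\<close>

lemma grow_refl:
  assumes "grow M" "is_refl n M N"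
  shows "grow N"
proof -
  have M: "indec n M" "sinks M \<noteq> {}" "sources M \<noteq> {}" using assms(1) unfolding grow_def by auto
  obtain a r b s where d: "disc a r (sinks M)" "disc b s (sources M)"
    using disc_sinks_ex disc_sources_ex M by metis
  then have rs: "r \<le> s" using assms(1) unfolding grow_def by blast
  have sN: "sinks N = sources M" using refl_sinks assms(2) by blast
  then have "\<not> zero_mod N" using M(3) unfolding sinks_def supp_def zero_mod_def by auto
  then have N: "indec n N" using indec_refl[OF M(1) assms(2)] by blast
  have nbN: "nbhd (sources M) = sinks M \<union> sources N" using refl_nbhd M assms(2) by blast
  have ne: "sources N \<noteq> {}" using nbhd_eq_radius[OF _ d] rs nbN by auto
  have "s' \<le> t" if "disc b' s' (sinks N)" "disc c t (sources N)" for b' s' c t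
  proof -
    have "s' = s" using disc_unique that(1) d(2) unfolding sN by blast
    moreover have "linked (sources N) (sources M)"
      using indec_linked[OF N _ ne] M(3) linked_sym unfolding sN by blast
    ultimately show ?thesis
      using next_radius(1)[OF nbN d that(2) indec_linked[OF M] _ rs] by blast
  qed
  then show ?thesis using N ne M(3) unfolding grow_def sN by blast
qed

lemma grow_indec: "grow M \<Longrightarrow> indec n M"
  unfolding grow_def by blast

lemma grow_shift: "grow M \<Longrightarrow> grow (shift n M)"
  using grow_refl is_refl_shift unfolding grow_def indec_def by blast

lemma grow_shift_minus: "grow (dualm M) \<Longrightarrow> grow (dualm (shift_minus n M))"
proof -
  assume g: "grow (dualm M)"
  then have "valid_mod n M" unfolding grow_def indec_def by simp
  then show ?thesis using grow_refl[OF g] is_refl_shift_minus by blast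
qed

lemma indec_of_dualm: "indec n (dualm M) \<Longrightarrow> indec n M"
  using indec_dualm[of n "dualm M"] by simp

text \<open>Two half-orbits: forwards from \<open>shift n M\<close>, and backwards through duals
  from \<open>dualm M\<close>. The forward condition starts one step late because in a sink module
  the sinks have the larger radius.\<close>

lemma grow_shift_pow:
  assumes "indec n M" "grow (shift n M)" "grow (dualm M)"
  shows "indec n (shift_pow n t M)"
proof (cases "t \<ge> 0")
  case True
  have "grow ((shift n ^^ Suc i) M)" for i
    by (induction i) (use assms(2) grow_shift in auto)
  then have "indec n ((shift n ^^ i) M)" for i
    using assms(1) grow_indec by (cases i) auto
  then show ?thesis using True unfolding shift_pow_def by simp
next
  case False
  have "grow (dualm ((shift_minus n ^^ i) M))" for i
    by (induction i) (use assms(3) grow_shift_minus in auto)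
  then have "indec n ((shift_minus n ^^ i) M)" for i using grow_indec indec_of_dualm by blast
  then show ?thesis using False unfolding shift_pow_def by simp
qed

text \<open>Regularity keeps every shift nonzero, so reflections carry indecomposability from
  \<open>M\<close> in both directions; negative powers pass through the dual.\<close>

lemma regular_indec:
  assumes "regular n M"
  shows "indec n (shift_pow n t M)"
proof -
  have g: "indec n M" and nz: "\<not> zero_mod (shift_pow n t M)" for t
    using assms indecomposable_imp_indec unfolding regular_def by auto
  have 1: "indec n (shift_pow n (int i) M)" for i
  proof (induction i)
    case (Suc i)
    have "shift_pow n (int (Suc i)) M = shift n (shift_pow n (int i) M)"
      using shift_pow_Suc[of "int i" n M] by (simp add: algebra_simps)
    then show ?case
      using indec_refl[OF Suc, of "shift_pow n (int (Suc i)) M"]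
        is_refl_shift[of n "shift_pow n (int i) M"]
        nz[of "int (Suc i)"] Suc unfolding indec_def by simp
  qed (use g in \<open>simp add: shift_pow_def\<close>)
  have 2: "indec n (shift_pow n (- int i) M)" for i
  proof (induction i)
    case (Suc i)
    have "- int (Suc i) = - int i - 1" by simp
    then have e: "shift_pow n (- int (Suc i)) M = shift_minus n (shift_pow n (- int i) M)"
      using shift_pow_pred[of "- int i" n M] by (metis neg_le_0_iff_le of_nat_0_le_iff)
    have "indec n (dualm (shift_pow n (- int (Suc i)) M))"
    proof (rule indec_refl[OF indec_dualm[OF Suc]])
      show "is_refl n (dualm (shift_pow n (- int i) M)) (dualm (shift_pow n (- int (Suc i)) M))"
        unfolding e using is_refl_shift_minus Suc unfolding indec_def by blast
    qed (use nz in simp)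
    then show ?case by (rule indec_of_dualm)
  qed (use g in \<open>simp add: shift_pow_def\<close>)
  show ?thesis
    using 1[of "nat t"] 2[of "nat (- t)"] by (cases "t \<ge> 0") auto
qed

text \<open>For nonpositive indices a step back in time is a reflection between duals, where sinks
  and sources have changed places.\<close>

lemma shift_orbit:
  assumes indec: "\<And>t. indec n (shift_pow n t M)"
  obtains c \<rho> where "orbit (\<lambda>t. sources (shift_pow n t M)) c \<rho>"
    "\<And>t. sinks (shift_pow n t M) = sources (shift_pow n (t - 1) M)"
proof -
  define S where "S t = shift_pow n t M" for t
  have up: "is_refl n (S t) (S (t + 1))" if "t \<ge> 0" for t
    using shift_pow_Suc[OF that] is_refl_shift indec[of t] unfolding S_def indec_def by metis
  have down: "is_refl n (dualm (S t)) (dualm (S (t - 1)))" if "t \<le> 0" for t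
    using shift_pow_pred[OF that] is_refl_shift_minus indec[of t] unfolding S_def indec_def by metis
  have g: "indec n (S t)" for t unfolding S_def by (rule indec)
  have sinks: "sinks (S t) = sources (S (t - 1))" for t
  proof (cases "t \<ge> 1")
    case True then show ?thesis using refl_sinks[OF up[of "t - 1"]] by simp
  next
    case False then show ?thesis using refl_sinks[OF down[of t]] by simp
  qed
  \<comment> \<open>An empty set of sources would leave one of two adjacent members without any
    support: there are neither vertices to keep nor neighbours to fill.\<close>
  have ne: "sources (S t) \<noteq> {}" for t
  proof
    assume e: "sources (S t) = {}"
    show False
    proof (cases "t \<ge> 0")
      case True
      have "sinks (S (t + 1)) = {}" using sinks[of "t + 1"] e by simp
      moreover have "sources (S (t + 1)) = {}"
        using refl_sources_subset[OF up[OF True]] e unfolding nbhd_def by simp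
      ultimately show False using indec_supp(3)[OF g[of "t + 1"]] supp_eq by blast
    next
      case False
      then have r: "is_refl n (dualm (S (t + 1))) (dualm (S t))" using down[of "t + 1"] by simp
      have "sinks (S (t + 1)) = {}" using sinks[of "t + 1"] e by simp
      then have "sinks (S t) = {}" using refl_sources_subset[OF r] unfolding nbhd_def by simp
      then show False using indec_supp(3)[OF g[of t]] supp_eq e by blast
    qed
  qed
  have "\<exists>c r. disc c r (sources (S t))" for t using disc_sources_ex g ne by blast
  then obtain c \<rho> where D: "\<And>t. disc (c t) (\<rho> t) (sources (S t))" by metis
  have "nbhd (sources (S t)) = sources (S (t - 1)) \<union> sources (S (t + 1))" for t
  proof (cases "t \<ge> 0")
    case True
    then show ?thesis using refl_nbhd[OF g up ne] sinks[of t] by simp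
  next
    case False
    have "nbhd (sources (dualm (S (t + 1)))) = sinks (dualm (S (t + 1))) \<union> sources (dualm (S t))"
      by (rule refl_nbhd)
        (use down[of "t + 1"] False indec_dualm[OF g] sinks[of "t + 1"] ne in auto)
    then show ?thesis using sinks[of t] sinks[of "t + 1"] by auto
  qed
  moreover have "even (wdist x y) \<longleftrightarrow> even (i - j)"
    if "x \<in> sources (S i)" "y \<in> sources (S j)" for i j x y
    using that unfolding sources_def is_sink_def S_def even_wdist mem_Collect_eq orient_shift_pow
      by auto
  ultimately have "orbit (\<lambda>t. sources (S t)) c \<rho>" unfolding orbit_def using D by blast
  then show ?thesis using that sinks unfolding S_def by blast
qed

section \<open>Diameter paths and the three types of modules\<close>

lemma diamI:
  assumes "\<exists>p. gpath p \<and> set p \<subseteq> supp M \<and> length p = Suc k"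
  "\<forall>p. gpath p \<and> set p \<subseteq> supp M \<longrightarrow> length p \<le> Suc k"
  shows "diam n M = k" "diam_paths n M \<noteq> {}"
    "p \<in> diam_paths n M \<Longrightarrow> gpath p \<and> set p \<subseteq> supp M \<and> length p = Suc k"
proof -
  obtain q where q: "gpath q" "set q \<subseteq> supp M" "length q = Suc k" using assms(1) by blast
  have le: "x \<le> k" if "x \<in> {plen p | p. is_path n p \<and> set p \<subseteq> supp M}" for x
    using that assms(2) unfolding plen_def is_path_gpath by fastforce
  then have "finite {plen p | p. is_path n p \<and> set p \<subseteq> supp M}"
    by (meson finite_nat_set_iff_bounded_le)
  moreover have "k \<in> {plen p | p. is_path n p \<and> set p \<subseteq> supp M}"
    using q unfolding plen_def is_path_gpath by force
  ultimately show d: "diam n M = k" unfolding diam_def using le by (intro Max_eqI) auto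
  show "diam_paths n M \<noteq> {}" using q d unfolding diam_paths_def plen_def is_path_gpath by auto
  show "p \<in> diam_paths n M \<Longrightarrow> gpath p \<and> set p \<subseteq> supp M \<and> length p = Suc k"
    using d unfolding diam_paths_def plen_def is_path_gpath gpath_def by (cases p) auto
qed

lemma even_center:
  assumes "connected (A \<union> B)" "supp M = A \<union> B" "disc c r A" "disc c s B" "s < r"
  shows "radius n M = r" "has_center n M {c}" "diam_paths n M \<noteq> {}"
    "p \<in> diam_paths n M \<Longrightarrow> hd p \<in> A \<and> last p \<in> A"
proof -
  note P = even_center_paths[OF assms(1,3-5)]
  have ex: "\<exists>p. gpath p \<and> set p \<subseteq> supp M \<and> length p = Suc (2 * r)" using P(1) assms(2) by simp
  have le: "\<forall>p. gpath p \<and> set p \<subseteq> supp M \<longrightarrow> length p \<le> Suc (2 * r)" using P(2) assms(2) by auto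
  note D = diamI[OF ex le]
  show "radius n M = r" using D(1) unfolding radius_def by simp
  show "diam_paths n M \<noteq> {}" by (rule D(2))
  have "p ! r = c \<and> hd p \<in> A \<and> last p \<in> A" if "p \<in> diam_paths n M" for p
    using D(3)[OF that] P(3) assms(2) by simp
  then show "p \<in> diam_paths n M \<Longrightarrow> hd p \<in> A \<and> last p \<in> A" "has_center n M {c}"
    using D(3) unfolding has_center_def path_center_def plen_def Let_def by auto
qed

lemma odd_center:
  assumes "connected (A \<union> B)" "supp M = A \<union> B" "disc a r A" "disc b r B" "linked A B"
  shows "radius n M = r" "has_center n M {a, b}" "diam_paths n M \<noteq> {}" "flow_mod n M"
proof -
  note P = odd_center_paths[OF assms(1,3-5)]
  have ex: "\<exists>p. gpath p \<and> set p \<subseteq> supp M \<and> length p = Suc (2 * r + 1)" using P(1) assms(2) by simp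
  have le: "\<forall>p. gpath p \<and> set p \<subseteq> supp M \<longrightarrow> length p \<le> Suc (2 * r + 1)" using P(2) assms(2) by auto
  note D = diamI[OF ex le]
  show "radius n M = r" using D(1) unfolding radius_def by simp
  show "flow_mod n M" unfolding flow_mod_def using D(1) by simp
  show "diam_paths n M \<noteq> {}" by (rule D(2))
  have "{p ! r, p ! Suc r} = {a, b}" if "p \<in> diam_paths n M" for p
    using D(3)[OF that] P(3) assms(2) by simp
  then show "has_center n M {a, b}"
    using D(3) unfolding has_center_def path_center_def plen_def Let_def by auto
qed

text \<open>A diameter path must be known to exist, since the types quantify over all such paths and
  could hold vacuously. Ends that are both sinks are at even distance.\<close>

lemma not_sink_and_flow:
  assumes "indec n M" "diam_paths n M \<noteq> {}" "sink_mod n M"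
  shows "\<not> flow_mod n M" "\<not> source_mod n M"
proof -
  obtain p where p: "p \<in> diam_paths n M" using assms by blast
  then have s: "sinkv M (hd p)" "sinkv M (last p)" using assms unfolding sink_mod_def by auto
  then show "\<not> source_mod n M" using p unfolding source_mod_def is_source_def by auto
  have "gpath p" "plen p = diam n M" using p unfolding diam_paths_def is_path_gpath by auto
  then have "wdist (hd p) (last p) = diam n M" using gpath_ends(1) unfolding plen_def by auto
  then show "\<not> flow_mod n M"
    using s even_wdist[of "hd p" "last p"] unfolding flow_mod_def is_sink_def by auto
qed

context
  fixes M :: "'k::field qmod" and c \<rho>
  assumes O: "orbit (\<lambda>t. sources (shift_pow n t M)) c \<rho>"
    and S: "\<And>t. sinks (shift_pow n t M) = sources (shift_pow n (t - 1) M)"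
    and G: "\<And>t. indec n (shift_pow n t M)"
begin

lemma discs: "disc (c t) (\<rho> t) (sources (shift_pow n t M))"
"disc (c (t - 1)) (\<rho> (t - 1)) (sinks (shift_pow n t M))"
  using O S[of t] unfolding orbit_def by auto

lemma conn: "connected (sinks (shift_pow n t M) \<union> sources (shift_pow n t M))"
    "connected (sources (shift_pow n t M) \<union> sinks (shift_pow n t M))"
  using indec_supp(4)[OF G[of t]] unfolding supp_eq by (simp_all add: Un_commute)

text \<open>The sinks form the larger of two concentric discs, so the diameter paths end in them and
  the radius of the module is that of its sinks.\<close>

lemma sink_type:
  assumes "\<rho> (t - 1) = \<rho> t + 1"
  shows "sink_mod n (shift_pow n t M)" "radius n (shift_pow n t M) = \<rho> t + 1"
  "has_center n (shift_pow n t M) {c t}"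
    "diam_paths n (shift_pow n t M) \<noteq> {}"
proof -
  have "c (t - 1) = c t" using orbit_step(1)[OF O, of "t - 1"] assms by simp
  then have d: "disc (c t) (\<rho> t + 1) (sinks (shift_pow n t M))" using discs(2)[of t] assms by simp
  note E = even_center[OF conn(1) supp_eq d discs(1)]
  show "radius n (shift_pow n t M) = \<rho> t + 1" "has_center n (shift_pow n t M) {c t}"
    "diam_paths n (shift_pow n t M) \<noteq> {}" by (rule E; simp)+
  show "sink_mod n (shift_pow n t M)"
    unfolding sink_mod_def using E(4) unfolding sinks_def by simp
qed

lemma source_type:
  assumes "\<rho> t = \<rho> (t - 1) + 1"
  shows "source_mod n (shift_pow n t M)" "radius n (shift_pow n t M) = \<rho> t"
  "has_center n (shift_pow n t M) {c t}"
    "diam_paths n (shift_pow n t M) \<noteq> {}"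
proof -
  have "c (t - 1) = c t" using orbit_step(1)[OF O, of "t - 1"] assms by simp
  then have d: "disc (c t) (\<rho> (t - 1)) (sinks (shift_pow n t M))" using discs(2)[of t] by simp
  have s: "supp (shift_pow n t M) = sources (shift_pow n t M) \<union> sinks (shift_pow n t M)"
    using supp_eq by blast
  note E = even_center[OF conn(2) s discs(1) d]
  show "radius n (shift_pow n t M) = \<rho> t" "has_center n (shift_pow n t M) {c t}"
    "diam_paths n (shift_pow n t M) \<noteq> {}" by (rule E; use assms in simp)+
  show "source_mod n (shift_pow n t M)"
    unfolding source_mod_def is_source_def using E(4) assms unfolding sources_def by simp
qed

lemma flow_type:
  assumes "\<rho> t = \<rho> (t - 1)"
  shows "flow_mod n (shift_pow n t M)" "radius n (shift_pow n t M) = \<rho> t"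
    "has_center n (shift_pow n t M) {c (t - 1), c t}" "diam_paths n (shift_pow n t M) \<noteq> {}"
proof -
  have d: "disc (c (t - 1)) (\<rho> t) (sinks (shift_pow n t M))" using discs(2)[of t] assms by simp
  have l: "linked (sinks (shift_pow n t M)) (sources (shift_pow n t M))"
    using indec_linked[OF G[of t]] discs[of t] discD(4) by blast
  show "flow_mod n (shift_pow n t M)" "radius n (shift_pow n t M) = \<rho> t"
    "has_center n (shift_pow n t M) {c (t - 1), c t}" "diam_paths n (shift_pow n t M) \<noteq> {}"
    using odd_center[OF conn(1) supp_eq d discs(1) l] by blast+
qed

text \<open>Consecutive radii differ by at most one, and in the other two cases the module is a flow
  or source module, which a sink module is not.\<close>

lemma sink_mod_iff: "sink_mod n (shift_pow n t M) \<longleftrightarrow> \<rho> (t - 1) = \<rho> t + 1"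
  using sink_type[of t] source_type[of t] flow_type[of t] not_sink_and_flow[OF G[of t]]
    orbit_step(2)[OF O, of "t - 1"] by auto

end

end

theorem theorem1:
  fixes n :: nat and M :: "'k::field qmod"
  assumes "n \<ge> 3" and "regular n M"
  shows "\<exists>t0. let M0 = shift_pow n t0 M; r0 = radius n M0 in
    sink_mod n M0 \<and>
    (\<forall>t. sink_mod n (shift_pow n t M) \<longrightarrow> r0 \<le> radius n (shift_pow n t M)) \<and>
    (\<forall>t. sink_mod n (shift_pow n t M) \<and> radius n (shift_pow n t M) = r0
         \<longrightarrow> iso_mod n (shift_pow n t M) M0) \<and>
    r0 \<ge> 1 \<and>
    (\<exists>b a. b \<le> r0 \<and> length a = Suc b \<and> is_path n a \<and>
       (\<forall>i::nat. sink_mod n (shift_pow n (- int i) M0) \<and>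
                 radius n (shift_pow n (- int i) M0) = r0 + i \<and>
                 has_center n (shift_pow n (- int i) M0) {a ! 0}) \<and>
       (\<forall>i::nat. 1 \<le> i \<and> i \<le> b \<longrightarrow>
                 flow_mod n (shift_pow n (int i) M0) \<and>
                 radius n (shift_pow n (int i) M0) = r0 - 1 \<and>
                 has_center n (shift_pow n (int i) M0) {a ! (i - 1), a ! i}) \<and>
       (\<forall>i::nat. source_mod n (shift_pow n (int (b + 1 + i)) M0) \<and>
                 radius n (shift_pow n (int (b + 1 + i)) M0) = r0 + i \<and>
                 has_center n (shift_pow n (int (b + 1 + i)) M0) {a ! b}) \<and>
       (if even r0 then is_sink (orient M0) (a ! 0) else is_source (orient M0) (a ! 0)))"
proof -
  interpret regular_tree n using assms(1) by unfold_locales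
  have G: "indec n (shift_pow n t M)" for t using regular_indec[OF assms(2)] .
  obtain c \<rho> where O: "orbit (\<lambda>t. sources (shift_pow n t M)) c \<rho>"
    and S: "\<And>t. sinks (shift_pow n t M) = sources (shift_pow n (t - 1) M)"
    using shift_orbit[OF G] by metis
  \<comment> \<open>A descent followed by no descent: the last sink module of the orbit.\<close>
  obtain t0 where t0: "\<rho> (t0 - 1) = \<rho> t0 + 1" "\<rho> t0 \<le> \<rho> (t0 + 1)" using orbit_valley[OF O] by blast
  define M0 where "M0 = shift_pow n t0 M"
  have D: "disc (c t) (\<rho> t) (sources (shift_pow n t M))" for t using O unfolding orbit_def by blast
  have ne: "sources (shift_pow n t M) \<noteq> {}" for t using D discD(4) by blast
  have uD: "r = \<rho> t" if "disc a r (sources (shift_pow n t M))" for a r t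
    using disc_unique[OF that D] by blast
  have good0: "indec n M0" unfolding M0_def by (rule G)
  have snk0: "sinks M0 = sources (shift_pow n (t0 - 1) M)" "sources M0 = sources (shift_pow n t0 M)"
    unfolding M0_def using S by auto
  \<comment> \<open>In the dual the sinks of \<open>M0\<close> become the sources, and theirs is the
    larger radius \<open>\<rho> t0 + 1\<close>.\<close>
  have grow_dual: "grow (dualm M0)"
    unfolding grow_def sinks_dualm snk0 using indec_dualm[OF good0] ne uD t0(1) by fastforce
  \<comment> \<open>For negative \<open>t0\<close> the module \<open>shift n M0\<close> is a
    \<open>shift\<close> after a \<open>shift_minus\<close> and need not be the next member of the
    orbit; support and orientation agree nevertheless.\<close>
  have parts1:
    "sinks (shift n M0) = sources (shift_pow n t0 M) \<and> sources (shift n M0) = sources (shift_pow n (t0 + 1) M)"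
  proof -
    have "supp (shift n M0) = supp (shift_pow n (t0 + 1) M)"
    proof (cases "t0 \<ge> 0")
      case True then show ?thesis using shift_pow_Suc unfolding M0_def by metis
    next
      case False
      then have e: "M0 = shift_minus n (shift_pow n (t0 + 1) M)" 
        using shift_pow_pred[of "t0 + 1" n M] unfolding M0_def by simp
      have "\<not> zero_mod M0" using good0 unfolding indec_def by blast
      then show ?thesis using supp_shift_shift_minus[OF G[of "t0 + 1"]] unfolding e by blast
    qed
    moreover have "orient (shift n M0) = orient (shift_pow n (t0 + 1) M)"
      unfolding M0_def orient_shift orient_shift_pow by auto
    ultimately have "sinks (shift n M0) = sinks (shift_pow n (t0 + 1) M)"
      "sources (shift n M0) = sources (shift_pow n (t0 + 1) M)"
      unfolding sinks_def sources_def by auto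
    then show ?thesis using S[of "t0 + 1"] by simp
  qed
  have r1: "is_refl n M0 (shift n M0)" using is_refl_shift good0 unfolding indec_def by blast
  have "\<not> zero_mod (shift n M0)"
    using parts1 ne[of t0] unfolding sinks_def supp_def zero_mod_def by auto
  then have "indec n (shift n M0)" using indec_refl[OF good0 r1] by blast
  then have grow1: "grow (shift n M0)"
    unfolding grow_def using parts1 ne uD t0(2) by fastforce
  have G0: "indec n (shift_pow n t M0)" for t by (rule grow_shift_pow[OF good0 grow1 grow_dual])
  obtain c' \<rho>' where O': "orbit (\<lambda>t. sources (shift_pow n t M0)) c' \<rho>'"
    and S': "\<And>t. sinks (shift_pow n t M0) = sources (shift_pow n (t - 1) M0)"
    using shift_orbit[OF G0] by metis
  have D': "disc (c' t) (\<rho>' t) (sources (shift_pow n t M0))" for t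
    using O' unfolding orbit_def by blast
  have p0: "shift_pow n 0 M0 = M0" "shift_pow n 1 M0 = shift n M0" unfolding shift_pow_def by auto
  \<comment> \<open>The new orbit shares its source sets at the indices -1, 0 and 1 with the old one
    around \<open>t0\<close>, so the valley reappears at 0.\<close>
  have "\<rho>' 0 = \<rho> t0" using uD D'[of 0] snk0(2) p0 by metis
  moreover have "\<rho>' (- 1) = \<rho> (t0 - 1)" using uD D'[of "- 1"] snk0(1) S'[of 0] p0 by simp
  moreover have "\<rho>' 1 = \<rho> (t0 + 1)" using uD D'[of 1] parts1 p0 by metis
  ultimately have v: "\<rho>' (0 - 1) = \<rho>' 0 + 1" "\<rho>' 0 \<le> \<rho>' (0 + 1)" and \<rho>0: "\<rho>' 0 = \<rho> t0"
    using t0 by auto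
  define r0 where "r0 = radius n M0"
  have r0: "r0 = \<rho>' 0 + 1" "sink_mod n M0"
    using sink_type(1,2)[OF O' S' G0 v(1)] unfolding p0 r0_def by auto
  \<comment> \<open>From the valley on the radii never decrease, so no later member is a sink
    module; earlier ones have larger radius by \<open>rad\<close>.\<close>
  have mono: "\<rho> (t0 + int k) \<le> \<rho> (t0 + int k + 1)" for k
  proof (induction k)
    case (Suc k)
    show ?case
      by (rule orbit_next(1)[OF O, of "t0 + int k"]) (use Suc in \<open>auto simp: algebra_simps\<close>)
  qed (use t0 in simp)
  have after: "\<rho> (t - 1) \<noteq> \<rho> t + 1" if "t > t0" for t
  proof -
    define k where "k = nat (t - t0 - 1)"
    have "t0 + int k = t - 1" using that unfolding k_def by simp
    then show ?thesis using mono[of k] by simp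
  qed
  have below: "\<exists>i. t = t0 - int i" if "sink_mod n (shift_pow n t M)" for t
  proof -
    have "\<not> t > t0" using that after sink_mod_iff[OF O S G] by blast
    then have "t = t0 - int (nat (t0 - t))" by simp
    then show ?thesis by blast
  qed
  have rad: "radius n (shift_pow n (t0 - int i) M) = r0 + i" for i
  proof -
    have "\<rho> (t0 - int i) = \<rho> t0 + i" "\<rho> (t0 - int (Suc i)) = \<rho> t0 + Suc i"
      using orbit_before_valley[OF O t0(1), of i] orbit_before_valley[OF O t0(1), of "Suc i"]
        by blast+
    then have "\<rho> (t0 - int i - 1) = \<rho> (t0 - int i) + 1" by (simp add: algebra_simps)
    then show ?thesis using sink_type(2)[OF O S G] r0 \<rho>0 \<open>\<rho> (t0 - int i) = \<rho> t0 + i\<close> by simp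
  qed
  obtain b where b: "b \<le> \<rho>' 0 + 1" "\<And>k. k \<le> b \<Longrightarrow> \<rho>' (0 + int k) = \<rho>' 0"
    "\<rho>' (0 + int b + 1) = \<rho>' 0 + 1"
    "gpath (map (\<lambda>k. c' (0 + int k)) [0..<Suc b])" using orbit_valley_run[OF O' v] by blast
  define a where "a = map (\<lambda>k. c' (int k)) [0..<Suc b]"
  have an: "a ! k = c' (int k)" if "k \<le> b" for k using that unfolding a_def by (simp del: upt_Suc)
  have sinks:
    "sink_mod n (shift_pow n (- int i) M0) \<and> radius n (shift_pow n (- int i) M0) = r0 + i \<and>
      has_center n (shift_pow n (- int i) M0) {a ! 0}" for i
  proof -
    have e: "\<rho>' (- int i) = \<rho>' 0 + i" "c' (- int i) = c' 0" "\<rho>' (- int (Suc i)) = \<rho>' 0 + Suc i"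
      using orbit_before_valley[OF O' v(1), of i] orbit_before_valley[OF O' v(1), of "Suc i"]
        by auto
    have prev: "- int i - 1 = - int (Suc i)" by simp
    have "\<rho>' (- int i - 1) = \<rho>' (- int i) + 1" unfolding prev e(1,3) by simp
    then show ?thesis using sink_type(1-3)[OF O' S' G0, of "- int i"] e(1,2) r0 an[of 0] by simp
  qed
  have flows: "flow_mod n (shift_pow n (int i) M0) \<and> radius n (shift_pow n (int i) M0) = r0 - 1 \<and>
      has_center n (shift_pow n (int i) M0) {a ! (i - 1), a ! i}" if "1 \<le> i" "i \<le> b" for i
  proof -
    have e: "\<rho>' (int i) = \<rho>' 0" "\<rho>' (int i - 1) = \<rho>' 0" "int (i - 1) = int i - 1"
      using b(2)[of i] b(2)[of "i - 1"] that by (auto simp: of_nat_diff)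
    then show ?thesis using flow_type(1-3)[OF O' S' G0, of "int i"] r0 an[of i] an[of "i - 1"] that
      by simp
  qed
  have sources:
    "source_mod n (shift_pow n (int (b + 1 + i)) M0) \<and> radius n (shift_pow n (int (b + 1 + i)) M0) = r0 + i \<and>
      has_center n (shift_pow n (int (b + 1 + i)) M0) {a ! b}" for i
  proof -
    have "\<rho>' (int b + 1) = \<rho>' (int b) + 1" using b(3) b(2)[of b] by simp
    from orbit_after_valley[OF O' this, of i] orbit_after_valley[OF O' this, of "Suc i"]
    have e: "\<rho>' (int b + int i) = \<rho>' 0 + i" "\<rho>' (int (b + 1 + i)) = \<rho>' 0 + 1 + i"
      "c' (int (b + 1 + i)) = c' (int b)"
      using b(2)[of b] by (auto simp: algebra_simps)
    moreover have "int (b + 1 + i) - 1 = int b + int i" by simp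
    ultimately show ?thesis using source_type(1-3)[OF O' S' G0, of "int (b + 1 + i)"] r0 an[of b]
      by simp
  qed
  \<comment> \<open>Some sink of the support is at distance exactly \<open>r0\<close> from
    \<open>a ! 0\<close>, and sinks and sources alternate along edges.\<close>
  have ori: "if even r0 then is_sink (orient M0) (a ! 0) else is_source (orient M0) (a ! 0)"
  proof -
    have "disc (c' (0 - 1)) (\<rho>' (0 - 1)) (sinks M0)" using D'[of "0 - 1"] S'[of 0] p0 by simp
    moreover have "c' (0 - 1) = c' 0" using orbit_before_valley[OF O' v(1), of 1] by simp
    ultimately obtain u where u: "u \<in> sinks M0" "wdist (c' 0) u = r0"
      using disc_ends v(1) r0 by metis
    then have "even r0 \<longleftrightarrow> (even (length (c' 0)) \<longleftrightarrow> even (length u))" using even_wdist by metis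
    moreover have "is_sink (orient M0) u" using u unfolding sinks_def by simp
    ultimately show ?thesis using an[of 0] unfolding is_sink_def is_source_def by auto
  qed
  show ?thesis
    unfolding Let_def M0_def[symmetric] r0_def[symmetric]
  proof (intro exI[of _ t0], unfold M0_def[symmetric] r0_def[symmetric], intro conjI allI impI)
    show "sink_mod n M0" "r0 \<ge> 1" using r0 by auto
    fix t assume "sink_mod n (shift_pow n t M)"
    then show "r0 \<le> radius n (shift_pow n t M)" using below rad by fastforce
  next
    \<comment> \<open>Equal radius forces the index \<open>t0\<close> itself, so the required
      isomorphism is the identity.\<close>
    fix t assume t: "sink_mod n (shift_pow n t M) \<and> radius n (shift_pow n t M) = r0"
    then obtain i where "t = t0 - int i" using below by blast
    then have "t = t0" using t rad[of i] by simp
    then show "iso_mod n (shift_pow n t M) M0"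
      using iso_mod_refl good0 unfolding M0_def indec_def by blast
  qed (rule exI[of _ b], rule exI[of _ a],
      use b(1,4) r0 sinks flows sources ori in \<open>auto simp: a_def is_path_gpath\<close>)
qed

end
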